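(* Let $B$ be a von Neumann algebra, $(A_i)_{i\in I}$ a family of von Neumann algebras all containing $B$, and $E_i:A_i\to B$ normal faithful conditional expectations. Let $\pi_i:A_i\to\ast_{i\in I}(A_i,E_i)$ be the canonical $^*$-homomorphisms into the reduced free product with amalgamation over $B$. Let $a_i\in A_i$ with $E_i(a_i)=0$, such that only finitely many $a_i$'s are different from $0$. Then $$\Bigl\|\sum_i\pi_i(a_i)\Bigr\|\le\sup_i\|a_i\|+\Bigl\|\sum_iE_i(a_i^*a_i)\Bigr\|^{1/2}+\Bigl\|\sum_iE_i(a_ia_i^* )\Bigr\|^{1/2}.$$
   Context: The reduced amalgamated free product is constructed on a Fock module. Let $L_\infty^c(A_i,E_i)$ be the completion of $A_i$ for the norm $\|E_i(x^*x)\|^{1/2}$, a Hilbert $C^*$-module over $B$, and $\mathcal H_i=L_\infty^c(A_i,E_i)\ominus B$. Put $\mathcal H=B\oplus\sum_{n\ge1,\,i_1\ne i_2\ne\cdots\ne i_n}\mathcal H_{i_1}\otimes_B\cdots\otimes_B\mathcal H_{i_n}$, and let $\mathcal L(\mathcal H)$ be the $C^*$-algebra of adjointable right $B$-module maps. The $^*$-homomorphism $\pi_i:A_i\to\mathcal L(\mathcal H)$ acts by left multiplication if $a\in B$; if $E_i(a)=0$, then $\pi_i(a)(h_{i_1}\otimes\cdots\otimes h_{i_n})=a\otimes h_{i_1}\otimes\cdots\otimes h_{i_n}$ when $i_1\ne i$, and $\pi_i(a)(h_{i_1}\otimes\cdots\otimes h_{i_n})=(ah_{i_1}-E_i(ah_{i_1}))\otimes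 h_{i_2}\otimes\cdots\otimes h_{i_n}+E_i(ah_{i_1})h_{i_2}\otimes\cdots\otimes h_{i_n}$ when $i_1=i$. $\ast_{i\in I}(A_i,E_i)$ is the $C^*$-algebra generated by the $\pi_i(A_i)$ in $\mathcal L(\mathcal H)$. *)

theory Defs
  imports "HOL-Analysis.Analysis" "HOL-Library.Poly_Mapping" "HOL-Algebra.Ring"
begin

section \<open>Complex Hilbert spaces and their bounded operators\<close>

text \<open>The inner product is linear in the second variable.  Positivity of the inner product is
  contained in the axiom relating it to the norm.\<close>

class complex_hilbert = banach +
  fixes scaleC :: "complex \<Rightarrow> 'a \<Rightarrow> 'a"  (infixr "*\<^sub>C" 75)
    and cinner :: "'a \<Rightarrow> 'a \<Rightarrow> complex"
  assumes scaleC_add_right: "c *\<^sub>C (x + y) = c *\<^sub>C x + c *\<^sub>C y"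
    and scaleC_add_left: "(c + d) *\<^sub>C x = c *\<^sub>C x + d *\<^sub>C x"
    and scaleC_scaleC: "c *\<^sub>C d *\<^sub>C x = (c * d) *\<^sub>C x"
    and scaleC_of_real: "complex_of_real r *\<^sub>C x = r *\<^sub>R x"
    and cinner_commute: "cinner x y = cnj (cinner y x)"
    and cinner_add_right: "cinner x (y + z) = cinner x y + cinner x z"
    and cinner_scaleC_right: "cinner x (c *\<^sub>C y) = c * cinner x y"
    and cinner_self: "cinner x x = complex_of_real ((norm x)\<^sup>2)"

text \<open>Operators are taken from the type of bounded real-linear maps; complex linearity is
  imposed by \<open>complex_linear_op\<close>.  The library norm on this type is the operator norm.\<close>

type_synonym 'h op = "'h \<Rightarrow>\<^sub>L 'h"

definition complex_linear_op :: "'h::complex_hilbert op \<Rightarrow> bool" where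
  "complex_linear_op T \<longleftrightarrow> (\<forall>c x. blinfun_apply T (c *\<^sub>C x) = c *\<^sub>C blinfun_apply T x)"

definition op_scale :: "complex \<Rightarrow> 'h::complex_hilbert op \<Rightarrow> 'h op" where
  "op_scale c T = Blinfun (\<lambda>x. c *\<^sub>C blinfun_apply T x)"

definition is_op_adj :: "'h::complex_hilbert op \<Rightarrow> 'h op \<Rightarrow> bool" where
  "is_op_adj T S \<longleftrightarrow> (\<forall>x y. cinner (blinfun_apply S x) y = cinner x (blinfun_apply T y))"

definition op_adj :: "'h::complex_hilbert op \<Rightarrow> 'h op" where
  "op_adj T = (THE S. is_op_adj T S)"

definition positive_op :: "'h::complex_hilbert op \<Rightarrow> bool" where
  "positive_op T \<longleftrightarrow>
     (\<forall>x. Im (cinner x (blinfun_apply T x)) = 0 \<and> 0 \<le> Re (cinner x (blinfun_apply T x)))"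

definition op_le :: "'h::complex_hilbert op \<Rightarrow> 'h op \<Rightarrow> bool" where
  "op_le S T \<longleftrightarrow> positive_op (T - S)"


section \<open>Von Neumann algebras, normal embeddings, conditional expectations\<close>

definition star_subalgebra :: "'h::complex_hilbert op set \<Rightarrow> bool" where
  "star_subalgebra M \<longleftrightarrow>
     (\<forall>T\<in>M. complex_linear_op T) \<and> 0 \<in> M \<and>
     (\<forall>S\<in>M. \<forall>T\<in>M. S + T \<in> M \<and> S o\<^sub>L T \<in> M) \<and>
     (\<forall>T\<in>M. \<forall>c. op_scale c T \<in> M) \<and>
     (\<forall>T\<in>M. \<exists>S\<in>M. is_op_adj T S)"

definition wot_closed :: "'h::complex_hilbert op set \<Rightarrow> bool" where
  "wot_closed M \<longleftrightarrow>
     (\<forall>T. complex_linear_op T \<and>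
        (\<forall>F. finite F \<longrightarrow> (\<forall>\<epsilon>>0. \<exists>S\<in>M. \<forall>(x, y)\<in>F.
            cmod (cinner x (blinfun_apply (S - T) y)) < \<epsilon>)) \<longrightarrow> T \<in> M)"

text \<open>The unit of \<open>M\<close> is a projection \<open>e\<close> that need not be the identity of the ambient
  space; \<open>M\<close> is then a von Neumann algebra, in the unital sense, on the range of \<open>e\<close>.  So a family
  of von Neumann algebras on different Hilbert spaces is covered: let them act on the corresponding
  subspaces of the direct sum.\<close>

definition is_unit_of :: "'h::complex_hilbert op set \<Rightarrow> 'h op \<Rightarrow> bool" where
  "is_unit_of M e \<longleftrightarrow> e \<in> M \<and> (\<forall>T\<in>M. e o\<^sub>L T = T \<and> T o\<^sub>L e = T)"

definition unit_of :: "'h::complex_hilbert op set \<Rightarrow> 'h op" where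
  "unit_of M = (THE e. is_unit_of M e)"

definition von_neumann_algebra :: "'h::complex_hilbert op set \<Rightarrow> bool" where
  "von_neumann_algebra M \<longleftrightarrow> star_subalgebra M \<and> wot_closed M \<and> (\<exists>e. is_unit_of M e)"

definition is_lub_in :: "'h::complex_hilbert op set \<Rightarrow> 'h op set \<Rightarrow> 'h op \<Rightarrow> bool" where
  "is_lub_in M D s \<longleftrightarrow> s \<in> M \<and> (\<forall>d\<in>D. op_le d s) \<and>
     (\<forall>u\<in>M. (\<forall>d\<in>D. op_le d u) \<longrightarrow> op_le s u)"

text \<open>Normality: preservation of suprema of upward directed families of self-adjoint elements.\<close>

definition normal_map ::
  "'h::complex_hilbert op set \<Rightarrow> 'k::complex_hilbert op set \<Rightarrow> ('h op \<Rightarrow> 'k op) \<Rightarrow> bool" where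
  "normal_map M N \<phi> \<longleftrightarrow>
     (\<forall>D s. D \<noteq> {} \<and> D \<subseteq> {T \<in> M. op_adj T = T} \<and>
        (\<forall>S\<in>D. \<forall>T\<in>D. \<exists>U\<in>D. op_le S U \<and> op_le T U) \<and> is_lub_in M D s
        \<longrightarrow> is_lub_in N (\<phi> ` D) (\<phi> s))"

text \<open>The inclusion of \<open>B\<close> into \<open>M\<close>: an injective unital normal *-homomorphism.\<close>

definition vn_inclusion ::
  "'k::complex_hilbert op set \<Rightarrow> 'h::complex_hilbert op set \<Rightarrow> ('k op \<Rightarrow> 'h op) \<Rightarrow> bool" where
  "vn_inclusion B M \<iota> \<longleftrightarrow>
     \<iota> ` B \<subseteq> M \<and> inj_on \<iota> B \<and> normal_map B M \<iota> \<and> \<iota> (unit_of B) = unit_of M \<and>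
     (\<forall>b\<in>B. \<forall>c\<in>B. \<iota> (b + c) = \<iota> b + \<iota> c \<and> \<iota> (b o\<^sub>L c) = \<iota> b o\<^sub>L \<iota> c) \<and>
     (\<forall>b\<in>B. \<iota> (op_adj b) = op_adj (\<iota> b) \<and> (\<forall>c. \<iota> (op_scale c b) = op_scale c (\<iota> b)))"

definition conditional_expectation ::
  "'k::complex_hilbert op set \<Rightarrow> 'h::complex_hilbert op set \<Rightarrow> ('k op \<Rightarrow> 'h op) \<Rightarrow> ('h op \<Rightarrow> 'k op) \<Rightarrow> bool"
  where
  "conditional_expectation B M \<iota> E \<longleftrightarrow>
     E ` M \<subseteq> B \<and>
     (\<forall>x\<in>M. \<forall>y\<in>M. E (x + y) = E x + E y) \<and>
     (\<forall>x\<in>M. \<forall>c. E (op_scale c x) = op_scale c (E x)) \<and>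
     (\<forall>x\<in>M. positive_op x \<longrightarrow> positive_op (E x)) \<and>
     (\<forall>b\<in>B. E (\<iota> b) = b) \<and>
     (\<forall>b\<in>B. \<forall>x\<in>M. \<forall>c\<in>B. E (\<iota> b o\<^sub>L x o\<^sub>L \<iota> c) = b o\<^sub>L E x o\<^sub>L c)"

definition faithful_on :: "'h::complex_hilbert op set \<Rightarrow> ('h op \<Rightarrow> 'k::complex_hilbert op) \<Rightarrow> bool" where
  "faithful_on M E \<longleftrightarrow> (\<forall>x\<in>M. E (op_adj x o\<^sub>L x) = 0 \<longrightarrow> x = 0)"


section \<open>Completions\<close>

text \<open>Let \<open>X\<close> be a module with an operator-valued semi-inner product \<open>ip\<close>.  Its completion for
  the seminorm \<open>\<parallel>ip x x\<parallel>\<^bsup>1/2\<^esup>\<close> is the set of Cauchy sequences modulo null sequences; in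
  particular vectors of length zero are divided out.\<close>

definition mnorm :: "('v \<Rightarrow> 'v \<Rightarrow> 'k::complex_hilbert op) \<Rightarrow> 'v \<Rightarrow> real" where
  "mnorm ip x = sqrt (norm (ip x x))"

definition cauchy_in ::
  "'v::ab_group_add set \<Rightarrow> ('v \<Rightarrow> 'v \<Rightarrow> 'k::complex_hilbert op) \<Rightarrow> (nat \<Rightarrow> 'v) set" where
  "cauchy_in X ip = {s. range s \<subseteq> X \<and>
     (\<forall>\<epsilon>>0. \<exists>N. \<forall>m\<ge>N. \<forall>n\<ge>N. mnorm ip (s m - s n) < \<epsilon>)}"

definition cls ::
  "'v::ab_group_add set \<Rightarrow> ('v \<Rightarrow> 'v \<Rightarrow> 'k::complex_hilbert op) \<Rightarrow> (nat \<Rightarrow> 'v) \<Rightarrow> (nat \<Rightarrow> 'v) set" where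
  "cls X ip s = {t \<in> cauchy_in X ip. (\<lambda>n. mnorm ip (s n - t n)) \<longlonglongrightarrow> 0}"

definition completion ::
  "'v::ab_group_add set \<Rightarrow> ('v \<Rightarrow> 'v \<Rightarrow> 'k::complex_hilbert op) \<Rightarrow> (nat \<Rightarrow> 'v) set set" where
  "completion X ip = cls X ip ` cauchy_in X ip"

definition rep :: "(nat \<Rightarrow> 'v) set \<Rightarrow> nat \<Rightarrow> 'v" where
  "rep \<xi> = (SOME s. s \<in> \<xi>)"

definition emb ::
  "'v::ab_group_add set \<Rightarrow> ('v \<Rightarrow> 'v \<Rightarrow> 'k::complex_hilbert op) \<Rightarrow> 'v \<Rightarrow> (nat \<Rightarrow> 'v) set" where
  "emb X ip x = cls X ip (\<lambda>_. x)"

definition cmap ::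
  "'v::ab_group_add set \<Rightarrow> ('v \<Rightarrow> 'v \<Rightarrow> 'k::complex_hilbert op) \<Rightarrow> ('v \<Rightarrow> 'v)
     \<Rightarrow> (nat \<Rightarrow> 'v) set \<Rightarrow> (nat \<Rightarrow> 'v) set" where
  "cmap X ip f \<xi> = cls X ip (\<lambda>n. f (rep \<xi> n))"

definition cadd ::
  "'v::ab_group_add set \<Rightarrow> ('v \<Rightarrow> 'v \<Rightarrow> 'k::complex_hilbert op)
     \<Rightarrow> (nat \<Rightarrow> 'v) set \<Rightarrow> (nat \<Rightarrow> 'v) set \<Rightarrow> (nat \<Rightarrow> 'v) set" where
  "cadd X ip \<xi> \<eta> = cls X ip (\<lambda>n. rep \<xi> n + rep \<eta> n)"

definition cdiff ::
  "'v::ab_group_add set \<Rightarrow> ('v \<Rightarrow> 'v \<Rightarrow> 'k::complex_hilbert op)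
     \<Rightarrow> (nat \<Rightarrow> 'v) set \<Rightarrow> (nat \<Rightarrow> 'v) set \<Rightarrow> (nat \<Rightarrow> 'v) set" where
  "cdiff X ip \<xi> \<eta> = cls X ip (\<lambda>n. rep \<xi> n - rep \<eta> n)"

definition cip ::
  "('v \<Rightarrow> 'v \<Rightarrow> 'k::complex_hilbert op) \<Rightarrow> (nat \<Rightarrow> 'v) set \<Rightarrow> (nat \<Rightarrow> 'v) set \<Rightarrow> 'k op" where
  "cip ip \<xi> \<eta> = lim (\<lambda>n. ip (rep \<xi> n) (rep \<eta> n))"


section \<open>The C*-algebra generated by a set\<close>

record 'x star_algebra = "'x ring" +
  scal :: "complex \<Rightarrow> 'x \<Rightarrow> 'x"
  star :: "'x \<Rightarrow> 'x"
  nrm :: "'x \<Rightarrow> real"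

definition cstar_closed :: "'x star_algebra \<Rightarrow> 'x set \<Rightarrow> bool" where
  "cstar_closed L C \<longleftrightarrow> C \<subseteq> carrier L \<and>
     (\<forall>x\<in>C. \<forall>y\<in>C. add L x y \<in> C \<and> mult L x y \<in> C) \<and>
     (\<forall>x\<in>C. star L x \<in> C \<and> (\<forall>c. scal L c x \<in> C)) \<and>
     (\<forall>s. \<forall>x\<in>carrier L. range s \<subseteq> C \<and>
        (\<lambda>n. nrm L (add L (s n) (scal L (- 1) x))) \<longlonglongrightarrow> 0 \<longrightarrow> x \<in> C)"

definition generated_cstar :: "'x star_algebra \<Rightarrow> 'x set \<Rightarrow> 'x star_algebra" where
  "generated_cstar L S = L\<lparr>carrier := \<Inter>{C. S \<subseteq> C \<and> cstar_closed L C}\<rparr>"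


section \<open>The reduced amalgamated free product\<close>

text \<open>A word \<open>[(i\<^sub>1,h\<^sub>1),\<dots>,(i\<^sub>n,h\<^sub>n)]\<close> stands for the simple tensor
  \<open>h\<^sub>1 \<otimes> \<cdots> \<otimes> h\<^sub>n\<close>, the empty word for the unit of the summand \<open>B\<close>.\<close>

type_synonym ('i, 'h) word = "('i \<times> (nat \<Rightarrow> 'h op) set) list"

text \<open>A finitely supported \<open>f\<close> stands for the sum over \<open>w\<close> of \<open>w \<cdot> f(w)\<close>, with
  coefficients in \<open>B\<close> acting on the right.\<close>

type_synonym ('i, 'h, 'k) prefock = "('i, 'h) word \<Rightarrow>\<^sub>0 'k op"

type_synonym ('i, 'h, 'k) fvec = "(nat \<Rightarrow> ('i, 'h, 'k) prefock) set"

locale amalgam =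
  fixes B :: "'k::complex_hilbert op set"
    and A :: "'i \<Rightarrow> 'h::complex_hilbert op set"
    and \<iota> :: "'i \<Rightarrow> 'k op \<Rightarrow> 'h op"
    and E :: "'i \<Rightarrow> 'h op \<Rightarrow> 'k op"
begin

subsection \<open>The modules \<open>L\<^sub>\<infinity>\<^sup>c(A\<^sub>i, E\<^sub>i)\<close> and \<open>H\<^sub>i\<close>\<close>

definition ip :: "'i \<Rightarrow> 'h op \<Rightarrow> 'h op \<Rightarrow> 'k op" where
  "ip i x y = E i (op_adj x o\<^sub>L y)"

definition Lc :: "'i \<Rightarrow> (nat \<Rightarrow> 'h op) set set" where
  "Lc i = completion (A i) (ip i)"

definition hat :: "'i \<Rightarrow> 'h op \<Rightarrow> (nat \<Rightarrow> 'h op) set" where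
  "hat i x = emb (A i) (ip i) x"

definition lact :: "'i \<Rightarrow> 'h op \<Rightarrow> (nat \<Rightarrow> 'h op) set \<Rightarrow> (nat \<Rightarrow> 'h op) set" where
  "lact i a = cmap (A i) (ip i) (\<lambda>x. a o\<^sub>L x)"

text \<open>The extension of \<open>E\<^sub>i\<close> to the completion.\<close>

definition Ebar :: "'i \<Rightarrow> (nat \<Rightarrow> 'h op) set \<Rightarrow> 'k op" where
  "Ebar i \<xi> = lim (\<lambda>n. E i (rep \<xi> n))"

definition H :: "'i \<Rightarrow> (nat \<Rightarrow> 'h op) set set" where
  "H i = {\<xi> \<in> Lc i. \<forall>b\<in>B. cip (ip i) (hat i (\<iota> i b)) \<xi> = 0}"

subsection \<open>The Fock module\<close>

definition words :: "('i, 'h) word set" where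
  "words = {w. (\<forall>(i, h)\<in>set w. h \<in> H i) \<and> distinct_adj (map fst w)}"

text \<open>\<open>word_ip b w v\<close> is \<open>\<langle>w, b \<cdot> v\<rangle>\<close>.  The recursion is the inner product of the interior
  tensor product, \<open>\<langle>h \<otimes> w, k \<otimes> v\<rangle> = \<langle>w, \<langle>h, k\<rangle> \<cdot> v\<rangle>\<close>; words with different index sequences
  lie in different summands.\<close>

fun word_ip :: "'k op \<Rightarrow> ('i, 'h) word \<Rightarrow> ('i, 'h) word \<Rightarrow> 'k op" where
  "word_ip b [] [] = b"
| "word_ip b ((i, h) # w) ((j, k) # v) =
     (if i = j then word_ip (cip (ip i) h (lact i (\<iota> i b) k)) w v else 0)"
| "word_ip b _ _ = 0"

definition prefock :: "('i, 'h, 'k) prefock set" where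
  "prefock = {f. Poly_Mapping.keys f \<subseteq> words \<and> (\<forall>w. Poly_Mapping.lookup f w \<in> B)}"

definition prefock_ip :: "('i, 'h, 'k) prefock \<Rightarrow> ('i, 'h, 'k) prefock \<Rightarrow> 'k op" where
  "prefock_ip f g = (\<Sum>w\<in>Poly_Mapping.keys f. \<Sum>v\<in>Poly_Mapping.keys g.
     op_adj (Poly_Mapping.lookup f w) o\<^sub>L word_ip (unit_of B) w v o\<^sub>L Poly_Mapping.lookup g v)"

text \<open>The completion of \<open>prefock\<close> is the direct sum of \<open>B\<close> and of all the interior tensor products
  \<open>H\<^sub>i\<^sub>1 \<otimes>\<^sub>B \<cdots> \<otimes>\<^sub>B H\<^sub>i\<^sub>n\<close>: the relations of the tensor product over \<open>B\<close>
  (multilinearity, \<open>h b \<otimes> k = h \<otimes> b k\<close>, and \<open>(h\<^sub>1 \<otimes> \<cdots> \<otimes> h\<^sub>n) b = h\<^sub>1 \<otimes> \<cdots> \<otimes> h\<^sub>n b\<close>)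
  hold modulo vectors of length zero.\<close>

definition fock :: "('i, 'h, 'k) fvec set" where
  "fock = completion prefock prefock_ip"

definition fock_ip :: "('i, 'h, 'k) fvec \<Rightarrow> ('i, 'h, 'k) fvec \<Rightarrow> 'k op" where
  "fock_ip = cip prefock_ip"

subsection \<open>Adjointable operators\<close>

definition is_adjoint ::
  "(('i, 'h, 'k) fvec \<Rightarrow> ('i, 'h, 'k) fvec) \<Rightarrow> (('i, 'h, 'k) fvec \<Rightarrow> ('i, 'h, 'k) fvec) \<Rightarrow> bool" where
  "is_adjoint T S \<longleftrightarrow> (\<forall>\<xi>\<in>fock. \<forall>\<eta>\<in>fock. fock_ip (T \<xi>) \<eta> = fock_ip \<xi> (S \<eta>))"

text \<open>Operators are extensional functions on \<open>fock\<close>.  As usual, the existence of an adjoint forces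
  right \<open>B\<close>-linearity and boundedness.\<close>

definition adjointable :: "(('i, 'h, 'k) fvec \<Rightarrow> ('i, 'h, 'k) fvec) star_algebra" where
  "adjointable =
     \<lparr> carrier = {T \<in> fock \<rightarrow>\<^sub>E fock. \<exists>S \<in> fock \<rightarrow>\<^sub>E fock. is_adjoint T S},
       mult = (\<lambda>S T. \<lambda>\<xi>\<in>fock. S (T \<xi>)),
       one = (\<lambda>\<xi>\<in>fock. \<xi>),
       zero = (\<lambda>\<xi>\<in>fock. emb prefock prefock_ip 0),
       add = (\<lambda>S T. \<lambda>\<xi>\<in>fock. cadd prefock prefock_ip (S \<xi>) (T \<xi>)),
       scal = (\<lambda>c T. \<lambda>\<xi>\<in>fock. cmap prefock prefock_ip (Poly_Mapping.map (op_scale c)) (T \<xi>)),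
       star = (\<lambda>T. THE S. S \<in> fock \<rightarrow>\<^sub>E fock \<and> is_adjoint T S),
       nrm = (\<lambda>T. SUP \<xi>\<in>{\<xi> \<in> fock. mnorm fock_ip \<xi> \<le> 1}. mnorm fock_ip (T \<xi>)) \<rparr>"

subsection \<open>The canonical homomorphisms and the free product\<close>

text \<open>\<open>lmul b w c\<close> and \<open>creann i a w c\<close> are the images of \<open>w \<cdot> c\<close> under left multiplication
  by \<open>b \<in> B\<close> and under \<open>\<pi>\<^sub>i(a)\<close> for \<open>E\<^sub>i(a) = 0\<close>, respectively.\<close>

fun lmul :: "'k op \<Rightarrow> ('i, 'h) word \<Rightarrow> 'k op \<Rightarrow> ('i, 'h, 'k) prefock" where
  "lmul b [] c = Poly_Mapping.single [] (b o\<^sub>L c)"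
| "lmul b ((j, h) # w) c = Poly_Mapping.single ((j, lact j (\<iota> j b) h) # w) c"

fun creann :: "'i \<Rightarrow> 'h op \<Rightarrow> ('i, 'h) word \<Rightarrow> 'k op \<Rightarrow> ('i, 'h, 'k) prefock" where
  "creann i a [] c = Poly_Mapping.single [(i, hat i a)] c"
| "creann i a ((j, h) # w) c =
     (if j \<noteq> i then Poly_Mapping.single ((i, hat i a) # (j, h) # w) c
      else Poly_Mapping.single
             ((i, cdiff (A i) (ip i) (lact i a h) (hat i (\<iota> i (Ebar i (lact i a h))))) # w) c
           + lmul (Ebar i (lact i a h)) w c)"

definition pre_pi :: "'i \<Rightarrow> 'h op \<Rightarrow> ('i, 'h, 'k) prefock \<Rightarrow> ('i, 'h, 'k) prefock" where
  "pre_pi i a f = (\<Sum>w\<in>Poly_Mapping.keys f.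
     lmul (E i a) w (Poly_Mapping.lookup f w) + creann i (a - \<iota> i (E i a)) w (Poly_Mapping.lookup f w))"

definition canonical_hom :: "'i \<Rightarrow> 'h op \<Rightarrow> ('i, 'h, 'k) fvec \<Rightarrow> ('i, 'h, 'k) fvec" where
  "canonical_hom i a = (\<lambda>\<xi>\<in>fock. cmap prefock prefock_ip (pre_pi i a) \<xi>)"

definition reduced_free_product :: "(('i, 'h, 'k) fvec \<Rightarrow> ('i, 'h, 'k) fvec) star_algebra" where
  "reduced_free_product = generated_cstar adjointable (\<Union>i. canonical_hom i ` A i)"

end

end

theory Submission
  imports Defs
begin

text \<open>On vectors of finite support, \<open>\<Sum>\<^sub>i \<pi>\<^sub>i(a\<^sub>i)\<close> is the sum of a creation part \<open>C\<close>, a diagonal part \<open>D\<close>,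
  which replaces the first letter \<open>h \<in> H\<^sub>i\<close> by \<open>a\<^sub>i h - E\<^sub>i(a\<^sub>i h)\<close>, and an annihilation part.
  The creation part is controlled by \<open>\<langle>C f, C f\<rangle> \<le> \<langle>f, \<Sum>\<^sub>i E\<^sub>i(a\<^sub>i\<^sup>* a\<^sub>i) f\<rangle>\<close>, because the vectors
  \<open>a\<^sub>i \<otimes> w\<close> with different \<open>i\<close> are orthogonal and the left action of \<open>B\<close> respects the first index.
  The diagonal part is block diagonal with blocks of norm at most \<open>\<parallel>a\<^sub>i\<parallel>\<close>, and the annihilation part
  is the adjoint of the creation part of the \<open>a\<^sub>i\<^sup>*\<close>.
  Positivity of the inner product, and all operator inequalities between such vectors, reduce to one
  statement: pairing a positive matrix over \<open>B\<close> with the inner products of a family of vectors gives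
  a positive operator.\<close>

section \<open>Operators with adjoints\<close>

text \<open>The Fock module is given only by a recursive formula for inner products of words, so its
  positivity has to be earned. Removing a first letter replaces scalars of \<open>B\<close> by a
  matrix over \<open>B\<close>, hence an induction on word length must carry positive matrices, not
  just positive elements. Elimination keeps this within \<open>B\<close> itself: it asks for square
  roots of single elements that are bounded below, at the price of an \<epsilon> that is removed by
  a limit.

  The estimates are made on finitely supported vectors and pass to the completion only at the end.
  Two kinds of imprecision accompany this. Formal vectors may have length zero without being zero,
  and a class of Cauchy sequences returns a chosen representative, not the sequence that defined it.
  Sums of operators are therefore compared through one sequence of finite sums, whose boundedness
  comes from the estimate itself.\<close>

lemma cinner_add_left: "cinner (x + y) z = cinner x z + cinner y z"
  by (metis cinner_add_right cinner_commute complex_cnj_add)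

lemma cinner_scaleC_left: "cinner (c *\<^sub>C x) y = cnj c * cinner x y"
  by (metis cinner_scaleC_right cinner_commute complex_cnj_mult)

lemma cinner_scaleR_right: "cinner x (r *\<^sub>R y) = complex_of_real r * cinner x y"
  by (metis scaleC_of_real cinner_scaleC_right)

lemma cinner_scaleR_left: "cinner (r *\<^sub>R x) y = complex_of_real r * cinner x y"
  by (metis scaleC_of_real cinner_scaleC_left complex_cnj_complex_of_real)

lemma cinner_zero_right [simp]: "cinner x 0 = 0"
  using cinner_add_right[of x 0 0] by simp

lemma cinner_zero_left [simp]: "cinner 0 x = 0"
  using cinner_add_left[of 0 0 x] by simp

lemma cinner_minus_right: "cinner x (- y) = - cinner x y"
  using cinner_add_right[of x y "- y"] by (simp add: add_eq_0_iff2)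

lemma cinner_minus_left: "cinner (- x) y = - cinner x y"
  using cinner_add_left[of x "- x" y] by (simp add: add_eq_0_iff2)

lemma cinner_diff_right: "cinner x (y - z) = cinner x y - cinner x z"
  using cinner_add_right[of x y "- z"] by (simp add: cinner_minus_right)

lemma cinner_diff_left: "cinner (x - y) z = cinner x z - cinner y z"
  using cinner_add_left[of x "- y" z] by (simp add: cinner_minus_left)

lemmas cinner_simps = cinner_add_left cinner_add_right cinner_diff_left cinner_diff_right
  cinner_minus_left cinner_minus_right cinner_scaleC_left cinner_scaleC_right
  cinner_scaleR_left cinner_scaleR_right

lemma cinner_ext:
  assumes "\<And>z. cinner x z = cinner y z"
  shows "x = y"
proof -
  have "cinner (x - y) (x - y) = 0"
    using assms by (simp add: cinner_diff_left)
  then show ?thesis by (simp add: cinner_self)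
qed

lemma scaleC_zero_left [simp]: "0 *\<^sub>C x = 0"
  using scaleC_of_real[of 0 x] by simp

lemma norm_scaleC: "norm (c *\<^sub>C x) = cmod c * norm x"
proof -
  have "complex_of_real ((norm (c *\<^sub>C x))\<^sup>2) = cnj c * c * cinner x x"
    unfolding cinner_self[symmetric] by (simp add: cinner_simps)
  also have "\<dots> = complex_of_real ((cmod c)\<^sup>2 * (norm x)\<^sup>2)"
    by (simp add: cinner_self complex_norm_square mult.commute del: of_real_power)
  finally have "(norm (c *\<^sub>C x))\<^sup>2 = (cmod c * norm x)\<^sup>2"
    unfolding of_real_eq_iff by (simp add: power_mult_distrib)
  then show ?thesis by (simp add: power2_eq_iff_nonneg)
qed

lemma bounded_linear_scaleC: "bounded_linear (\<lambda>x::'a::complex_hilbert. c *\<^sub>C x)"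
proof (intro bounded_linear_intro)
  fix x y :: 'a and r
  show "c *\<^sub>C (x + y) = c *\<^sub>C x + c *\<^sub>C y" by (rule scaleC_add_right)
  show "c *\<^sub>C r *\<^sub>R x = r *\<^sub>R c *\<^sub>C x"
    by (metis scaleC_of_real scaleC_scaleC mult.commute)
  show "norm (c *\<^sub>C x) \<le> norm x * cmod c" by (simp add: norm_scaleC)
qed

lemma op_scale_apply [simp]: "blinfun_apply (op_scale c T) x = c *\<^sub>C blinfun_apply T x"
  unfolding op_scale_def
  by (subst bounded_linear_Blinfun_apply)
     (auto intro: bounded_linear_compose[OF bounded_linear_scaleC blinfun.bounded_linear_right])

lemma op_scale_of_real: "op_scale (complex_of_real r) T = r *\<^sub>R T"
  by (rule blinfun_eqI) (simp add: scaleC_of_real blinfun.bilinear_simps)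

lemma op_scale_zero [simp]: "op_scale 0 T = 0"
  by (rule blinfun_eqI) (simp add: blinfun.bilinear_simps)

lemmas comp_simps =
  bounded_bilinear.add_left[OF bounded_bilinear_blinfun_compose]
  bounded_bilinear.add_right[OF bounded_bilinear_blinfun_compose]
  bounded_bilinear.diff_left[OF bounded_bilinear_blinfun_compose]
  bounded_bilinear.diff_right[OF bounded_bilinear_blinfun_compose]
  bounded_bilinear.minus_left[OF bounded_bilinear_blinfun_compose]
  bounded_bilinear.minus_right[OF bounded_bilinear_blinfun_compose]
  bounded_bilinear.scaleR_left[OF bounded_bilinear_blinfun_compose]
  bounded_bilinear.scaleR_right[OF bounded_bilinear_blinfun_compose]

lemmas comp_sum_left = bounded_bilinear.sum_left[OF bounded_bilinear_blinfun_compose]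
lemmas comp_sum_right = bounded_bilinear.sum_right[OF bounded_bilinear_blinfun_compose]
lemmas comp_tendsto = bounded_bilinear.tendsto[OF bounded_bilinear_blinfun_compose]

lemma comp_assoc: "(a o\<^sub>L b) o\<^sub>L c = a o\<^sub>L (b o\<^sub>L c)"
  by (rule blinfun_eqI) simp

text \<open>Operators are only real-linear by type, and an adjoint forces complex linearity. Its
  existence is therefore carried as a hypothesis; for elements of a von Neumann algebra it comes
  with the definition of a *-subalgebra, so no Riesz representation is invoked.\<close>

definition has_adj :: "'h::complex_hilbert op \<Rightarrow> bool" where
  "has_adj T \<longleftrightarrow> (\<exists>S. is_op_adj T S)"

lemma op_adjI:
  assumes "is_op_adj T S"
  shows "op_adj T = S"
proof -
  have "S' = S" if "is_op_adj T S'" for S'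
    using assms that unfolding is_op_adj_def by (intro blinfun_eqI cinner_ext) simp
  with assms show ?thesis unfolding op_adj_def by (metis the_equality)
qed

lemma has_adjD: "has_adj T \<Longrightarrow> is_op_adj T (op_adj T)"
  unfolding has_adj_def using op_adjI by blast

lemma adj_left: "has_adj T \<Longrightarrow> cinner (blinfun_apply (op_adj T) x) y = cinner x (blinfun_apply T y)"
  using has_adjD unfolding is_op_adj_def by blast

lemma adj_right: "has_adj T \<Longrightarrow> cinner x (blinfun_apply (op_adj T) y) = cinner (blinfun_apply T x) y"
  using adj_left cinner_commute by metis

lemma is_op_adj_op_adj: "has_adj T \<Longrightarrow> is_op_adj (op_adj T) T"
  unfolding is_op_adj_def by (simp add: adj_right)

lemma op_adj_op_adj [simp]: "has_adj T \<Longrightarrow> op_adj (op_adj T) = T"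
  using is_op_adj_op_adj op_adjI by blast

lemma is_op_adj_add:
  "has_adj S \<Longrightarrow> has_adj T \<Longrightarrow> is_op_adj (S + T) (op_adj S + op_adj T)"
  by (simp add: is_op_adj_def blinfun.bilinear_simps cinner_simps adj_left)

lemma is_op_adj_diff:
  "has_adj S \<Longrightarrow> has_adj T \<Longrightarrow> is_op_adj (S - T) (op_adj S - op_adj T)"
  by (simp add: is_op_adj_def blinfun.bilinear_simps cinner_simps adj_left)

lemma is_op_adj_scaleR: "has_adj T \<Longrightarrow> is_op_adj (r *\<^sub>R T) (r *\<^sub>R op_adj T)"
  by (simp add: is_op_adj_def blinfun.bilinear_simps cinner_simps adj_left)

lemma is_op_adj_comp:
  "has_adj S \<Longrightarrow> has_adj T \<Longrightarrow> is_op_adj (S o\<^sub>L T) (op_adj T o\<^sub>L op_adj S)"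
  by (simp add: is_op_adj_def adj_left)

lemma is_op_adj_zero: "is_op_adj 0 0"
  by (simp add: is_op_adj_def)

lemmas op_adj_add = is_op_adj_add[THEN op_adjI]
lemmas op_adj_diff = is_op_adj_diff[THEN op_adjI]
lemmas op_adj_scaleR = is_op_adj_scaleR[THEN op_adjI]
lemmas op_adj_comp = is_op_adj_comp[THEN op_adjI]
lemmas op_adj_zero [simp] = is_op_adj_zero[THEN op_adjI]

lemma has_adj_zero [simp]: "has_adj 0"
  using has_adj_def is_op_adj_zero by blast

lemma has_adj_add: "has_adj S \<Longrightarrow> has_adj T \<Longrightarrow> has_adj (S + T)"
  using has_adj_def is_op_adj_add by blast

lemma has_adj_diff: "has_adj S \<Longrightarrow> has_adj T \<Longrightarrow> has_adj (S - T)"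
  using has_adj_def is_op_adj_diff by blast

lemma has_adj_scaleR: "has_adj T \<Longrightarrow> has_adj (r *\<^sub>R T)"
  using has_adj_def is_op_adj_scaleR by blast

lemma has_adj_sum: "(\<And>k. k \<in> I \<Longrightarrow> has_adj (T k)) \<Longrightarrow> has_adj (sum T I)"
  by (induction I rule: infinite_finite_induct) (auto intro: has_adj_add)

lemma op_adj_sum: "(\<And>k. k \<in> I \<Longrightarrow> has_adj (T k)) \<Longrightarrow> op_adj (sum T I) = (\<Sum>k\<in>I. op_adj (T k))"
  by (induction I rule: infinite_finite_induct) (auto simp: op_adj_add has_adj_sum)

lemma has_adj_complex_linear:
  assumes "has_adj T"
  shows "blinfun_apply T (c *\<^sub>C x) = c *\<^sub>C blinfun_apply T x"
proof (rule cinner_ext)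
  fix z
  have "cinner z (T (c *\<^sub>C x)) = cinner z (c *\<^sub>C T x)"
    using assms by (simp add: adj_left[symmetric] cinner_simps)
  then show "cinner (T (c *\<^sub>C x)) z = cinner (c *\<^sub>C T x) z"
    by (metis cinner_commute)
qed

lemma has_adj_id: "has_adj id_blinfun"
  by (auto simp: has_adj_def is_op_adj_def intro: exI[of _ id_blinfun])


subsection \<open>Positive operators\<close>

lemma positive_op_zero [simp]: "positive_op 0"
  by (simp add: positive_op_def)

lemma positive_op_add: "positive_op S \<Longrightarrow> positive_op T \<Longrightarrow> positive_op (S + T)"
  by (simp add: positive_op_def blinfun.bilinear_simps cinner_simps)

lemma positive_op_sum: "(\<And>k. k \<in> I \<Longrightarrow> positive_op (T k)) \<Longrightarrow> positive_op (sum T I)"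
  by (induction I rule: infinite_finite_induct) (auto intro: positive_op_add)

lemma positive_op_scaleR: "positive_op T \<Longrightarrow> 0 \<le> r \<Longrightarrow> positive_op (r *\<^sub>R T)"
  by (simp add: positive_op_def blinfun.bilinear_simps cinner_simps)

lemma positive_op_id: "positive_op id_blinfun"
  by (simp add: positive_op_def cinner_self)

lemma positive_op_conj:
  "positive_op T \<Longrightarrow> has_adj b \<Longrightarrow> positive_op (op_adj b o\<^sub>L T o\<^sub>L b)"
  by (simp add: positive_op_def adj_right)

lemma positive_op_square: "has_adj b \<Longrightarrow> positive_op (op_adj b o\<^sub>L b)"
  by (simp add: positive_op_def adj_right cinner_self)

text \<open>Polarisation: reality of the quadratic form at \<open>x + y\<close> and at
  \<open>x + \<i> *\<^sub>C y\<close> gives the imaginary and the real part of the symmetry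
  relation.\<close>

lemma positive_op_selfadj:
  assumes T: "positive_op T" and h: "has_adj T"
  shows "op_adj T = T"
proof (rule op_adjI, unfold is_op_adj_def, intro allI)
  fix x y
  let ?z = "cinner x (T y)" and ?w = "cinner y (T x)"
  have "Im (cinner (x + y) (T (x + y))) = 0"
    and "Im (cinner (x + \<i> *\<^sub>C y) (T (x + \<i> *\<^sub>C y))) = 0"
    and "Im (cinner x (T x)) = 0" "Im (cinner y (T y)) = 0"
    using T unfolding positive_op_def by blast+
  then have "Im ?z + Im ?w = 0" "Re ?z = Re ?w"
    by (auto simp: blinfun.bilinear_simps cinner_simps has_adj_complex_linear[OF h])
  then have "?z = cnj ?w" by (auto simp: complex_eq_iff)
  then show "cinner (T x) y = cinner x (T y)" by (metis cinner_commute)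
qed

lemma positive_op_Cauchy_Schwarz:
  assumes T: "positive_op T" and h: "has_adj T"
  shows "(cmod (cinner x (blinfun_apply T y)))\<^sup>2
    \<le> Re (cinner x (blinfun_apply T x)) * Re (cinner y (blinfun_apply T y))"
proof -
  define z where "z = cinner x (T y)"
  define p where "p = Re (cinner x (T x))"
  define r where "r = Re (cinner y (T y))"
  have w: "cinner y (T x) = cnj z"
    unfolding z_def by (metis adj_left[OF h] positive_op_selfadj[OF T h] cinner_commute)
  have p0: "p \<ge> 0" and r0: "r \<ge> 0" using T unfolding positive_op_def p_def r_def by blast+
  \<comment> \<open>Evaluate the form at x + \<mu> y with \<mu> equal to -t times the conjugate of
    \<open>z\<close>. This phase makes each cross term -t |z|^2, so a real quadratic in
    \<open>t\<close> remains.\<close>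
  have q: "p - 2 * t * (cmod z)\<^sup>2 + t\<^sup>2 * (cmod z)\<^sup>2 * r \<ge> 0" for t :: real
  proof -
    let ?\<mu> = "- (complex_of_real t * cnj z)"
    have 1: "cnj ?\<mu> * ?\<mu> = complex_of_real (t\<^sup>2 * (cmod z)\<^sup>2)"
      by (simp only: cmod_power2) (simp add: complex_eq_iff power2_eq_square algebra_simps)
    have 2: "?\<mu> * z + cnj ?\<mu> * cnj z = complex_of_real (- 2 * t * (cmod z)\<^sup>2)"
      by (simp only: cmod_power2) (simp add: complex_eq_iff power2_eq_square algebra_simps)
    have "cinner (x + ?\<mu> *\<^sub>C y) (T (x + ?\<mu> *\<^sub>C y))
        = cinner x (T x) + (?\<mu> * z + cnj ?\<mu> * cnj z) + (cnj ?\<mu> * ?\<mu>) * cinner y (T y)"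
      by (simp add: blinfun.bilinear_simps cinner_simps has_adj_complex_linear[OF h] w
          z_def[symmetric] algebra_simps)
    then have "Re (cinner (x + ?\<mu> *\<^sub>C y) (T (x + ?\<mu> *\<^sub>C y)))
        = p - 2 * t * (cmod z)\<^sup>2 + t\<^sup>2 * (cmod z)\<^sup>2 * r"
      unfolding 1 2 p_def r_def by (simp del: of_real_mult of_real_power)
    then show ?thesis using T unfolding positive_op_def by metis
  qed
  show ?thesis
  proof (cases "r = 0")
    case False
    then have "r > 0" using r0 by simp
    with q[of "1 / r"] have "p - (cmod z)\<^sup>2 / r \<ge> 0"
      by (simp add: power2_eq_square field_simps)
    with \<open>r > 0\<close> show ?thesis
      unfolding z_def[symmetric] p_def[symmetric] r_def[symmetric] by (simp add: field_simps)
  next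
    case True
    have "(cmod z)\<^sup>2 = 0"
    proof (rule ccontr)
      assume "(cmod z)\<^sup>2 \<noteq> 0"
      \<comment> \<open>With \<open>r = 0\<close> the quadratic is affine in \<open>t\<close>; at
        this \<open>t\<close> it equals \<open>p - 2 * (p + 1)\<close>, which is negative.\<close>
      then have "2 * ((p + 1) / (cmod z)\<^sup>2) * (cmod z)\<^sup>2 = 2 * (p + 1)" by simp
      then show False
        using q[of "(p + 1) / (cmod z)\<^sup>2"] True p0 by simp
    qed
    then show ?thesis
      using p0 r0 unfolding z_def[symmetric] p_def[symmetric] r_def[symmetric] by simp
  qed
qed

lemma cinner_Cauchy_Schwarz: "cmod (cinner x y) \<le> norm x * norm y"
proof -
  have "(cmod (cinner x y))\<^sup>2 \<le> (norm x * norm y)\<^sup>2"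
    using positive_op_Cauchy_Schwarz[OF positive_op_id has_adj_id, of x y]
    by (simp add: cinner_self power_mult_distrib)
  then show ?thesis using abs_le_square_iff[of "cmod (cinner x y)" "norm x * norm y"] by simp
qed

lemma tendsto_cinner_right:
  assumes "(f \<longlongrightarrow> l) F"
  shows "((\<lambda>n. cinner x (f n)) \<longlongrightarrow> cinner x l) F"
proof -
  have "bounded_linear (cinner x)"
    by (intro bounded_linear_intro[where K = "norm x"])
       (auto simp: cinner_simps scaleR_conv_of_real mult.commute[of "norm _" "norm x"] cinner_Cauchy_Schwarz)
  then show ?thesis using assms by (rule bounded_linear.tendsto)
qed

lemma positive_op_limit:
  assumes "T \<longlonglongrightarrow> S" and "\<And>n. positive_op (T n)"
  shows "positive_op S"
  unfolding positive_op_def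
proof (intro allI conjI)
  fix x
  have *: "(\<lambda>n. cinner x (T n x)) \<longlonglongrightarrow> cinner x (S x)"
    by (intro tendsto_cinner_right blinfun.tendsto assms(1) tendsto_const)
  have "(\<lambda>n. Im (cinner x (T n x))) \<longlonglongrightarrow> Im (cinner x (S x))"
    using * by (rule tendsto_Im)
  then show "Im (cinner x (S x)) = 0"
    using assms(2) by (simp add: positive_op_def LIMSEQ_const_iff)
  show "0 \<le> Re (cinner x (S x))"
    using tendsto_Re[OF *] by (rule LIMSEQ_le_const) (use assms(2) in \<open>auto simp: positive_op_def\<close>)
qed

text \<open>Lets a pivot be made invertible by a small perturbation. \<open>S\<close> is arbitrary,
  because only the convergence of T + \<epsilon> S to T matters.\<close>

lemma positive_op_eps:
  assumes "\<And>\<epsilon>. \<epsilon> > 0 \<Longrightarrow> positive_op (T + \<epsilon> *\<^sub>R S)"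
  shows "positive_op T"
proof (rule positive_op_limit)
  have "(\<lambda>n. T + inverse (real (Suc n)) *\<^sub>R S) \<longlonglongrightarrow> T + 0 *\<^sub>R S"
    by (intro tendsto_intros LIMSEQ_inverse_real_of_nat)
  then show "(\<lambda>n. T + inverse (real (Suc n)) *\<^sub>R S) \<longlonglongrightarrow> T" by simp
qed (use assms in simp)

lemma Re_cinner_op_le: "Re (cinner x (blinfun_apply T x)) \<le> norm T * (norm x)\<^sup>2"
proof -
  have "Re (cinner x (T x)) \<le> norm x * norm (T x)"
    using complex_Re_le_cmod cinner_Cauchy_Schwarz order_trans by blast
  also have "\<dots> \<le> norm x * (norm T * norm x)"
    by (intro mult_left_mono norm_blinfun) auto
  finally show ?thesis by (simp add: power2_eq_square mult_ac)
qed

text \<open>Cauchy-Schwarz for the form of \<open>T\<close> at the vectors \<open>T x\<close> and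
  \<open>x\<close> bounds the fourth power of \<open>norm (T x)\<close> by \<open>q\<close> squared
  times the squared norms of both vectors; one square of \<open>norm (T x)\<close> cancels.\<close>

lemma positive_op_norm_le:
  assumes T: "positive_op T" and h: "has_adj T" and "q \<ge> 0"
    and le: "\<And>x. Re (cinner x (blinfun_apply T x)) \<le> q * (norm x)\<^sup>2"
  shows "norm T \<le> q"
proof (rule norm_blinfun_bound[OF \<open>q \<ge> 0\<close>])
  fix x
  let ?n = "norm (T x)"
  have "(?n\<^sup>2)\<^sup>2 = (cmod (cinner (T x) (T x)))\<^sup>2" by (simp add: cinner_self norm_power)
  also have "\<dots> \<le> Re (cinner (T x) (T (T x))) * Re (cinner x (T x))"
    by (rule positive_op_Cauchy_Schwarz[OF T h])
  also have "\<dots> \<le> (q * ?n\<^sup>2) * (q * (norm x)\<^sup>2)"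
    using T \<open>q \<ge> 0\<close> by (intro mult_mono le) (auto simp: positive_op_def)
  finally have *: "(?n\<^sup>2)\<^sup>2 \<le> ?n\<^sup>2 * (q * norm x)\<^sup>2"
    by (simp add: power2_eq_square mult_ac)
  show "?n \<le> q * norm x"
  proof (cases "?n = 0")
    case False
    then have "?n\<^sup>2 > 0" by simp
    with * have "?n\<^sup>2 \<le> (q * norm x)\<^sup>2"
      unfolding power2_eq_square[of "?n\<^sup>2"] by (rule mult_left_le_imp_le)
    then show ?thesis using \<open>q \<ge> 0\<close> by (simp add: power2_le_iff_abs_le)
  qed (use \<open>q \<ge> 0\<close> in simp)
qed

lemma positive_op_norm_mono:
  assumes "positive_op S" "has_adj S" "positive_op (T - S)"
  shows "norm S \<le> norm T"
proof (rule positive_op_norm_le[OF assms(1,2)])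
  fix x
  have "Re (cinner x (S x)) \<le> Re (cinner x (T x))"
    using assms(3) by (simp add: positive_op_def blinfun.bilinear_simps cinner_simps)
  also have "\<dots> \<le> norm T * (norm x)\<^sup>2" by (rule Re_cinner_op_le)
  finally show "Re (cinner x (S x)) \<le> norm T * (norm x)\<^sup>2" .
qed simp


section \<open>Positivity in von Neumann algebras\<close>

lemma norm_op_adj_le:
  assumes "has_adj T"
  shows "norm (op_adj T) \<le> norm T"
proof (rule norm_blinfun_bound)
  fix x
  let ?n = "norm (op_adj T x)"
  have "?n\<^sup>2 = Re (cinner x (T (op_adj T x)))"
    unfolding adj_left[OF assms, symmetric] by (simp add: cinner_self)
  also have "\<dots> \<le> norm x * norm (T (op_adj T x))"
    using complex_Re_le_cmod cinner_Cauchy_Schwarz order_trans by blast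
  also have "\<dots> \<le> norm x * (norm T * ?n)"
    by (intro mult_left_mono norm_blinfun) auto
  finally have "?n * ?n \<le> ?n * (norm T * norm x)"
    by (simp add: power2_eq_square mult_ac)
  then show "?n \<le> norm T * norm x"
    by (cases "?n = 0") (auto simp: mult_le_cancel_left_pos)
qed simp

lemma sum_sum_insert:
  fixes g :: "'a \<Rightarrow> 'a \<Rightarrow> 'b::ab_group_add"
  assumes "finite I" "j \<notin> I"
  shows "(\<Sum>k\<in>insert j I. \<Sum>l\<in>insert j I. g k l)
    = g j j + (\<Sum>l\<in>I. g j l) + (\<Sum>k\<in>I. g k j) + (\<Sum>k\<in>I. \<Sum>l\<in>I. g k l)"
  using assms by (simp add: sum.distrib algebra_simps)

locale vn_algebra =
  fixes M :: "'k::complex_hilbert op set"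
  assumes vn: "von_neumann_algebra M"
begin

abbreviation "\<e> \<equiv> unit_of M"

lemma has_adjI: "T \<in> M \<Longrightarrow> has_adj T"
  using vn unfolding von_neumann_algebra_def star_subalgebra_def has_adj_def by blast

lemma op_adj_mem: "T \<in> M \<Longrightarrow> op_adj T \<in> M"
  using vn op_adjI unfolding von_neumann_algebra_def star_subalgebra_def by metis

lemma zero_mem [simp]: "0 \<in> M"
  using vn unfolding von_neumann_algebra_def star_subalgebra_def by blast

lemma add_mem: "S \<in> M \<Longrightarrow> T \<in> M \<Longrightarrow> S + T \<in> M"
  using vn unfolding von_neumann_algebra_def star_subalgebra_def by blast

lemma comp_mem: "S \<in> M \<Longrightarrow> T \<in> M \<Longrightarrow> S o\<^sub>L T \<in> M"
  using vn unfolding von_neumann_algebra_def star_subalgebra_def by blast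

lemma op_scale_mem: "T \<in> M \<Longrightarrow> op_scale c T \<in> M"
  using vn unfolding von_neumann_algebra_def star_subalgebra_def by blast

lemma scaleR_mem: "T \<in> M \<Longrightarrow> r *\<^sub>R T \<in> M"
  using op_scale_mem op_scale_of_real by metis

lemma minus_mem: "T \<in> M \<Longrightarrow> - T \<in> M"
  using scaleR_mem[of T "- 1"] by simp

lemma diff_mem: "S \<in> M \<Longrightarrow> T \<in> M \<Longrightarrow> S - T \<in> M"
  using add_mem[of S "- T"] minus_mem by simp

lemma sum_mem: "(\<And>k. k \<in> I \<Longrightarrow> f k \<in> M) \<Longrightarrow> sum f I \<in> M"
  by (induction I rule: infinite_finite_induct) (auto intro: add_mem)

text \<open>A norm limit is a weak operator limit, so \<open>wot_closed\<close> applies. Complex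
  linearity is passed to the limit separately, since \<open>wot_closed\<close> speaks of
  complex-linear operators only.\<close>

lemma limit_mem:
  assumes "\<And>n. s n \<in> M" and lim: "s \<longlonglongrightarrow> T"
  shows "T \<in> M"
proof -
  have "complex_linear_op T"
    unfolding complex_linear_op_def
  proof (intro allI)
    fix c x
    have *: "(\<lambda>n. s n y) \<longlonglongrightarrow> T y" for y
      by (intro blinfun.tendsto lim tendsto_const)
    have "(\<lambda>n. s n (c *\<^sub>C x)) \<longlonglongrightarrow> c *\<^sub>C T x"
      using bounded_linear.tendsto[OF bounded_linear_scaleC *]
      by (simp add: has_adj_complex_linear has_adjI assms(1))
    then show "T (c *\<^sub>C x) = c *\<^sub>C T x"
      using * LIMSEQ_unique by blast
  qed
  moreover have "\<exists>S\<in>M. \<forall>(x, y)\<in>F. cmod (cinner x ((S - T) y)) < \<epsilon>"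
    if F: "finite F" and "\<epsilon> > 0" for F \<epsilon>
  proof -
    \<comment> \<open>One constant dominating all pairs in \<open>F\<close>; the summand 1 keeps it
      positive even when \<open>F\<close> is empty.\<close>
    define K where "K = (\<Sum>(x, y)\<in>F. norm x * norm y) + 1"
    have K: "norm x * norm y \<le> K" if "(x, y) \<in> F" for x y
    proof -
      have "(case (x, y) of (x, y) \<Rightarrow> norm x * norm y) \<le> (\<Sum>(x, y)\<in>F. norm x * norm y)"
        using F that by (intro member_le_sum) auto
      then show ?thesis by (simp add: K_def)
    qed
    have "K > 0" unfolding K_def by (intro add_nonneg_pos sum_nonneg) auto
    obtain n where n: "norm (s n - T) < \<epsilon> / K"
      using LIMSEQ_D[OF lim, of "\<epsilon> / K"] \<open>K > 0\<close> \<open>\<epsilon> > 0\<close> by auto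
    have "cmod (cinner x ((s n - T) y)) < \<epsilon>" if "(x, y) \<in> F" for x y
    proof -
      have "cmod (cinner x ((s n - T) y)) \<le> norm x * norm ((s n - T) y)"
        by (rule cinner_Cauchy_Schwarz)
      also have "\<dots> \<le> norm x * (norm (s n - T) * norm y)"
        by (intro mult_left_mono norm_blinfun) auto
      also have "\<dots> = (norm x * norm y) * norm (s n - T)" by simp
      also have "\<dots> \<le> K * norm (s n - T)"
        by (intro mult_right_mono K that) auto
      also have "\<dots> < \<epsilon>" using n \<open>K > 0\<close> by (simp add: field_simps)
      finally show ?thesis .
    qed
    then show ?thesis using assms(1) by blast
  qed
  ultimately show ?thesis
    using vn unfolding von_neumann_algebra_def wot_closed_def by blast
qed

lemma closed: "closed M"
  using limit_mem by (auto simp: closed_sequential_limits)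

lemma unit_ex: "is_unit_of M \<e>"
proof -
  obtain e where e: "is_unit_of M e" using vn unfolding von_neumann_algebra_def by blast
  have "e' = e" if "is_unit_of M e'" for e'
    using e that unfolding is_unit_of_def by metis
  with e have "unit_of M = e" unfolding unit_of_def by (metis the_equality)
  with e show ?thesis by simp
qed

lemma unit_mem: "\<e> \<in> M" and unit_left: "T \<in> M \<Longrightarrow> \<e> o\<^sub>L T = T"
  and unit_right: "T \<in> M \<Longrightarrow> T o\<^sub>L \<e> = T"
  using unit_ex unfolding is_unit_of_def by auto

lemma op_adj_unit: "op_adj \<e> = \<e>"
proof -
  have "op_adj \<e> = op_adj \<e> o\<^sub>L \<e>" using unit_right op_adj_mem unit_mem by metis
  then have "op_adj (op_adj \<e>) = op_adj (op_adj \<e> o\<^sub>L \<e>)" by simp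
  also have "\<dots> = op_adj \<e> o\<^sub>L \<e>"
    using op_adj_comp has_adjI op_adj_mem unit_mem op_adj_op_adj by metis
  finally show ?thesis
    using unit_right op_adj_mem unit_mem has_adjI op_adj_op_adj by metis
qed

lemmas mem = add_mem comp_mem scaleR_mem minus_mem diff_mem sum_mem op_adj_mem unit_mem zero_mem

text \<open>The unit may be a proper projection of the ambient space, so lower bounds are measured
  by the squared norm of \<open>\<e> x\<close> and not by that of \<open>x\<close>.\<close>

lemma unit_quadratic: "cinner x (blinfun_apply \<e> x) = complex_of_real ((norm (blinfun_apply \<e> x))\<^sup>2)"
  by (metis adj_left blinfun_apply_blinfun_compose cinner_self has_adjI op_adj_unit unit_mem unit_right)

lemma norm_unit_apply: "norm (blinfun_apply \<e> x) \<le> norm x"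
proof -
  have "(norm (\<e> x))\<^sup>2 = cmod (cinner x (\<e> x))" by (simp add: unit_quadratic norm_power)
  also have "\<dots> \<le> norm x * norm (\<e> x)" by (rule cinner_Cauchy_Schwarz)
  finally show ?thesis
    by (cases "norm (\<e> x) = 0") (auto simp: power2_eq_square)
qed

lemma positive_unit: "positive_op \<e>"
  by (simp add: positive_op_def unit_quadratic flip: of_real_power)

text \<open>For \<open>c\<close> bounded below, the square root and its inverse come from the contractions
  \<open>Y \<mapsto> (Z + Y\<^sup>2)/2\<close> and \<open>X \<mapsto> e + Y X\<close>, where \<open>Z = e - c/L\<close> has norm less than \<open>1\<close>.\<close>

lemma square_root:
  assumes c: "c \<in> M" and ge: "positive_op (c - \<epsilon> *\<^sub>R \<e>)" and "\<epsilon> > 0"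
  obtains s t where "s \<in> M" "t \<in> M" "op_adj s = s" "op_adj t = t"
    "s o\<^sub>L s = c" "s o\<^sub>L t = \<e>" "t o\<^sub>L s = \<e>"
proof -
  \<comment> \<open>\<open>L\<close> exceeds \<open>norm c\<close>, so Z = e - c/L is positive, and
    the lower bound \<epsilon> on \<open>c\<close> gives \<open>Z\<close> norm at most q = 1 -
    \<epsilon>/L < 1.\<close>
  define L where "L = norm c + \<epsilon>"
  define q where "q = 1 - \<epsilon> / L"
  define Z where "Z = \<e> - (1 / L) *\<^sub>R c"
  have L: "L > 0" using \<open>\<epsilon> > 0\<close> by (simp add: L_def add_nonneg_pos)
  have q: "0 \<le> q" "q < 1" using L \<open>\<epsilon> > 0\<close> by (auto simp: q_def L_def)
  have ZM: "Z \<in> M" unfolding Z_def by (intro mem c)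
  have "positive_op ((c - \<epsilon> *\<^sub>R \<e>) + \<epsilon> *\<^sub>R \<e>)"
    using ge \<open>\<epsilon> > 0\<close> by (intro positive_op_add positive_op_scaleR positive_unit) auto
  then have cpos: "positive_op c" by simp
  have cadj: "op_adj c = c" using cpos c by (intro positive_op_selfadj has_adjI)
  have Zadj: "op_adj Z = Z"
    unfolding Z_def by (simp add: op_adj_diff op_adj_scaleR has_adj_scaleR has_adjI unit_mem c cadj op_adj_unit)
  have cx: "cinner x (c x) = cinner (\<e> x) (c (\<e> x))" for x
  proof -
    have "\<e> o\<^sub>L c o\<^sub>L \<e> = c" by (simp add: unit_left unit_right c)
    from arg_cong[OF this, of "\<lambda>T. blinfun_apply T x"]
    have "\<e> (c (\<e> x)) = c x" by simp
    then show ?thesis using adj_left[OF has_adjI[OF unit_mem], of x "c (\<e> x)"]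
      by (simp add: op_adj_unit)
  qed
  have cle: "Re (cinner x (c x)) \<le> L * (norm (\<e> x))\<^sup>2" for x
  proof -
    have "Re (cinner x (c x)) \<le> norm c * (norm (\<e> x))\<^sup>2"
      by (subst cx) (rule Re_cinner_op_le)
    also have "\<dots> \<le> L * (norm (\<e> x))\<^sup>2"
      using \<open>\<epsilon> > 0\<close> by (intro mult_right_mono) (auto simp: L_def)
    finally show ?thesis .
  qed
  have cge: "\<epsilon> * (norm (\<e> x))\<^sup>2 \<le> Re (cinner x (c x))" for x
  proof -
    have "0 \<le> Re (cinner x ((c - \<epsilon> *\<^sub>R \<e>) x))" using ge unfolding positive_op_def by blast
    then show ?thesis by (simp add: blinfun.bilinear_simps cinner_simps unit_quadratic flip: of_real_power)
  qed
  have Zx: "Re (cinner x (Z x)) = (norm (\<e> x))\<^sup>2 - Re (cinner x (c x)) / L"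
      "Im (cinner x (Z x)) = 0" for x
  proof -
    have "Im (cinner x (c x)) = 0" using cpos unfolding positive_op_def by blast
    then show "Re (cinner x (Z x)) = (norm (\<e> x))\<^sup>2 - Re (cinner x (c x)) / L"
      "Im (cinner x (Z x)) = 0"
      unfolding Z_def by (simp_all add: blinfun.bilinear_simps cinner_simps unit_quadratic flip: of_real_power)
  qed
  have "positive_op Z"
    unfolding positive_op_def
  proof (intro allI conjI)
    fix x
    show "Im (cinner x (Z x)) = 0" by (rule Zx)
    show "0 \<le> Re (cinner x (Z x))" using cle[of x] L unfolding Zx by (simp add: field_simps)
  qed
  then have Zq: "norm Z \<le> q"
  proof (rule positive_op_norm_le[OF _ has_adjI[OF ZM] q(1)])
    fix x
    have "Re (cinner x (Z x)) = (norm (\<e> x))\<^sup>2 - Re (cinner x (c x)) / L"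
      by (rule Zx)
    also have "\<dots> \<le> (norm (\<e> x))\<^sup>2 - \<epsilon> * (norm (\<e> x))\<^sup>2 / L"
      using cge[of x] L by (intro diff_left_mono divide_right_mono) auto
    also have "\<dots> = q * (norm (\<e> x))\<^sup>2" by (simp add: q_def algebra_simps)
    also have "\<dots> \<le> q * (norm x)\<^sup>2"
      using q norm_unit_apply by (intro mult_left_mono power_mono) auto
    finally show "Re (cinner x (Z x)) \<le> q * (norm x)\<^sup>2" .
  qed
  \<comment> \<open>The radius \<open>q\<close> serves twice: (q + q^2)/2 is at most
    \<open>q\<close>, so the ball is mapped into itself, and on this ball the map contracts by the
    factor \<open>q\<close>.\<close>
  let ?S = "M \<inter> cball 0 q"
  let ?f = "\<lambda>Y. (1/2) *\<^sub>R (Z + (Y o\<^sub>L Y))"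
  have "\<exists>!Y\<in>?S. ?f Y = Y"
  proof (rule Banach_fix[OF _ _ q])
    show "complete ?S" by (simp add: complete_eq_closed closed_Int closed)
    have "0 \<in> ?S" using q by simp
    then show "?S \<noteq> {}" by blast
    show "?f ` ?S \<subseteq> ?S"
    proof
      fix X assume "X \<in> ?f ` ?S"
      then obtain Y where Y: "Y \<in> M" "norm Y \<le> q" "X = ?f Y" by auto
      have "norm (Y o\<^sub>L Y) \<le> q * q"
        using norm_blinfun_compose[of Y Y] mult_mono[OF Y(2,2)] q by simp
      then have "norm (Z + (Y o\<^sub>L Y)) \<le> q + q * q"
        using Zq norm_triangle_ineq[of Z "Y o\<^sub>L Y"] by linarith
      also have "\<dots> \<le> 2 * q" using q mult_left_le[of q q] by simp
      finally have "norm X \<le> q" using Y by simp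
      then show "X \<in> ?S" using Y by (auto intro!: mem ZM)
    qed
  next
    fix Y Y' assume Y: "Y \<in> ?S" "Y' \<in> ?S"
    have "?f Y - ?f Y' = (1/2) *\<^sub>R ((Z + (Y o\<^sub>L Y)) - (Z + (Y' o\<^sub>L Y')))"
      by (rule scaleR_diff_right[symmetric])
    also have "(Z + (Y o\<^sub>L Y)) - (Z + (Y' o\<^sub>L Y')) = (Y o\<^sub>L (Y - Y')) + ((Y - Y') o\<^sub>L Y')"
      by (simp add: comp_simps)
    finally have "?f Y - ?f Y' = (1/2) *\<^sub>R ((Y o\<^sub>L (Y - Y')) + ((Y - Y') o\<^sub>L Y'))" .
    then have "norm (?f Y - ?f Y') = (1/2) * norm ((Y o\<^sub>L (Y - Y')) + ((Y - Y') o\<^sub>L Y'))"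
      by (simp only: norm_scaleR)
    also have "\<dots> \<le> (1/2) * (norm (Y o\<^sub>L (Y - Y')) + norm ((Y - Y') o\<^sub>L Y'))"
      by (intro mult_left_mono norm_triangle_ineq) auto
    also have "\<dots> \<le> (1/2) * (norm Y * norm (Y - Y') + norm (Y - Y') * norm Y')"
      by (intro mult_left_mono add_mono norm_blinfun_compose) auto
    also have "\<dots> \<le> (1/2) * (q * norm (Y - Y') + norm (Y - Y') * q)"
      using Y by (intro mult_left_mono add_mono mult_right_mono) auto
    finally show "dist (?f Y) (?f Y') \<le> q * dist Y Y'" by (simp add: dist_norm mult.commute)
  qed
  note ex1 = this
  define Y where "Y = (THE Y. Y \<in> ?S \<and> ?f Y = Y)"
  have "Y \<in> ?S \<and> ?f Y = Y" unfolding Y_def by (rule theI'[OF ex1])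
  then have Yf: "?f Y = Y" and Y: "Y \<in> M" "norm Y \<le> q" by auto
  \<comment> \<open>Since \<open>Z\<close> is self-adjoint, \<open>op_adj Y\<close> is another fixed
    point in the same ball, and uniqueness applies.\<close>
  have Yadj: "op_adj Y = Y"
  proof (rule the1_equality[OF ex1, folded Y_def, symmetric], intro conjI)
    show "op_adj Y \<in> ?S"
      using norm_op_adj_le[OF has_adjI[OF Y(1)]] Y by (auto intro: mem)
    have "op_adj (?f Y) = (1/2) *\<^sub>R op_adj (Z + (Y o\<^sub>L Y))"
      by (intro op_adj_scaleR has_adjI add_mem comp_mem ZM Y(1))
    also have "op_adj (Z + (Y o\<^sub>L Y)) = op_adj Z + op_adj (Y o\<^sub>L Y)"
      by (intro op_adj_add has_adjI comp_mem ZM Y(1))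
    also have "op_adj (Y o\<^sub>L Y) = op_adj Y o\<^sub>L op_adj Y"
      by (intro op_adj_comp has_adjI Y(1))
    finally have "?f (op_adj Y) = op_adj (?f Y)" by (simp only: Zadj)
    also have "\<dots> = op_adj Y" by (simp only: Yf)
    finally show "?f (op_adj Y) = op_adj Y" .
  qed
  let ?g = "\<lambda>X. \<e> + (Y o\<^sub>L X)"
  have "\<exists>!X\<in>M. ?g X = X"
  proof (rule Banach_fix[OF _ _ q])
    show "complete M" by (simp add: complete_eq_closed closed)
    show "M \<noteq> {}" using zero_mem by blast
    show "?g ` M \<subseteq> M" using Y by (auto intro!: mem)
  next
    fix X X' :: "'k op"
    have "norm (Y o\<^sub>L (X - X')) \<le> q * norm (X - X')"
      using norm_blinfun_compose[of Y "X - X'"] mult_right_mono[OF Y(2), of "norm (X - X')"] by simp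
    then show "dist (?g X) (?g X') \<le> q * dist X X'" by (simp add: dist_norm comp_simps)
  qed
  then obtain X where X: "X \<in> M" "?g X = X" by blast
  let ?D = "\<e> - Y"
  have DM: "?D \<in> M" and Dadj: "op_adj ?D = ?D"
    using Y Yadj by (auto intro!: mem simp: op_adj_diff has_adjI unit_mem op_adj_unit)
  have DX: "?D o\<^sub>L X = \<e>" using X(2) by (simp add: comp_simps unit_left X(1) diff_eq_eq)
  have "op_adj (?D o\<^sub>L X) = op_adj X o\<^sub>L ?D"
    using op_adj_comp[of ?D X] by (simp add: has_adjI DM X Dadj)
  then have XD: "op_adj X o\<^sub>L ?D = \<e>" using DX op_adj_unit by simp
  \<comment> \<open>\<open>X\<close> is a right inverse of \<open>\<e> - Y\<close> and its adjoint
    is a left inverse, so the two coincide.\<close>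
  have Xadj: "op_adj X = X"
    by (metis DX XD comp_assoc unit_left unit_right X(1) op_adj_mem)
  \<comment> \<open>The fixed point equation says Y^2 = 2 Y - Z, hence (e - Y)^2 = e - Z =
    c/L.\<close>
  have DD: "?D o\<^sub>L ?D = (1 / L) *\<^sub>R c"
  proof -
    have "Z + (Y o\<^sub>L Y) = 2 *\<^sub>R Y" using arg_cong[OF Yf, of "\<lambda>T. 2 *\<^sub>R T"] by simp
    then have YY: "Y o\<^sub>L Y = 2 *\<^sub>R Y - Z" by (metis add_diff_cancel_left')
    have "?D o\<^sub>L ?D = \<e> - Y - (Y - (Y o\<^sub>L Y))"
      by (simp add: comp_simps unit_left unit_right unit_mem Y)
    then show ?thesis unfolding YY by (simp add: Z_def scaleR_2)
  qed
  define r where "r = sqrt L"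
  have r: "r > 0" "r * r = L" using L by (auto simp: r_def)
  show thesis
  proof (rule that)
    show "r *\<^sub>R ?D \<in> M" "(1 / r) *\<^sub>R X \<in> M" by (intro mem DM X)+
    show "op_adj (r *\<^sub>R ?D) = r *\<^sub>R ?D" "op_adj ((1 / r) *\<^sub>R X) = (1 / r) *\<^sub>R X"
      by (simp_all only: op_adj_scaleR[OF has_adjI] DM X Dadj Xadj)
    have *: "(p *\<^sub>R S) o\<^sub>L (p' *\<^sub>R T) = (p * p') *\<^sub>R (S o\<^sub>L T)" for p p' and S T :: "'k op"
      by (simp add: comp_simps mult.commute)
    show "(r *\<^sub>R ?D) o\<^sub>L (r *\<^sub>R ?D) = c"
      unfolding * DD r(2) using L by simp
    show "(r *\<^sub>R ?D) o\<^sub>L ((1 / r) *\<^sub>R X) = \<e>"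
      unfolding * DX using r(1) by simp
    show "((1 / r) *\<^sub>R X) o\<^sub>L (r *\<^sub>R ?D) = \<e>"
      unfolding * XD[unfolded Xadj] using r(1) by simp
  qed
qed

text \<open>Cauchy-Schwarz for a positive two by two matrix over \<open>M\<close>. Testing with b =
  -t Z and c = e leaves a real quadratic in \<open>t\<close>, optimal at
  \<open>t = 1 / norm X\<close>. The triangle inequality of the module seminorms rests on
  it.\<close>

lemma kernel2_norm:
  assumes M: "X \<in> M" "Y \<in> M" "Z \<in> M"
    and pos: "\<And>b c. b \<in> M \<Longrightarrow> c \<in> M \<Longrightarrow> positive_op
      ((op_adj b o\<^sub>L X o\<^sub>L b) + (op_adj b o\<^sub>L Z o\<^sub>L c) + (op_adj c o\<^sub>L op_adj Z o\<^sub>L b) + (op_adj c o\<^sub>L Y o\<^sub>L c))"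
  shows "norm Z \<le> sqrt (norm X) * sqrt (norm Y)"
proof (rule norm_blinfun_bound)
  fix x
  define z where "z = (norm (Z x))\<^sup>2"
  define y where "y = norm Y * (norm x)\<^sup>2"
  have *: "2 * t * z \<le> t\<^sup>2 * (norm X * z) + y" for t
  proof -
    let ?b = "(- t) *\<^sub>R Z"
    have adjb: "op_adj ?b = (- t) *\<^sub>R op_adj Z" by (rule op_adj_scaleR[OF has_adjI[OF M(3)]])
    have "positive_op ((op_adj ?b o\<^sub>L X o\<^sub>L ?b) + (op_adj ?b o\<^sub>L Z o\<^sub>L \<e>)
        + (op_adj \<e> o\<^sub>L op_adj Z o\<^sub>L ?b) + (op_adj \<e> o\<^sub>L Y o\<^sub>L \<e>))"
      by (intro pos mem M)
    also have "\<dots> = ((t\<^sup>2) *\<^sub>R (op_adj Z o\<^sub>L X o\<^sub>L Z) - (2 * t) *\<^sub>R (op_adj Z o\<^sub>L Z) + Y)"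
      unfolding adjb op_adj_unit
      by (simp add: comp_simps comp_assoc unit_left unit_right mem M power2_eq_square algebra_simps)
         (simp add: scaleR_2[symmetric] algebra_simps)
    finally have "0 \<le> Re (cinner x (((t\<^sup>2) *\<^sub>R (op_adj Z o\<^sub>L X o\<^sub>L Z) - (2 * t) *\<^sub>R (op_adj Z o\<^sub>L Z) + Y) x))"
      unfolding positive_op_def by blast
    also have "\<dots> = t\<^sup>2 * Re (cinner (Z x) (X (Z x))) - 2 * t * z + Re (cinner x (Y x))"
      by (simp add: blinfun.bilinear_simps cinner_simps adj_right has_adjI M z_def cinner_self
          flip: of_real_power)
    also have "\<dots> \<le> t\<^sup>2 * (norm X * z) - 2 * t * z + y"
      unfolding z_def y_def by (intro add_mono diff_mono mult_left_mono Re_cinner_op_le order_refl) auto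
    finally show ?thesis by simp
  qed
  have "z \<le> norm X * y"
  proof (cases "norm X = 0")
    case True
    have "z \<le> 0"
    proof (rule ccontr)
      assume "\<not> z \<le> 0"
      then have "2 * ((y + 1) / z) * z = 2 * (y + 1)" by simp
      moreover have "y \<ge> 0" by (simp add: y_def)
      ultimately show False using *[of "(y + 1) / z"] True by simp
    qed
    then show ?thesis by (simp add: True)
  next
    case False
    then have "norm X > 0" by simp
    then show ?thesis using *[of "1 / norm X"] by (simp add: field_simps power2_eq_square)
  qed
  then have "sqrt z \<le> sqrt (norm X * y)" by simp
  then show "norm (Z x) \<le> sqrt (norm X) * sqrt (norm Y) * norm x"
    by (simp add: z_def y_def real_sqrt_mult)
qed simp

text \<open>This replaces the factorisation \<open>N = S\<^sup>* S\<close> in the matrices over \<open>M\<close> by a block Cholesky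
  elimination, one row at a time.  The pivot \<open>N j j\<close> is made invertible by adding \<open>\<epsilon> e\<close>, and the
  Schur complement inherits positivity from \<open>N\<close>.\<close>

lemma positive_op_pairing:
  assumes "finite I"
    and add: "\<And>k l b b'. k \<in> I \<Longrightarrow> l \<in> I \<Longrightarrow> b \<in> M \<Longrightarrow> b' \<in> M \<Longrightarrow> q k l (b + b') = q k l b + q k l b'"
    and scale: "\<And>k l b r. k \<in> I \<Longrightarrow> l \<in> I \<Longrightarrow> b \<in> M \<Longrightarrow> q k l (r *\<^sub>R b) = r *\<^sub>R q k l b"
    and pos: "\<And>\<beta>. (\<And>k. k \<in> I \<Longrightarrow> \<beta> k \<in> M) \<Longrightarrow>
      positive_op (\<Sum>k\<in>I. \<Sum>l\<in>I. q k l (op_adj (\<beta> k) o\<^sub>L \<beta> l))"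
    and NM: "\<And>k l. k \<in> I \<Longrightarrow> l \<in> I \<Longrightarrow> N k l \<in> M"
    and Nadj: "\<And>k l. k \<in> I \<Longrightarrow> l \<in> I \<Longrightarrow> op_adj (N k l) = N l k"
    and Npos: "\<And>\<beta>. (\<And>k. k \<in> I \<Longrightarrow> \<beta> k \<in> M) \<Longrightarrow>
      positive_op (\<Sum>k\<in>I. \<Sum>l\<in>I. op_adj (\<beta> k) o\<^sub>L N k l o\<^sub>L \<beta> l)"
  shows "positive_op (\<Sum>k\<in>I. \<Sum>l\<in>I. q k l (N k l))"
  using assms
proof (induction I arbitrary: N rule: finite_induct)
  case empty
  then show ?case by simp
next
  case (insert j I)
  note add = insert.prems(1) and scale = insert.prems(2) and pos = insert.prems(3)
    and NM = insert.prems(4) and Nadj = insert.prems(5) and Npos = insert.prems(6)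
  note split = sum_sum_insert[OF insert.hyps(1,2)]
  have ne: "k \<noteq> j" if "k \<in> I" for k using that insert.hyps by blast
  have q0: "q k l 0 = 0" if "k \<in> insert j I" "l \<in> insert j I" for k l
    using scale[OF that zero_mem, of 0] by simp
  have qdiff: "q k l (b - b') = q k l b - q k l b'"
    if "k \<in> insert j I" "l \<in> insert j I" "b \<in> M" "b' \<in> M" for k l b b'
    using add[OF that(1,2) that(3), of "- b'"] scale[OF that(1,2,4), of "- 1"] that
    by (simp add: minus_mem)
  show ?case
  proof (rule positive_op_eps)
    fix \<epsilon> :: real assume "\<epsilon> > 0"
    define c where "c = N j j + \<epsilon> *\<^sub>R \<e>"
    \<comment> \<open>Testing \<open>N\<close> with the unit in slot \<open>j\<close> and 0
      elsewhere isolates the pivot.\<close>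
    have "positive_op (\<Sum>k\<in>insert j I. \<Sum>l\<in>insert j I.
        op_adj (if k = j then \<e> else 0) o\<^sub>L N k l o\<^sub>L (if l = j then \<e> else 0))"
      by (rule Npos) (simp add: mem)
    then have "positive_op (N j j)"
      unfolding split using ne by (simp add: op_adj_unit unit_left unit_right NM cong: sum.cong)
    then have "positive_op (c - \<epsilon> *\<^sub>R \<e>)" by (simp add: c_def)
    moreover have "c \<in> M" unfolding c_def by (intro mem NM) auto
    ultimately obtain s t where st: "s \<in> M" "t \<in> M" "op_adj s = s" "op_adj t = t"
      "s o\<^sub>L s = c" "s o\<^sub>L t = \<e>" "t o\<^sub>L s = \<e>"
      using square_root \<open>\<epsilon> > 0\<close> by blast
    \<comment> \<open>Row \<open>j\<close> of the Cholesky factor of the perturbed matrix;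
      \<open>N'\<close> is then the Schur complement of its pivot. Row and column \<open>j\<close>
      are reproduced exactly, except that the pivot gains the \<epsilon>.\<close>
    define \<beta> where "\<beta> k = (if k = j then s else t o\<^sub>L N j k)" for k
    have \<beta>M: "\<beta> k \<in> M" if "k \<in> insert j I" for k
      unfolding \<beta>_def using that by (auto intro!: mem NM st)
    have \<beta>adj: "op_adj (\<beta> k) = (if k = j then s else N k j o\<^sub>L t)" if "k \<in> insert j I" for k
      unfolding \<beta>_def using that by (auto simp: st op_adj_comp has_adjI NM Nadj)
    define N' where "N' k l = N k l - (op_adj (\<beta> k) o\<^sub>L \<beta> l)" for k l
    have "(\<Sum>k\<in>insert j I. \<Sum>l\<in>insert j I. q k l (N k l)) + \<epsilon> *\<^sub>R q j j \<e>
        = (\<Sum>k\<in>insert j I. \<Sum>l\<in>insert j I. q k l (op_adj (\<beta> k) o\<^sub>L \<beta> l))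
          + (\<Sum>k\<in>I. \<Sum>l\<in>I. q k l (N' k l))"
    proof -
      have jj: "q j j (op_adj (\<beta> j) o\<^sub>L \<beta> j) = q j j (N j j) + \<epsilon> *\<^sub>R q j j \<e>"
        by (simp add: \<beta>_def st c_def add scale mem NM)
      have jl: "op_adj (\<beta> j) o\<^sub>L \<beta> l = N j l" if "l \<in> I" for l
        using that ne[OF that] by (simp add: \<beta>_def st comp_assoc[symmetric] unit_left NM)
      have kj: "op_adj (\<beta> k) o\<^sub>L \<beta> j = N k j" if "k \<in> I" for k
        using that ne[OF that] by (simp add: \<beta>adj) (simp add: \<beta>_def st comp_assoc unit_right NM)
      have kl: "q k l (N' k l) = q k l (N k l) - q k l (op_adj (\<beta> k) o\<^sub>L \<beta> l)"
        if "k \<in> I" "l \<in> I" for k l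
        unfolding N'_def using that by (intro qdiff mem NM \<beta>M) auto
      show ?thesis
        unfolding split by (simp add: jj jl kj kl sum_subtractf cong: sum.cong)
    qed
    also have "positive_op \<dots>"
    proof (rule positive_op_add)
      show "positive_op (\<Sum>k\<in>insert j I. \<Sum>l\<in>insert j I. q k l (op_adj (\<beta> k) o\<^sub>L \<beta> l))"
        by (rule pos) (rule \<beta>M)
      show "positive_op (\<Sum>k\<in>I. \<Sum>l\<in>I. q k l (N' k l))"
      proof (rule insert.IH)
        fix k l assume kl: "k \<in> I" "l \<in> I"
        show "N' k l \<in> M" unfolding N'_def using kl by (intro mem NM \<beta>M) auto
        show "op_adj (N' k l) = N' l k"
          unfolding N'_def using kl
          by (simp add: op_adj_diff has_adjI op_adj_comp mem NM \<beta>M Nadj)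
      next
        fix \<gamma> assume \<gamma>: "\<And>k. k \<in> I \<Longrightarrow> \<gamma> k \<in> M"
        let ?\<gamma> = "\<lambda>k. if k = j then 0 else \<gamma> k"
        have "positive_op (\<Sum>k\<in>insert j I. \<Sum>l\<in>insert j I. q k l (op_adj (?\<gamma> k) o\<^sub>L ?\<gamma> l))"
          using \<gamma> by (intro pos) auto
        then show "positive_op (\<Sum>k\<in>I. \<Sum>l\<in>I. q k l (op_adj (\<gamma> k) o\<^sub>L \<gamma> l))"
          unfolding split using ne by (simp add: q0 cong: sum.cong)
      next
        fix \<gamma> assume \<gamma>: "\<And>k. k \<in> I \<Longrightarrow> \<gamma> k \<in> M"
        define r where "r = (\<Sum>l\<in>I. N j l o\<^sub>L \<gamma> l)"
        \<comment> \<open>\<open>t o\<^sub>L t\<close> inverts the perturbed pivot \<open>c\<close>,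
          so \<open>- g\<close> is the entry in slot \<open>j\<close> that minimises the form of the
          perturbed matrix; the minimum is the form of the Schur complement.\<close>
        define g where "g = t o\<^sub>L t o\<^sub>L r"
        define R where "R = (\<Sum>k\<in>I. \<Sum>l\<in>I. op_adj (\<gamma> k) o\<^sub>L N k l o\<^sub>L \<gamma> l)"
        have rM: "r \<in> M" unfolding r_def by (intro mem NM \<gamma>) auto
        have gM: "g \<in> M" unfolding g_def by (intro mem st rM)
        have radj: "op_adj r = (\<Sum>k\<in>I. op_adj (\<gamma> k) o\<^sub>L N k j)"
          unfolding r_def by (simp add: op_adj_sum has_adjI mem NM \<gamma> op_adj_comp Nadj cong: sum.cong)
        have gadj: "op_adj g = op_adj r o\<^sub>L t o\<^sub>L t"
          unfolding g_def by (simp add: op_adj_comp has_adjI mem st rM comp_assoc)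
        let ?\<gamma> = "\<lambda>k. if k = j then - g else \<gamma> k"
        have adjmg: "op_adj (- g) = - op_adj g"
          using op_adj_scaleR[OF has_adjI[OF gM], of "- 1"] by simp
        \<comment> \<open>The extra square supplies the \<epsilon> by which \<open>c\<close> exceeds
          \<open>N j j\<close>, so that the square is completed exactly.\<close>
        have "positive_op ((\<Sum>k\<in>insert j I. \<Sum>l\<in>insert j I. op_adj (?\<gamma> k) o\<^sub>L N k l o\<^sub>L ?\<gamma> l)
            + \<epsilon> *\<^sub>R (op_adj g o\<^sub>L g))"
          using \<gamma> \<open>\<epsilon> > 0\<close>
          by (intro positive_op_add Npos positive_op_scaleR positive_op_square has_adjI gM)
             (auto intro: mem gM)
        also have "(\<Sum>k\<in>insert j I. \<Sum>l\<in>insert j I. op_adj (?\<gamma> k) o\<^sub>L N k l o\<^sub>L ?\<gamma> l)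
            = (op_adj g o\<^sub>L N j j o\<^sub>L g) - (op_adj g o\<^sub>L r) - (op_adj r o\<^sub>L g) + R"
          unfolding split using ne
          by (simp add: R_def adjmg comp_simps r_def[symmetric] comp_assoc comp_sum_right[symmetric]
                sum_negf cong: sum.cong)
             (simp add: radj comp_sum_left comp_assoc)
        also have "op_adj g o\<^sub>L N j j o\<^sub>L g = (op_adj r o\<^sub>L t o\<^sub>L t o\<^sub>L r) - \<epsilon> *\<^sub>R (op_adj g o\<^sub>L g)"
        proof -
          have "s o\<^sub>L (t o\<^sub>L x) = x" if "x \<in> M" for x
            using that by (simp add: comp_assoc[symmetric] st unit_left)
          then have ssg: "s o\<^sub>L (s o\<^sub>L g) = r"
            by (simp add: g_def comp_assoc mem st rM)
          have "N j j = (s o\<^sub>L s) - \<epsilon> *\<^sub>R \<e>" by (simp add: st c_def)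
          then have "op_adj g o\<^sub>L N j j o\<^sub>L g = (op_adj g o\<^sub>L (s o\<^sub>L (s o\<^sub>L g))) - \<epsilon> *\<^sub>R (op_adj g o\<^sub>L g)"
            by (simp add: comp_simps comp_assoc unit_left gM)
          then show ?thesis by (simp add: ssg gadj)
        qed
        also have "op_adj g o\<^sub>L r = op_adj r o\<^sub>L t o\<^sub>L t o\<^sub>L r" by (simp add: gadj)
        also have "op_adj r o\<^sub>L g = op_adj r o\<^sub>L t o\<^sub>L t o\<^sub>L r" by (simp add: g_def comp_assoc)
        also have "(op_adj r o\<^sub>L t o\<^sub>L t o\<^sub>L r) - \<epsilon> *\<^sub>R (op_adj g o\<^sub>L g) - (op_adj r o\<^sub>L t o\<^sub>L t o\<^sub>L r)
            - (op_adj r o\<^sub>L t o\<^sub>L t o\<^sub>L r) + R + \<epsilon> *\<^sub>R (op_adj g o\<^sub>L g) = R - (op_adj r o\<^sub>L t o\<^sub>L t o\<^sub>L r)"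
          by simp
        also have "\<dots> = (\<Sum>k\<in>I. \<Sum>l\<in>I. op_adj (\<gamma> k) o\<^sub>L N' k l o\<^sub>L \<gamma> l)"
        proof -
          have "op_adj (\<beta> k) o\<^sub>L \<beta> l = N k j o\<^sub>L t o\<^sub>L t o\<^sub>L N j l" if "k \<in> I" "l \<in> I" for k l
            using that ne by (auto simp: \<beta>adj) (auto simp: \<beta>_def comp_assoc)
          then have "(\<Sum>k\<in>I. \<Sum>l\<in>I. op_adj (\<gamma> k) o\<^sub>L N' k l o\<^sub>L \<gamma> l)
            = R - (\<Sum>k\<in>I. \<Sum>l\<in>I. op_adj (\<gamma> k) o\<^sub>L N k j o\<^sub>L t o\<^sub>L t o\<^sub>L N j l o\<^sub>L \<gamma> l)"
            by (simp add: N'_def R_def comp_simps sum_subtractf comp_assoc cong: sum.cong)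
          also have "(\<Sum>k\<in>I. \<Sum>l\<in>I. op_adj (\<gamma> k) o\<^sub>L N k j o\<^sub>L t o\<^sub>L t o\<^sub>L N j l o\<^sub>L \<gamma> l)
            = op_adj r o\<^sub>L t o\<^sub>L t o\<^sub>L r"
            unfolding radj by (simp add: r_def comp_sum_left comp_sum_right comp_assoc) (rule sum.swap)
          finally show ?thesis by simp
        qed
        finally show "positive_op (\<Sum>k\<in>I. \<Sum>l\<in>I. op_adj (\<gamma> k) o\<^sub>L N' k l o\<^sub>L \<gamma> l)" .
      qed (use add scale in auto)
    qed
    finally show "positive_op ((\<Sum>k\<in>insert j I. \<Sum>l\<in>insert j I. q k l (N k l)) + \<epsilon> *\<^sub>R q j j \<e>)" .
  qed
qed

end


section \<open>Semi-inner products with values in a von Neumann algebra\<close>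

text \<open>A semi-inner product module recorded without its right action. Positivity of the inner
  product of x b + y c with itself is therefore required in expanded form.\<close>

locale pre_module = vn_algebra M for M :: "'k::complex_hilbert op set" +
  fixes X :: "'v::ab_group_add set" and ip :: "'v \<Rightarrow> 'v \<Rightarrow> 'k op"
  assumes zero_in: "0 \<in> X"
    and add_in: "x \<in> X \<Longrightarrow> y \<in> X \<Longrightarrow> x + y \<in> X"
    and diff_in: "x \<in> X \<Longrightarrow> y \<in> X \<Longrightarrow> x - y \<in> X"
    and ip_mem: "x \<in> X \<Longrightarrow> y \<in> X \<Longrightarrow> ip x y \<in> M"
    and ip_add_right: "x \<in> X \<Longrightarrow> y \<in> X \<Longrightarrow> z \<in> X \<Longrightarrow> ip x (y + z) = ip x y + ip x z"
    and ip_adj: "x \<in> X \<Longrightarrow> y \<in> X \<Longrightarrow> op_adj (ip x y) = ip y x"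
    and ip_positive: "x \<in> X \<Longrightarrow> y \<in> X \<Longrightarrow> b \<in> M \<Longrightarrow> c \<in> M \<Longrightarrow> positive_op
      ((op_adj b o\<^sub>L ip x x o\<^sub>L b) + (op_adj b o\<^sub>L ip x y o\<^sub>L c) + (op_adj c o\<^sub>L ip y x o\<^sub>L b) + (op_adj c o\<^sub>L ip y y o\<^sub>L c))"
begin

lemma ip_add_left: "x \<in> X \<Longrightarrow> y \<in> X \<Longrightarrow> z \<in> X \<Longrightarrow> ip (x + y) z = ip x z + ip y z"
  by (metis ip_adj ip_add_right add_in ip_mem has_adjI op_adj_add)

lemma ip_diff_right: "x \<in> X \<Longrightarrow> y \<in> X \<Longrightarrow> z \<in> X \<Longrightarrow> ip x (y - z) = ip x y - ip x z"
  using ip_add_right[of x "y - z" z] diff_in by simp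

lemma ip_diff_left: "x \<in> X \<Longrightarrow> y \<in> X \<Longrightarrow> z \<in> X \<Longrightarrow> ip (x - y) z = ip x z - ip y z"
  using ip_add_left[of "x - y" y z] diff_in by simp

lemma ip_zero_right: "x \<in> X \<Longrightarrow> ip x 0 = 0"
  using ip_diff_right[of x x x] by simp

lemma ip_zero_left: "x \<in> X \<Longrightarrow> ip 0 x = 0"
  using ip_diff_left[of x x x] by simp

lemma mnorm_nonneg [simp]: "mnorm ip x \<ge> 0"
  by (simp add: mnorm_def)

lemma norm_ip_self: "norm (ip x x) = (mnorm ip x)\<^sup>2"
  by (simp add: mnorm_def)

lemma norm_ip_le: "x \<in> X \<Longrightarrow> y \<in> X \<Longrightarrow> norm (ip x y) \<le> mnorm ip x * mnorm ip y"
  unfolding mnorm_def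
  by (rule kernel2_norm) (auto intro: ip_mem simp: ip_adj ip_positive)

lemma mnorm_add_le:
  assumes "x \<in> X" "y \<in> X"
  shows "mnorm ip (x + y) \<le> mnorm ip x + mnorm ip y"
proof -
  have "ip (x + y) (x + y) = ip x x + ip x y + (ip y x + ip y y)"
    using assms by (simp add: ip_add_left ip_add_right add_in)
  then have "norm (ip (x + y) (x + y)) \<le> norm (ip x x + ip x y) + norm (ip y x + ip y y)"
    using norm_triangle_ineq by metis
  also have "\<dots> \<le> (norm (ip x x) + norm (ip x y)) + (norm (ip y x) + norm (ip y y))"
    by (intro add_mono norm_triangle_ineq)
  also have "\<dots> \<le> ((mnorm ip x)\<^sup>2 + mnorm ip x * mnorm ip y) + (mnorm ip y * mnorm ip x + (mnorm ip y)\<^sup>2)"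
    using assms by (intro add_mono norm_ip_le) (auto simp: norm_ip_self)
  also have "\<dots> = (mnorm ip x + mnorm ip y)\<^sup>2"
    by (simp add: power2_eq_square algebra_simps)
  finally show ?thesis unfolding norm_ip_self by (rule power2_le_imp_le) simp
qed

lemma mnorm_commute: "x \<in> X \<Longrightarrow> y \<in> X \<Longrightarrow> mnorm ip (x - y) = mnorm ip (y - x)"
  by (simp add: mnorm_def ip_diff_left ip_diff_right diff_in algebra_simps)

lemma mnorm_diff_triangle:
  "x \<in> X \<Longrightarrow> y \<in> X \<Longrightarrow> z \<in> X \<Longrightarrow> mnorm ip (x - z) \<le> mnorm ip (x - y) + mnorm ip (y - z)"
  using mnorm_add_le[of "x - y" "y - z"] by (simp add: diff_in)

lemma mnorm_zero [simp]: "mnorm ip 0 = 0"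
  using zero_in by (simp add: mnorm_def ip_zero_right)

lemma mnorm_le_diff: "x \<in> X \<Longrightarrow> y \<in> X \<Longrightarrow> mnorm ip x \<le> mnorm ip (x - y) + mnorm ip y"
  using mnorm_add_le[of "x - y" y] by (simp add: diff_in)

lemma mnorm_sum_le:
  "(\<And>k. k \<in> K \<Longrightarrow> f k \<in> X) \<Longrightarrow> mnorm ip (sum f K) \<le> (\<Sum>k\<in>K. mnorm ip (f k)) \<and> sum f K \<in> X"
proof (induction K rule: infinite_finite_induct)
  case (insert k K)
  then show ?case using mnorm_add_le[of "f k" "sum f K"] by (auto intro: add_in)
qed (auto simp: zero_in)

lemma sum_in: "(\<And>k. k \<in> K \<Longrightarrow> f k \<in> X) \<Longrightarrow> sum f K \<in> X"
  using mnorm_sum_le by blast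


subsection \<open>Cauchy sequences and the completion\<close>

abbreviation "Cau \<equiv> cauchy_in X ip"
abbreviation "null_diff s t \<equiv> (\<lambda>n. mnorm ip (s n - t n)) \<longlonglongrightarrow> 0"

lemma Cau_mem: "s \<in> Cau \<Longrightarrow> s n \<in> X"
  by (auto simp: cauchy_in_def)

lemma CauD: "s \<in> Cau \<Longrightarrow> \<epsilon> > 0 \<Longrightarrow> \<exists>N. \<forall>m\<ge>N. \<forall>n\<ge>N. mnorm ip (s m - s n) < \<epsilon>"
  by (auto simp: cauchy_in_def)

lemma CauI:
  assumes "\<And>n. s n \<in> X" "\<And>\<epsilon>. \<epsilon> > 0 \<Longrightarrow> \<exists>N. \<forall>m\<ge>N. \<forall>n\<ge>N. mnorm ip (s m - s n) < \<epsilon>"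
  shows "s \<in> Cau"
  using assms by (auto simp: cauchy_in_def)

lemma Cau_const: "x \<in> X \<Longrightarrow> (\<lambda>_. x) \<in> Cau"
  by (rule CauI) auto

lemma Cau_bounded:
  assumes "s \<in> Cau"
  obtains K where "K > 0" "\<And>n. mnorm ip (s n) \<le> K"
proof -
  obtain N where N: "\<forall>m\<ge>N. \<forall>n\<ge>N. mnorm ip (s m - s n) < 1"
    using CauD[OF assms, of 1] by auto
  define K where "K = 1 + (\<Sum>n\<le>N. mnorm ip (s n))"
  have le: "mnorm ip (s n) \<le> K - 1" if "n \<le> N" for n
    unfolding K_def using member_le_sum[of n "{..N}" "\<lambda>n. mnorm ip (s n)"] that by simp
  have "mnorm ip (s n) \<le> K" for n
  proof (cases "n \<le> N")
    case False
    then have "mnorm ip (s n - s N) < 1" using N by simp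
    then show ?thesis
      using mnorm_le_diff[OF Cau_mem[OF assms] Cau_mem[OF assms], of n N] le[of N] by simp
  next
    case True
    then show ?thesis using le[of n] by simp
  qed
  moreover have "K > 0" unfolding K_def by (intro add_pos_nonneg sum_nonneg) auto
  ultimately show ?thesis using that by blast
qed

lemma Cau_image:
  assumes s: "s \<in> Cau" and t: "\<And>n. t n \<in> X"
    and le: "\<And>m n. mnorm ip (t m - t n) \<le> K * mnorm ip (s m - s n)"
  shows "t \<in> Cau"
proof (rule CauI[OF t])
  fix \<epsilon> :: real assume "\<epsilon> > 0"
  \<comment> \<open>\<open>K\<close> carries no sign hypothesis; \<open>\<bar>K\<bar> + 1\<close> is
    positive and still a Lipschitz constant.\<close>
  then obtain N where N: "\<forall>m\<ge>N. \<forall>n\<ge>N. mnorm ip (s m - s n) < \<epsilon> / (\<bar>K\<bar> + 1)"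
    using CauD[OF s, of "\<epsilon> / (\<bar>K\<bar> + 1)"] by auto
  have "mnorm ip (t m - t n) < \<epsilon>" if "m \<ge> N" "n \<ge> N" for m n
  proof -
    have "mnorm ip (t m - t n) \<le> (\<bar>K\<bar> + 1) * mnorm ip (s m - s n)"
      using le[of m n] by (rule order_trans) (auto intro: mult_right_mono)
    also have "\<dots> < (\<bar>K\<bar> + 1) * (\<epsilon> / (\<bar>K\<bar> + 1))"
      using N that by (intro mult_strict_left_mono) auto
    finally show ?thesis by simp
  qed
  then show "\<exists>N. \<forall>m\<ge>N. \<forall>n\<ge>N. mnorm ip (t m - t n) < \<epsilon>" by blast
qed

lemma Cau_equiv:
  assumes s: "s \<in> Cau" and t: "\<And>n. t n \<in> X" and st: "null_diff s t"
  shows "t \<in> Cau"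
proof (rule CauI[OF t])
  fix \<epsilon> :: real assume "\<epsilon> > 0"
  obtain N1 where N1: "\<forall>m\<ge>N1. \<forall>n\<ge>N1. mnorm ip (s m - s n) < \<epsilon> / 3"
    using CauD[OF s, of "\<epsilon> / 3"] \<open>\<epsilon> > 0\<close> by auto
  obtain N2 where N2: "\<And>n. n \<ge> N2 \<Longrightarrow> mnorm ip (s n - t n) < \<epsilon> / 3"
    using LIMSEQ_D[OF st, of "\<epsilon> / 3"] \<open>\<epsilon> > 0\<close> by auto
  have "mnorm ip (t m - t n) < \<epsilon>" if "m \<ge> max N1 N2" "n \<ge> max N1 N2" for m n
  proof -
    have "mnorm ip (t m - t n) \<le> mnorm ip (t m - s m) + mnorm ip (s m - t n)"
      by (intro mnorm_diff_triangle t Cau_mem s)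
    also have "mnorm ip (s m - t n) \<le> mnorm ip (s m - s n) + mnorm ip (s n - t n)"
      by (intro mnorm_diff_triangle t Cau_mem s)
    also have "mnorm ip (t m - s m) = mnorm ip (s m - t m)"
      by (intro mnorm_commute t Cau_mem s)
    finally show ?thesis using N1 N2[of m] N2[of n] that by fastforce
  qed
  then show "\<exists>N. \<forall>m\<ge>N. \<forall>n\<ge>N. mnorm ip (t m - t n) < \<epsilon>" by blast
qed

lemma null_diff_sym:
  assumes "\<And>n. s n \<in> X" "\<And>n. t n \<in> X" "null_diff s t"
  shows "null_diff t s"
  using assms by (simp add: mnorm_commute[of "t _" "s _"])

lemma null_diff_trans:
  assumes "\<And>n. s n \<in> X" "\<And>n. t n \<in> X" "\<And>n. u n \<in> X" "null_diff s t" "null_diff t u"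
  shows "null_diff s u"
proof (rule tendsto_sandwich[OF _ _ tendsto_const])
  show "(\<lambda>n. mnorm ip (s n - t n) + mnorm ip (t n - u n)) \<longlonglongrightarrow> 0"
    using tendsto_add[OF assms(4,5)] by simp
  show "\<forall>\<^sub>F n in sequentially. mnorm ip (s n - u n) \<le> mnorm ip (s n - t n) + mnorm ip (t n - u n)"
    using assms(1-3) by (intro always_eventually allI mnorm_diff_triangle)
qed simp

lemma null_diff_image:
  assumes "null_diff s t" and "\<And>n. mnorm ip (s' n - t' n) \<le> K * mnorm ip (s n - t n)"
  shows "null_diff s' t'"
proof (rule tendsto_sandwich[OF _ _ tendsto_const])
  show "(\<lambda>n. K * mnorm ip (s n - t n)) \<longlonglongrightarrow> 0"
    using tendsto_mult_left[OF assms(1), of K] by simp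
qed (use assms(2) in auto)

lemma cls_eq:
  assumes "s \<in> Cau" "t \<in> Cau" "null_diff s t"
  shows "cls X ip s = cls X ip t"
  unfolding cls_def
proof (intro Collect_cong conj_cong refl)
  fix u assume u: "u \<in> Cau"
  note mem = Cau_mem[OF assms(1)] Cau_mem[OF assms(2)] Cau_mem[OF u]
  have ts: "null_diff t s" by (rule null_diff_sym[OF mem(1,2) assms(3)])
  show "null_diff s u = null_diff t u"
    using null_diff_trans[OF mem(2,1,3) ts] null_diff_trans[OF mem assms(3)] by (rule iffI)
qed

text \<open>\<open>rep\<close> is a choice, so a class returns its defining sequence only up to a
  null sequence. Operations on classes go through \<open>rep\<close> and are brought back to given
  sequences by this.\<close>

lemma rep_cls:
  assumes "s \<in> Cau"
  shows "rep (cls X ip s) \<in> Cau" "null_diff s (rep (cls X ip s))"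
proof -
  have "s \<in> cls X ip s" using assms by (simp add: cls_def)
  then have "rep (cls X ip s) \<in> cls X ip s" unfolding rep_def by (rule someI[where P = "\<lambda>t. t \<in> cls X ip s"])
  then show "rep (cls X ip s) \<in> Cau" "null_diff s (rep (cls X ip s))" by (auto simp: cls_def)
qed

lemma cls_mem: "s \<in> Cau \<Longrightarrow> cls X ip s \<in> completion X ip"
  by (simp add: completion_def)

lemma rep_Cau: "\<xi> \<in> completion X ip \<Longrightarrow> rep \<xi> \<in> Cau"
  by (auto simp: completion_def rep_cls)

lemma cls_rep:
  assumes "\<xi> \<in> completion X ip"
  shows "cls X ip (rep \<xi>) = \<xi>"
proof -
  obtain s where s: "s \<in> Cau" "\<xi> = cls X ip s" using assms by (auto simp: completion_def)
  have "cls X ip s = cls X ip (rep (cls X ip s))"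
    by (rule cls_eq) (use s rep_cls in auto)
  then show ?thesis using s by simp
qed

lemma ip_diff_norm_le:
  assumes "x \<in> X" "x' \<in> X" "y \<in> X" "y' \<in> X"
  shows "norm (ip x y - ip x' y') \<le> mnorm ip (x - x') * mnorm ip y + mnorm ip x' * mnorm ip (y - y')"
proof -
  have "ip x y - ip x' y' = ip (x - x') y + ip x' (y - y')"
    using assms by (simp add: ip_diff_left ip_diff_right)
  then have "norm (ip x y - ip x' y') \<le> norm (ip (x - x') y) + norm (ip x' (y - y'))"
    using norm_triangle_ineq by metis
  also have "\<dots> \<le> mnorm ip (x - x') * mnorm ip y + mnorm ip x' * mnorm ip (y - y')"
    using assms by (intro add_mono norm_ip_le diff_in)
  finally show ?thesis .
qed

lemma ip_convergent:
  assumes s: "s \<in> Cau" and t: "t \<in> Cau"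
  shows "convergent (\<lambda>n. ip (s n) (t n))"
proof -
  obtain K where K: "K > 0" "\<And>n. mnorm ip (s n) \<le> K" using Cau_bounded[OF s] by blast
  obtain L where L: "L > 0" "\<And>n. mnorm ip (t n) \<le> L" using Cau_bounded[OF t] by blast
  have "Cauchy (\<lambda>n. ip (s n) (t n))"
  proof (rule metric_CauchyI)
    fix \<epsilon> :: real assume "\<epsilon> > 0"
    obtain N1 where N1: "\<And>m n. m \<ge> N1 \<Longrightarrow> n \<ge> N1 \<Longrightarrow> mnorm ip (s m - s n) < \<epsilon> / (2 * L)"
      using CauD[OF s, of "\<epsilon> / (2 * L)"] \<open>\<epsilon> > 0\<close> \<open>L > 0\<close> by (metis divide_pos_pos mult_pos_pos zero_less_numeral)
    obtain N2 where N2: "\<And>m n. m \<ge> N2 \<Longrightarrow> n \<ge> N2 \<Longrightarrow> mnorm ip (t m - t n) < \<epsilon> / (2 * K)"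
      using CauD[OF t, of "\<epsilon> / (2 * K)"] \<open>\<epsilon> > 0\<close> \<open>K > 0\<close> by (metis divide_pos_pos mult_pos_pos zero_less_numeral)
    have "dist (ip (s m) (t m)) (ip (s n) (t n)) < \<epsilon>" if mn: "m \<ge> max N1 N2" "n \<ge> max N1 N2" for m n
    proof -
      have "dist (ip (s m) (t m)) (ip (s n) (t n))
          \<le> mnorm ip (s m - s n) * mnorm ip (t m) + mnorm ip (s n) * mnorm ip (t m - t n)"
        unfolding dist_norm by (intro ip_diff_norm_le Cau_mem s t)
      also have "\<dots> \<le> mnorm ip (s m - s n) * L + K * mnorm ip (t m - t n)"
        by (intro add_mono mult_left_mono mult_right_mono K L) auto
      also have "\<dots> < (\<epsilon> / (2 * L)) * L + K * (\<epsilon> / (2 * K))"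
        using mn K L by (intro add_strict_mono mult_strict_left_mono mult_strict_right_mono N1 N2) auto
      also have "\<dots> = \<epsilon>" using K L by simp
      finally show ?thesis .
    qed
    then show "\<exists>N. \<forall>m\<ge>N. \<forall>n\<ge>N. dist (ip (s m) (t m)) (ip (s n) (t n)) < \<epsilon>" by blast
  qed
  then show ?thesis by (simp add: Cauchy_convergent_iff)
qed

lemma ip_null_diff:
  assumes "s \<in> Cau" "s' \<in> Cau" "t \<in> Cau" "t' \<in> Cau" "null_diff s s'" "null_diff t t'"
  shows "(\<lambda>n. ip (s n) (t n) - ip (s' n) (t' n)) \<longlonglongrightarrow> 0"
proof -
  obtain K where K: "K > 0" "\<And>n. mnorm ip (s' n) \<le> K" using Cau_bounded[OF assms(2)] by blast
  obtain L where L: "L > 0" "\<And>n. mnorm ip (t n) \<le> L" using Cau_bounded[OF assms(3)] by blast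
  show ?thesis
  proof (rule Lim_null_comparison)
    show "\<forall>\<^sub>F n in sequentially. norm (ip (s n) (t n) - ip (s' n) (t' n))
        \<le> mnorm ip (s n - s' n) * L + K * mnorm ip (t n - t' n)"
    proof (rule always_eventually, rule allI)
      fix n
      have "norm (ip (s n) (t n) - ip (s' n) (t' n))
          \<le> mnorm ip (s n - s' n) * mnorm ip (t n) + mnorm ip (s' n) * mnorm ip (t n - t' n)"
        by (intro ip_diff_norm_le Cau_mem assms)
      also have "\<dots> \<le> mnorm ip (s n - s' n) * L + K * mnorm ip (t n - t' n)"
        by (intro add_mono mult_left_mono mult_right_mono K L) auto
      finally show "norm (ip (s n) (t n) - ip (s' n) (t' n))
        \<le> mnorm ip (s n - s' n) * L + K * mnorm ip (t n - t' n)" .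
    qed
    show "(\<lambda>n. mnorm ip (s n - s' n) * L + K * mnorm ip (t n - t' n)) \<longlonglongrightarrow> 0"
      using tendsto_add[OF tendsto_mult_right[OF assms(5), of L] tendsto_mult_left[OF assms(6), of K]]
      by simp
  qed
qed

lemma cip_cls:
  assumes "s \<in> Cau" "t \<in> Cau"
  shows "(\<lambda>n. ip (s n) (t n)) \<longlonglongrightarrow> cip ip (cls X ip s) (cls X ip t)"
proof -
  let ?s = "rep (cls X ip s)" and ?t = "rep (cls X ip t)"
  have 1: "(\<lambda>n. ip (?s n) (?t n)) \<longlonglongrightarrow> cip ip (cls X ip s) (cls X ip t)"
    unfolding cip_def using ip_convergent[of ?s ?t] assms rep_cls by (simp add: convergent_LIMSEQ_iff)
  have "(\<lambda>n. ip (s n) (t n) - ip (?s n) (?t n)) \<longlonglongrightarrow> 0"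
    using assms by (intro ip_null_diff rep_cls)
  from tendsto_add[OF this 1] show ?thesis by simp
qed

lemma cip_rep:
  assumes "\<xi> \<in> completion X ip" "\<eta> \<in> completion X ip"
  shows "(\<lambda>n. ip (rep \<xi> n) (rep \<eta> n)) \<longlonglongrightarrow> cip ip \<xi> \<eta>"
  using cip_cls[OF rep_Cau rep_Cau, OF assms] by (simp add: cls_rep assms)

lemma cip_mem: "\<xi> \<in> completion X ip \<Longrightarrow> \<eta> \<in> completion X ip \<Longrightarrow> cip ip \<xi> \<eta> \<in> M"
  by (rule limit_mem[OF _ cip_rep]) (auto intro: ip_mem Cau_mem rep_Cau)

lemma mnorm_cip:
  assumes "s \<in> Cau"
  shows "(\<lambda>n. mnorm ip (s n)) \<longlonglongrightarrow> mnorm (cip ip) (cls X ip s)"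
  unfolding mnorm_def by (intro tendsto_intros cip_cls assms)

end

lemma op_adj_limit:
  assumes "x \<longlonglongrightarrow> a" "y \<longlonglongrightarrow> b" "\<And>n. is_op_adj (x n) (y n)"
  shows "is_op_adj a b"
  unfolding is_op_adj_def
proof (intro allI)
  fix u v
  have "(\<lambda>n. cinner u (x n v)) \<longlonglongrightarrow> cinner u (a v)"
    by (intro tendsto_cinner_right blinfun.tendsto assms tendsto_const)
  moreover have "(\<lambda>n. cnj (cinner v (y n u))) \<longlonglongrightarrow> cnj (cinner v (b u))"
    by (intro tendsto_cnj tendsto_cinner_right blinfun.tendsto assms tendsto_const)
  moreover have "cinner u (x n v) = cnj (cinner v (y n u))" for n
    using assms(3) cinner_commute unfolding is_op_adj_def by metis
  ultimately have "cinner u (a v) = cnj (cinner v (b u))" using LIMSEQ_unique by auto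
  then show "cinner (b u) v = cinner u (a v)" using cinner_commute by metis
qed


section \<open>The modules of the factors\<close>

lemma is_op_adj_op_scale: "has_adj T \<Longrightarrow> is_op_adj (op_scale c T) (op_scale (cnj c) (op_adj T))"
  by (simp add: is_op_adj_def cinner_simps adj_left)

text \<open>After compression to the range of \<open>\<e>\<close>, the form of \<open>h\<close> is
  at least \<open>- norm h\<close> times that of the unit. The shift reduces statements about
  self-adjoint elements to positive ones.\<close>

lemma (in vn_algebra) positive_shift:
  assumes "h \<in> M" "op_adj h = h"
  shows "positive_op (h + norm h *\<^sub>R \<e>)"
  unfolding positive_op_def
proof (intro allI conjI)
  fix x
  have "cinner x (h x) = cnj (cinner x (h x))"
    using adj_left[OF has_adjI[OF assms(1)], of x x] assms(2) cinner_commute[of "h x" x] by simp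
  then have im: "Im (cinner x (h x)) = 0" by (simp add: complex_eq_iff)
  then show "Im (cinner x ((h + norm h *\<^sub>R \<e>) x)) = 0"
    by (simp add: blinfun.bilinear_simps cinner_simps unit_quadratic flip: of_real_power)
  have "\<e> o\<^sub>L h o\<^sub>L \<e> = h" by (simp add: unit_left unit_right assms)
  from arg_cong[OF this, of "\<lambda>T. blinfun_apply T x"]
  have "\<e> (h (\<e> x)) = h x" by simp
  then have "cinner x (h x) = cinner (\<e> x) (h (\<e> x))"
    using adj_left[OF has_adjI[OF unit_mem], of x "h (\<e> x)"] by (simp add: op_adj_unit)
  moreover have "- Re (cinner (\<e> x) (h (\<e> x))) \<le> norm h * (norm (\<e> x))\<^sup>2"
    using Re_cinner_op_le[of "\<e> x" "- h"] by (simp add: blinfun.bilinear_simps cinner_simps)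
  ultimately show "0 \<le> Re (cinner x ((h + norm h *\<^sub>R \<e>) x))"
    by (simp add: blinfun.bilinear_simps cinner_simps unit_quadratic flip: of_real_power)
qed

lemma positive_norm_square_diff:
  assumes "has_adj a" "has_adj x"
  shows "positive_op (((norm a)\<^sup>2) *\<^sub>R (op_adj x o\<^sub>L x) - (op_adj (a o\<^sub>L x) o\<^sub>L (a o\<^sub>L x)))"
  unfolding positive_op_def
proof (intro allI conjI)
  fix v
  have *: "cinner v ((((norm a)\<^sup>2) *\<^sub>R (op_adj x o\<^sub>L x) - (op_adj (a o\<^sub>L x) o\<^sub>L (a o\<^sub>L x))) v)
      = complex_of_real ((norm a)\<^sup>2 * (norm (x v))\<^sup>2 - (norm (a (x v)))\<^sup>2)"
    using assms by (simp add: blinfun.bilinear_simps cinner_simps adj_right op_adj_comp cinner_self)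
  show "Im (cinner v ((((norm a)\<^sup>2) *\<^sub>R (op_adj x o\<^sub>L x) - (op_adj (a o\<^sub>L x) o\<^sub>L (a o\<^sub>L x))) v)) = 0"
    unfolding * by simp
  have "norm (a (x v)) \<le> norm a * norm (x v)" by (rule norm_blinfun)
  then have "(norm (a (x v)))\<^sup>2 \<le> (norm a * norm (x v))\<^sup>2" by (rule power_mono) simp
  then show "0 \<le> Re (cinner v ((((norm a)\<^sup>2) *\<^sub>R (op_adj x o\<^sub>L x) - (op_adj (a o\<^sub>L x) o\<^sub>L (a o\<^sub>L x))) v))"
    unfolding * by (simp add: power_mult_distrib)
qed

locale amalgam_expectation = amalgam B A \<iota> E
  for B :: "'k::complex_hilbert op set"
    and A :: "'i \<Rightarrow> 'h::complex_hilbert op set"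
    and \<iota> :: "'i \<Rightarrow> 'k op \<Rightarrow> 'h op"
    and E :: "'i \<Rightarrow> 'h op \<Rightarrow> 'k op" +
  assumes vnB: "von_neumann_algebra B"
    and vnA: "\<And>i. von_neumann_algebra (A i)"
    and inclusion: "\<And>i. vn_inclusion B (A i) (\<iota> i)"
    and expectation: "\<And>i. conditional_expectation B (A i) (\<iota> i) (E i)"
begin

sublocale B: vn_algebra B by unfold_locales (rule vnB)
sublocale A: vn_algebra "A i" for i by unfold_locales (rule vnA)

section \<open>Algebra of the inclusions and the expectations\<close>

lemma iota_mem: "b \<in> B \<Longrightarrow> \<iota> i b \<in> A i"
  and iota_add: "b \<in> B \<Longrightarrow> c \<in> B \<Longrightarrow> \<iota> i (b + c) = \<iota> i b + \<iota> i c"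
  and iota_comp: "b \<in> B \<Longrightarrow> c \<in> B \<Longrightarrow> \<iota> i (b o\<^sub>L c) = \<iota> i b o\<^sub>L \<iota> i c"
  and iota_adj: "b \<in> B \<Longrightarrow> \<iota> i (op_adj b) = op_adj (\<iota> i b)"
  and iota_scale: "b \<in> B \<Longrightarrow> \<iota> i (op_scale z b) = op_scale z (\<iota> i b)"
  and iota_unit: "\<iota> i (unit_of B) = unit_of (A i)"
  using inclusion[of i] unfolding vn_inclusion_def by blast+

lemma iota_scaleR: "b \<in> B \<Longrightarrow> \<iota> i (r *\<^sub>R b) = r *\<^sub>R \<iota> i b"
  using iota_scale[of b i "complex_of_real r"] by (simp add: op_scale_of_real)

lemma iota_zero: "\<iota> i 0 = 0"
  using iota_scaleR[of 0 i 0] by simp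

lemma iota_diff: "b \<in> B \<Longrightarrow> c \<in> B \<Longrightarrow> \<iota> i (b - c) = \<iota> i b - \<iota> i c"
  using iota_add[of b "- c" i] iota_scaleR[of c i "- 1"] by (simp add: B.minus_mem)

lemma iota_sum: "(\<And>k. k \<in> I \<Longrightarrow> f k \<in> B) \<Longrightarrow> \<iota> i (sum f I) = (\<Sum>k\<in>I. \<iota> i (f k))"
  by (induction I rule: infinite_finite_induct) (auto simp: iota_zero iota_add B.sum_mem)

lemma E_mem: "x \<in> A i \<Longrightarrow> E i x \<in> B"
  and E_add: "x \<in> A i \<Longrightarrow> y \<in> A i \<Longrightarrow> E i (x + y) = E i x + E i y"
  and E_scale: "x \<in> A i \<Longrightarrow> E i (op_scale z x) = op_scale z (E i x)"
  and E_positive: "x \<in> A i \<Longrightarrow> positive_op x \<Longrightarrow> positive_op (E i x)"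
  and E_iota: "b \<in> B \<Longrightarrow> E i (\<iota> i b) = b"
  and E_bimodule: "b \<in> B \<Longrightarrow> x \<in> A i \<Longrightarrow> c \<in> B \<Longrightarrow> E i (\<iota> i b o\<^sub>L x o\<^sub>L \<iota> i c) = b o\<^sub>L E i x o\<^sub>L c"
  using expectation[of i] unfolding conditional_expectation_def by blast+

lemma E_scaleR: "x \<in> A i \<Longrightarrow> E i (r *\<^sub>R x) = r *\<^sub>R E i x"
  using E_scale[of x i "complex_of_real r"] by (simp add: op_scale_of_real)

lemma E_zero: "E i 0 = 0"
  using E_scaleR[of 0 i 0] by simp

lemma E_diff: "x \<in> A i \<Longrightarrow> y \<in> A i \<Longrightarrow> E i (x - y) = E i x - E i y"
  using E_add[of x i "- y"] E_scaleR[of y i "- 1"] by (simp add: A.minus_mem)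

lemma E_sum: "(\<And>k. k \<in> I \<Longrightarrow> f k \<in> A i) \<Longrightarrow> E i (sum f I) = (\<Sum>k\<in>I. E i (f k))"
  by (induction I rule: infinite_finite_induct) (auto simp: E_zero E_add A.sum_mem)

lemma E_left: "b \<in> B \<Longrightarrow> x \<in> A i \<Longrightarrow> E i (\<iota> i b o\<^sub>L x) = b o\<^sub>L E i x"
  using E_bimodule[of b x i "unit_of B"]
  by (simp add: iota_unit A.unit_right B.unit_right B.unit_mem A.comp_mem iota_mem B.comp_mem E_mem)

lemma E_right: "b \<in> B \<Longrightarrow> x \<in> A i \<Longrightarrow> E i (x o\<^sub>L \<iota> i b) = E i x o\<^sub>L b"
  using E_bimodule[of "unit_of B" x i b]
  by (simp add: iota_unit A.unit_left B.unit_left B.unit_mem A.comp_mem iota_mem B.comp_mem E_mem)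

text \<open>\<open>conditional_expectation\<close> records preservation of positivity, not of
  adjoints. Adding \<open>norm h\<close> times the unit makes \<open>h\<close> positive, and the
  unit is sent to the self-adjoint unit of \<open>B\<close>.\<close>

lemma E_selfadj:
  assumes "h \<in> A i" "op_adj h = h"
  shows "op_adj (E i h) = E i h"
proof -
  let ?p = "h + norm h *\<^sub>R unit_of (A i)"
  have p: "?p \<in> A i" by (intro A.mem assms)
  have "op_adj (E i ?p) = E i ?p"
    using A.positive_shift[OF assms] p by (intro positive_op_selfadj E_positive B.has_adjI E_mem)
  moreover have "E i ?p = E i h + norm h *\<^sub>R unit_of B"
    using assms E_iota[OF B.unit_mem, of i] by (simp add: E_add E_scaleR A.mem iota_unit)
  ultimately show ?thesis
    using assms by (simp add: op_adj_add op_adj_scaleR B.op_adj_unit B.has_adjI B.mem E_mem)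
qed

text \<open>\<open>x + op_adj x\<close> and \<open>op_scale \<i> (x - op_adj x)\<close> are
  self-adjoint; \<open>E_selfadj\<close> at these two elements gives two linear relations whose sum
  is twice the claim.\<close>

lemma E_adj:
  assumes x: "x \<in> A i"
  shows "E i (op_adj x) = op_adj (E i x)"
proof -
  let ?y = "op_adj x"
  have y: "?y \<in> A i" by (intro A.mem x)
  have hx: "has_adj x" "has_adj ?y" using A.has_adjI[OF x] A.has_adjI[OF y] by auto
  have hE: "has_adj (E i x)" "has_adj (E i ?y)" by (intro B.has_adjI E_mem x y)+
  have "op_adj (E i (x + ?y)) = E i (x + ?y)"
    by (intro E_selfadj A.mem x) (simp add: op_adj_add hx add.commute)
  then have 1: "op_adj (E i x) + op_adj (E i ?y) = E i x + E i ?y"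
    by (simp add: E_add x y op_adj_add hE)
  let ?k = "op_scale \<i> (x - ?y)"
  have "op_scale (- \<i>) (?y - x) = ?k"
    by (rule blinfun_eqI, rule cinner_ext) (simp add: cinner_simps blinfun.bilinear_simps algebra_simps)
  then have "op_adj ?k = ?k"
    using op_adjI[OF is_op_adj_op_scale[of "x - ?y" \<i>]] hx by (simp add: op_adj_diff has_adj_diff)
  then have "op_adj (E i ?k) = E i ?k"
    by (intro E_selfadj A.op_scale_mem A.mem x)
  then have "op_scale (- \<i>) (op_adj (E i x) - op_adj (E i ?y)) = op_scale \<i> (E i x - E i ?y)"
    using op_adjI[OF is_op_adj_op_scale[of "E i x - E i ?y" \<i>]] hE
    by (simp add: E_scale E_diff A.diff_mem x y op_adj_diff has_adj_diff)
  then have "op_scale \<i> (op_scale (- \<i>) (op_adj (E i x) - op_adj (E i ?y)))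
      = op_scale \<i> (op_scale \<i> (E i x - E i ?y))" by simp
  moreover have "op_scale \<i> (op_scale (- \<i>) T) = T" "op_scale \<i> (op_scale \<i> T) = - T" for T :: "'k op"
    using scaleC_of_real[of 1] scaleC_of_real[of "- 1"]
    by (auto intro!: blinfun_eqI simp: scaleC_scaleC blinfun.bilinear_simps)
  ultimately have 2: "op_adj (E i x) - op_adj (E i ?y) = - (E i x - E i ?y)" by simp
  have "2 *\<^sub>R op_adj (E i x) = (op_adj (E i x) + op_adj (E i ?y)) + (op_adj (E i x) - op_adj (E i ?y))"
    by (simp add: scaleR_2)
  also have "\<dots> = 2 *\<^sub>R E i ?y" unfolding 1 2 by (simp add: scaleR_2)
  finally show ?thesis by simp
qed

section \<open>The inner product of a factor\<close>

lemma ip_mem: "x \<in> A i \<Longrightarrow> y \<in> A i \<Longrightarrow> ip i x y \<in> B"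
  unfolding ip_def by (intro E_mem A.mem)

lemma ip_right_module:
  "x \<in> A i \<Longrightarrow> y \<in> A i \<Longrightarrow> b \<in> B \<Longrightarrow> c \<in> B \<Longrightarrow>
    ip i (x o\<^sub>L \<iota> i b) (y o\<^sub>L \<iota> i c) = op_adj b o\<^sub>L ip i x y o\<^sub>L c"
  using E_bimodule[of "op_adj b" "op_adj x o\<^sub>L y" i c]
  by (simp add: ip_def op_adj_comp A.has_adjI[of _ i] iota_mem iota_adj B.mem A.mem comp_assoc)

lemma ip_add_right: "x \<in> A i \<Longrightarrow> y \<in> A i \<Longrightarrow> z \<in> A i \<Longrightarrow> ip i x (y + z) = ip i x y + ip i x z"
  by (simp add: ip_def comp_simps E_add A.mem)

lemma ip_adj: "x \<in> A i \<Longrightarrow> y \<in> A i \<Longrightarrow> op_adj (ip i x y) = ip i y x"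
  by (simp add: ip_def E_adj[symmetric] op_adj_comp A.has_adjI[of _ i] A.mem)

lemma ip_self_positive: "x \<in> A i \<Longrightarrow> positive_op (ip i x x)"
  unfolding ip_def by (intro E_positive positive_op_square A.mem A.has_adjI)

lemma ip_add_left: "x \<in> A i \<Longrightarrow> y \<in> A i \<Longrightarrow> z \<in> A i \<Longrightarrow> ip i (x + y) z = ip i x z + ip i y z"
  by (simp add: ip_def comp_simps E_add A.mem op_adj_add A.has_adjI)

sublocale L: pre_module B "A i" "ip i" for i
proof unfold_locales
  fix x y b c assume xy: "x \<in> A i" "y \<in> A i" and bc: "b \<in> B" "c \<in> B"
  let ?z = "(x o\<^sub>L \<iota> i b) + (y o\<^sub>L \<iota> i c)"
  have m: "x o\<^sub>L \<iota> i b \<in> A i" "y o\<^sub>L \<iota> i c \<in> A i" using xy bc by (auto intro: A.comp_mem iota_mem)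
  have "positive_op (ip i ?z ?z)" by (intro ip_self_positive A.add_mem m)
  also have "ip i ?z ?z = (op_adj b o\<^sub>L ip i x x o\<^sub>L b) + (op_adj b o\<^sub>L ip i x y o\<^sub>L c)
      + (op_adj c o\<^sub>L ip i y x o\<^sub>L b) + (op_adj c o\<^sub>L ip i y y o\<^sub>L c)"
    using xy bc m by (simp add: ip_add_left ip_add_right A.add_mem ip_right_module)
  finally show "positive_op ((op_adj b o\<^sub>L ip i x x o\<^sub>L b) + (op_adj b o\<^sub>L ip i x y o\<^sub>L c)
      + (op_adj c o\<^sub>L ip i y x o\<^sub>L b) + (op_adj c o\<^sub>L ip i y y o\<^sub>L c))" .
qed (auto intro: A.mem ip_mem simp: ip_add_right ip_adj)

lemma ip_sum:
  assumes "\<And>k. k \<in> I \<Longrightarrow> x k \<in> A i" "\<And>k. k \<in> I \<Longrightarrow> \<beta> k \<in> B"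
  shows "ip i (\<Sum>k\<in>I. x k o\<^sub>L \<iota> i (\<beta> k)) (\<Sum>k\<in>I. x k o\<^sub>L \<iota> i (\<beta> k))
    = (\<Sum>k\<in>I. \<Sum>l\<in>I. op_adj (\<beta> k) o\<^sub>L ip i (x k) (x l) o\<^sub>L \<beta> l)"
proof -
  let ?x = "\<lambda>k. x k o\<^sub>L \<iota> i (\<beta> k)"
  have m: "?x k \<in> A i" if "k \<in> I" for k using assms that by (auto intro: A.comp_mem iota_mem)
  have "op_adj (\<Sum>k\<in>I. ?x k) = (\<Sum>k\<in>I. op_adj (?x k))"
    by (intro op_adj_sum A.has_adjI[of _ i] m)
  then have "ip i (\<Sum>k\<in>I. ?x k) (\<Sum>k\<in>I. ?x k) = E i (\<Sum>k\<in>I. \<Sum>l\<in>I. op_adj (?x k) o\<^sub>L ?x l)"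
    by (simp only: ip_def comp_sum_left) (simp only: comp_sum_right)
  also have "\<dots> = (\<Sum>k\<in>I. \<Sum>l\<in>I. ip i (?x k) (?x l))"
    unfolding ip_def using m by (simp add: E_sum A.mem)
  also have "\<dots> = (\<Sum>k\<in>I. \<Sum>l\<in>I. op_adj (\<beta> k) o\<^sub>L ip i (x k) (x l) o\<^sub>L \<beta> l)"
    using assms by (intro sum.cong refl ip_right_module)
  finally show ?thesis .
qed

lemma act_positive:
  assumes "a \<in> A i" "x \<in> A i"
  shows "positive_op (((norm a)\<^sup>2) *\<^sub>R ip i x x - ip i (a o\<^sub>L x) (a o\<^sub>L x))"
proof -
  have "positive_op (E i (((norm a)\<^sup>2) *\<^sub>R (op_adj x o\<^sub>L x) - (op_adj (a o\<^sub>L x) o\<^sub>L (a o\<^sub>L x))))"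
    using assms by (intro E_positive positive_norm_square_diff A.mem A.has_adjI)
  then show ?thesis using assms by (simp add: ip_def E_diff E_scaleR A.mem)
qed

lemma mnorm_act:
  assumes "a \<in> A i" "x \<in> A i"
  shows "mnorm (ip i) (a o\<^sub>L x) \<le> norm a * mnorm (ip i) x"
proof -
  have m: "a o\<^sub>L x \<in> A i" using assms by (rule A.comp_mem)
  have "norm (ip i (a o\<^sub>L x) (a o\<^sub>L x)) \<le> norm (((norm a)\<^sup>2) *\<^sub>R ip i x x)"
    by (intro positive_op_norm_mono act_positive ip_self_positive m assms B.has_adjI ip_mem)
  then have "(mnorm (ip i) (a o\<^sub>L x))\<^sup>2 \<le> (norm a * mnorm (ip i) x)\<^sup>2"
    by (simp add: L.norm_ip_self power_mult_distrib)
  then show ?thesis by (rule power2_le_imp_le) simp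
qed

lemma mnorm_iota: "b \<in> B \<Longrightarrow> mnorm (ip i) (\<iota> i b) \<le> norm b"
proof -
  assume b: "b \<in> B"
  have "ip i (\<iota> i b) (\<iota> i b) = op_adj b o\<^sub>L b"
    using b E_left[of "op_adj b" "\<iota> i b" i] by (simp add: ip_def iota_adj[symmetric] B.mem iota_mem E_iota)
  then have "(mnorm (ip i) (\<iota> i b))\<^sup>2 = norm (op_adj b o\<^sub>L b)" by (simp flip: L.norm_ip_self)
  also have "\<dots> \<le> norm (op_adj b) * norm b" by (rule norm_blinfun_compose)
  also have "\<dots> \<le> (norm b)\<^sup>2"
    using norm_op_adj_le[OF B.has_adjI[OF b]] by (simp add: power2_eq_square mult_right_mono)
  finally show ?thesis by (rule power2_le_imp_le) simp
qed

section \<open>The completed factors: left action, inner product, extended expectation\<close>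

abbreviation "Cau i \<equiv> cauchy_in (A i) (ip i)"
abbreviation "Cls i \<equiv> cls (A i) (ip i)"
abbreviation "Cip i \<equiv> cip (ip i)"

lemma Lc_cases:
  assumes "h \<in> Lc i"
  obtains s where "s \<in> Cau i" "h = Cls i s"
  using assms by (auto simp: Lc_def completion_def)

lemma Cls_mem: "s \<in> Cau i \<Longrightarrow> Cls i s \<in> Lc i"
  unfolding Lc_def by (rule L.cls_mem)

lemma Cau_act:
  assumes "a \<in> A i" "s \<in> Cau i"
  shows "(\<lambda>n. a o\<^sub>L s n) \<in> Cau i"
proof (rule L.Cau_image[OF assms(2)])
  fix m n
  note m = L.Cau_mem[OF assms(2)]
  show "a o\<^sub>L s n \<in> A i" by (intro A.comp_mem assms m)
  show "mnorm (ip i) ((a o\<^sub>L s m) - (a o\<^sub>L s n)) \<le> norm a * mnorm (ip i) (s m - s n)"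
    using mnorm_act[OF assms(1) A.diff_mem[OF m m], of m n] by (simp add: comp_simps)
qed

text \<open>Left multiplication by \<open>a\<close> is Lipschitz with constant
  \<open>norm a\<close>, so it respects null sequences and the representative chosen inside
  \<open>lact\<close> is immaterial.\<close>

lemma lact_Cls:
  assumes "a \<in> A i" "s \<in> Cau i"
  shows "lact i a (Cls i s) = Cls i (\<lambda>n. a o\<^sub>L s n)"
  unfolding lact_def cmap_def
proof (rule L.cls_eq)
  let ?r = "rep (Cls i s)"
  note r = L.rep_cls[OF assms(2)]
  note m = L.Cau_mem[OF assms(2)] L.Cau_mem[OF r(1)]
  show "(\<lambda>n. a o\<^sub>L ?r n) \<in> Cau i" "(\<lambda>n. a o\<^sub>L s n) \<in> Cau i"
    by (intro Cau_act assms r)+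
  show "(\<lambda>n. mnorm (ip i) ((a o\<^sub>L ?r n) - (a o\<^sub>L s n))) \<longlonglongrightarrow> 0"
  proof (rule L.null_diff_image)
    show "(\<lambda>n. mnorm (ip i) (?r n - s n)) \<longlonglongrightarrow> 0"
      by (rule L.null_diff_sym[OF m r(2)])
    show "mnorm (ip i) ((a o\<^sub>L ?r n) - (a o\<^sub>L s n)) \<le> norm a * mnorm (ip i) (?r n - s n)" for n
      using mnorm_act[OF assms(1) A.diff_mem[OF m(2) m(1)], of n n] by (simp add: comp_simps)
  qed
qed

lemma lact_mem: "a \<in> A i \<Longrightarrow> h \<in> Lc i \<Longrightarrow> lact i a h \<in> Lc i"
  by (metis Lc_cases lact_Cls Cau_act Cls_mem)

lemma hat_Cls: "hat i x = Cls i (\<lambda>_. x)"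
  by (simp add: hat_def emb_def)

lemma hat_mem: "x \<in> A i \<Longrightarrow> hat i x \<in> Lc i"
  by (simp add: hat_Cls Cls_mem L.Cau_const)

lemma lact_hat: "a \<in> A i \<Longrightarrow> x \<in> A i \<Longrightarrow> lact i a (hat i x) = hat i (a o\<^sub>L x)"
  unfolding hat_Cls by (simp add: lact_Cls L.Cau_const)

lemma Cip_mem: "h \<in> Lc i \<Longrightarrow> k \<in> Lc i \<Longrightarrow> Cip i h k \<in> B"
  unfolding Lc_def by (rule L.cip_mem)

lemma Cip_Cls: "s \<in> Cau i \<Longrightarrow> t \<in> Cau i \<Longrightarrow> (\<lambda>n. ip i (s n) (t n)) \<longlonglongrightarrow> Cip i (Cls i s) (Cls i t)"
  by (rule L.cip_cls)

lemma Cip_adj: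
  assumes "h \<in> Lc i" "k \<in> Lc i"
  shows "op_adj (Cip i h k) = Cip i k h"
proof -
  obtain s t where s: "s \<in> Cau i" "h = Cls i s" and t: "t \<in> Cau i" "k = Cls i t"
    using assms Lc_cases by metis
  have "is_op_adj (ip i (s n) (t n)) (ip i (t n) (s n))" for n
    using has_adjD[OF B.has_adjI[OF ip_mem]] ip_adj L.Cau_mem[OF s(1)] L.Cau_mem[OF t(1)] by metis
  then show ?thesis
    unfolding s t by (intro op_adjI op_adj_limit[OF Cip_Cls Cip_Cls] s t)
qed

lemma Cip_hat: "x \<in> A i \<Longrightarrow> y \<in> A i \<Longrightarrow> Cip i (hat i x) (hat i y) = ip i x y"
  using Cip_Cls[OF L.Cau_const L.Cau_const, of x i y] by (simp add: hat_Cls LIMSEQ_const_iff)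

lemma ip_act: "a \<in> A i \<Longrightarrow> x \<in> A i \<Longrightarrow> y \<in> A i \<Longrightarrow> ip i x (a o\<^sub>L y) = ip i (op_adj a o\<^sub>L x) y"
  by (simp add: ip_def op_adj_comp A.has_adjI[of _ i] A.mem comp_assoc)

lemma Cip_lact_left:
  assumes "a \<in> A i" "h \<in> Lc i" "k \<in> Lc i"
  shows "Cip i h (lact i a k) = Cip i (lact i (op_adj a) h) k"
proof -
  obtain s t where s: "s \<in> Cau i" "h = Cls i s" and t: "t \<in> Cau i" "k = Cls i t"
    using assms Lc_cases by metis
  have "(\<lambda>n. ip i (s n) (a o\<^sub>L t n)) \<longlonglongrightarrow> Cip i h (lact i a k)"
    unfolding s t using assms s t by (simp add: lact_Cls Cip_Cls Cau_act)
  moreover have "(\<lambda>n. ip i (op_adj a o\<^sub>L s n) (t n)) \<longlonglongrightarrow> Cip i (lact i (op_adj a) h) k"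
    unfolding s t using assms s t by (simp add: lact_Cls Cip_Cls Cau_act A.mem)
  moreover have "ip i (s n) (a o\<^sub>L t n) = ip i (op_adj a o\<^sub>L s n) (t n)" for n
    by (intro ip_act assms L.Cau_mem s t)
  ultimately show ?thesis using LIMSEQ_unique by simp
qed

lemma lact_lact: "a \<in> A i \<Longrightarrow> a' \<in> A i \<Longrightarrow> h \<in> Lc i \<Longrightarrow> lact i a (lact i a' h) = lact i (a o\<^sub>L a') h"
  by (elim Lc_cases) (simp add: lact_Cls Cau_act A.mem comp_assoc)

lemma lact_unit: "h \<in> Lc i \<Longrightarrow> lact i (unit_of (A i)) h = h"
  by (elim Lc_cases) (simp add: lact_Cls A.unit_mem A.unit_left L.Cau_mem)

lemma Cip_lact_add:
  assumes "a \<in> A i" "a' \<in> A i" "h \<in> Lc i" "k \<in> Lc i"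
  shows "Cip i h (lact i (a + a') k) = Cip i h (lact i a k) + Cip i h (lact i a' k)"
proof -
  obtain s t where s: "s \<in> Cau i" "h = Cls i s" and t: "t \<in> Cau i" "k = Cls i t"
    using assms Lc_cases by metis
  have 1: "(\<lambda>n. ip i (s n) (c o\<^sub>L t n)) \<longlonglongrightarrow> Cip i h (lact i c k)" if "c \<in> A i" for c
    unfolding s t using that s t by (simp add: lact_Cls Cip_Cls Cau_act)
  have "ip i (s n) ((a + a') o\<^sub>L t n) = ip i (s n) (a o\<^sub>L t n) + ip i (s n) (a' o\<^sub>L t n)" for n
    by (simp add: comp_simps ip_add_right A.mem assms L.Cau_mem[OF s(1)] L.Cau_mem[OF t(1)])
  then show ?thesis
    using LIMSEQ_unique[OF 1[OF A.add_mem[OF assms(1,2)]]] tendsto_add[OF 1[OF assms(1)] 1[OF assms(2)]]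
    by simp
qed

lemma Cip_lact_scaleR:
  assumes "a \<in> A i" "h \<in> Lc i" "k \<in> Lc i"
  shows "Cip i h (lact i (r *\<^sub>R a) k) = r *\<^sub>R Cip i h (lact i a k)"
proof -
  obtain s t where s: "s \<in> Cau i" "h = Cls i s" and t: "t \<in> Cau i" "k = Cls i t"
    using assms Lc_cases by metis
  have 1: "(\<lambda>n. ip i (s n) (c o\<^sub>L t n)) \<longlonglongrightarrow> Cip i h (lact i c k)" if "c \<in> A i" for c
    unfolding s t using that s t by (simp add: lact_Cls Cip_Cls Cau_act)
  have "ip i (s n) ((r *\<^sub>R a) o\<^sub>L t n) = r *\<^sub>R ip i (s n) (a o\<^sub>L t n)" for n
    by (simp add: ip_def comp_simps E_scaleR A.mem assms L.Cau_mem[OF s(1)] L.Cau_mem[OF t(1)])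
  then show ?thesis
    using LIMSEQ_unique[OF 1[OF A.scaleR_mem[OF assms(1)]]] tendsto_scaleR[OF tendsto_const 1[OF assms(1)]]
    by simp
qed

text \<open>\<open>E i\<close> is the pairing with the unit vector; the convergence behind
  \<open>Ebar\<close> thereby reduces to that of inner products.\<close>

lemma E_ip: "x \<in> A i \<Longrightarrow> E i x = ip i (unit_of (A i)) x"
  by (simp add: ip_def A.op_adj_unit A.unit_left)

lemma Ebar_Cls:
  assumes "s \<in> Cau i"
  shows "(\<lambda>n. E i (s n)) \<longlonglongrightarrow> Ebar i (Cls i s)"
proof -
  have 1: "(\<lambda>n. E i (t n)) \<longlonglongrightarrow> Cip i (hat i (unit_of (A i))) (Cls i t)" if "t \<in> Cau i" for t
    using Cip_Cls[OF L.Cau_const[OF A.unit_mem] that] L.Cau_mem[OF that] by (simp add: E_ip hat_Cls)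
  have "Ebar i (Cls i s) = Cip i (hat i (unit_of (A i))) (Cls i (rep (Cls i s)))"
    unfolding Ebar_def by (rule limI[OF 1[OF L.rep_cls(1)[OF assms]]])
  also have "Cls i (rep (Cls i s)) = Cls i s" by (intro L.cls_rep L.cls_mem assms)
  finally show ?thesis using 1[OF assms] by simp
qed

lemma Ebar_mem: "h \<in> Lc i \<Longrightarrow> Ebar i h \<in> B"
  by (elim Lc_cases) (auto intro: B.limit_mem[OF _ Ebar_Cls] E_mem L.Cau_mem)

text \<open>The coefficient produced by annihilation with \<open>a\<close> is a pairing with the
  vector that creation with \<open>op_adj a\<close> inserts. This is the adjointness of the two at a
  single letter.\<close>

lemma Cip_hat_left:
  assumes "a \<in> A i" "h \<in> Lc i"
  shows "Cip i (hat i (op_adj a)) h = Ebar i (lact i a h)"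
proof -
  obtain s where s: "s \<in> Cau i" "h = Cls i s" using assms Lc_cases by metis
  have "(\<lambda>n. ip i (op_adj a) (s n)) \<longlonglongrightarrow> Cip i (hat i (op_adj a)) h"
    unfolding s hat_Cls by (intro Cip_Cls L.Cau_const A.mem assms s)
  moreover have "(\<lambda>n. E i (a o\<^sub>L s n)) \<longlonglongrightarrow> Ebar i (lact i a h)"
    using Ebar_Cls[OF Cau_act[OF assms(1) s(1)]] s assms by (simp add: lact_Cls)
  moreover have "ip i (op_adj a) (s n) = E i (a o\<^sub>L s n)" for n
    using assms by (simp add: ip_def A.has_adjI)
  ultimately show ?thesis using LIMSEQ_unique by simp
qed

lemma H_Lc: "h \<in> H i \<Longrightarrow> h \<in> Lc i"
  by (simp add: H_def)

lemma hat_H: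
  assumes "a \<in> A i" "E i a = 0"
  shows "hat i a \<in> H i"
proof -
  have "ip i (\<iota> i b) a = 0" if "b \<in> B" for b
    using that assms E_left[of "op_adj b" a i] by (simp add: ip_def iota_adj[symmetric] B.mem)
  then show ?thesis using assms by (simp add: H_def hat_mem Cip_hat iota_mem)
qed

lemma lact_H:
  assumes "b \<in> B" "h \<in> H i"
  shows "lact i (\<iota> i b) h \<in> H i"
proof -
  have "Cip i (hat i (\<iota> i c)) (lact i (\<iota> i b) h) = 0" if "c \<in> B" for c
  proof -
    have "Cip i (hat i (\<iota> i c)) (lact i (\<iota> i b) h) = Cip i (hat i (\<iota> i (op_adj b o\<^sub>L c))) h"
      using assms that
      by (simp add: Cip_lact_left iota_mem hat_mem H_Lc iota_adj[symmetric] lact_hat B.mem iota_comp)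
    then show ?thesis using assms that by (simp add: H_def B.mem)
  qed
  then show ?thesis using assms by (simp add: H_def lact_mem iota_mem)
qed

text \<open>For elements x_k of \<open>A i\<close> the sum is the inner product of the vector \<Sum>
  x_k \<iota>(\<beta>_k) with itself; representatives and closedness of positivity under limits do
  the rest.\<close>

lemma gram_positive:
  assumes "\<And>k. k \<in> I \<Longrightarrow> h k \<in> Lc i" "\<And>k. k \<in> I \<Longrightarrow> \<beta> k \<in> B"
  shows "positive_op (\<Sum>k\<in>I. \<Sum>l\<in>I. op_adj (\<beta> k) o\<^sub>L Cip i (h k) (h l) o\<^sub>L \<beta> l)"
proof (rule positive_op_limit)
  have r: "rep (h k) \<in> Cau i" if "k \<in> I" for k
    using assms(1)[OF that] unfolding Lc_def by (rule L.rep_Cau)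
  show "(\<lambda>n. \<Sum>k\<in>I. \<Sum>l\<in>I. op_adj (\<beta> k) o\<^sub>L ip i (rep (h k) n) (rep (h l) n) o\<^sub>L \<beta> l)
      \<longlonglongrightarrow> (\<Sum>k\<in>I. \<Sum>l\<in>I. op_adj (\<beta> k) o\<^sub>L Cip i (h k) (h l) o\<^sub>L \<beta> l)"
    using assms(1) unfolding Lc_def by (intro tendsto_sum comp_tendsto tendsto_const L.cip_rep)
  show "positive_op (\<Sum>k\<in>I. \<Sum>l\<in>I. op_adj (\<beta> k) o\<^sub>L ip i (rep (h k) n) (rep (h l) n) o\<^sub>L \<beta> l)" for n
    using assms r L.Cau_mem
    by (subst ip_sum[symmetric]) (auto intro!: ip_self_positive A.mem iota_mem)
qed

section \<open>Compression of left multiplication to \<open>H i\<close>\<close>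

definition diag :: "'i \<Rightarrow> 'h op \<Rightarrow> (nat \<Rightarrow> 'h op) set \<Rightarrow> (nat \<Rightarrow> 'h op) set" where
  "diag i a h = cdiff (A i) (ip i) (lact i a h) (hat i (\<iota> i (Ebar i (lact i a h))))"

lemma mnorm_E:
  assumes "x \<in> A i"
  shows "norm (E i x) \<le> mnorm (ip i) x"
proof -
  have "norm (E i x) \<le> mnorm (ip i) (unit_of (A i)) * mnorm (ip i) x"
    using L.norm_ip_le[OF A.unit_mem assms] assms by (simp add: E_ip)
  also have "\<dots> \<le> norm (unit_of B) * mnorm (ip i) x"
    using mnorm_iota[OF B.unit_mem, of i] by (intro mult_right_mono) (auto simp: iota_unit)
  also have "\<dots> \<le> 1 * mnorm (ip i) x"
    by (intro mult_right_mono norm_blinfun_bound) (auto simp: B.norm_unit_apply)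
  finally show ?thesis by simp
qed

text \<open>The Lipschitz constant 2 is the triangle inequality for x - \<iota>(E(x)), as
  \<open>E\<close> and \<iota> do not increase the norms involved.\<close>

lemma Cau_center:
  assumes "s \<in> Cau i"
  shows "(\<lambda>n. s n - \<iota> i (E i (s n))) \<in> Cau i"
proof (rule L.Cau_image[OF assms])
  note m = L.Cau_mem[OF assms]
  show "s n - \<iota> i (E i (s n)) \<in> A i" for n by (intro A.mem m iota_mem E_mem)
  fix j n
  let ?x = "s j - s n"
  have x: "?x \<in> A i" by (intro A.mem m)
  have eq: "(s j - \<iota> i (E i (s j))) - (s n - \<iota> i (E i (s n))) = ?x - \<iota> i (E i ?x)"
    by (simp add: E_diff iota_diff E_mem m)
  have "mnorm (ip i) (?x - \<iota> i (E i ?x)) \<le> mnorm (ip i) ?x + mnorm (ip i) (0 - \<iota> i (E i ?x))"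
    using L.mnorm_diff_triangle[of ?x i 0 "\<iota> i (E i ?x)"] x by (simp add: iota_mem E_mem)
  moreover have "mnorm (ip i) (0 - \<iota> i (E i ?x)) = mnorm (ip i) (\<iota> i (E i ?x) - 0)"
    by (rule L.mnorm_commute) (auto intro: iota_mem E_mem x)
  moreover have "mnorm (ip i) (\<iota> i (E i ?x)) \<le> mnorm (ip i) ?x"
    using mnorm_iota[OF E_mem[OF x], of i] mnorm_E[OF x] by simp
  ultimately show "mnorm (ip i) ((s j - \<iota> i (E i (s j))) - (s n - \<iota> i (E i (s n)))) \<le> 2 * mnorm (ip i) ?x"
    unfolding eq by simp
qed

text \<open>\<open>diag\<close> subtracts the embedded limit of the
  \<open>E i (a o\<^sub>L t n)\<close>, this formula the terms themselves. They differ by a null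
  sequence because \<iota> does not increase norms. The termwise form permits algebra in
  \<open>A i\<close> before the limit is taken.\<close>

lemma diag_Cls:
  assumes "a \<in> A i" "t \<in> Cau i"
  shows "diag i a (Cls i t) = Cls i (\<lambda>n. (a o\<^sub>L t n) - \<iota> i (E i (a o\<^sub>L t n)))"
proof -
  define s where "s = (\<lambda>n. a o\<^sub>L t n)"
  have s: "s \<in> Cau i" unfolding s_def by (intro Cau_act assms)
  define \<beta> where "\<beta> = Ebar i (Cls i s)"
  have \<beta>: "\<beta> \<in> B" unfolding \<beta>_def by (intro Ebar_mem Cls_mem s)
  have h: "(\<lambda>_. \<iota> i \<beta>) \<in> Cau i" by (intro L.Cau_const iota_mem \<beta>)
  let ?r = "rep (Cls i s)" and ?q = "rep (hat i (\<iota> i \<beta>))"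
  have r: "?r \<in> Cau i" "(\<lambda>n. mnorm (ip i) (s n - ?r n)) \<longlonglongrightarrow> 0" by (intro L.rep_cls s)+
  have q: "?q \<in> Cau i" "(\<lambda>n. mnorm (ip i) (\<iota> i \<beta> - ?q n)) \<longlonglongrightarrow> 0"
    unfolding hat_Cls using L.rep_cls[OF h] by simp_all
  note m = L.Cau_mem[OF s] L.Cau_mem[OF r(1)] L.Cau_mem[OF q(1)]
  let ?u = "\<lambda>n. s n - \<iota> i (E i (s n))" and ?v = "\<lambda>n. ?r n - ?q n"
  have u: "?u \<in> Cau i" by (rule Cau_center[OF s])
  have uv: "(\<lambda>n. mnorm (ip i) (?u n - ?v n)) \<longlonglongrightarrow> 0"
  proof (rule tendsto_sandwich[OF _ _ tendsto_const])
    have "(\<lambda>n. norm (\<beta> - E i (s n))) \<longlonglongrightarrow> norm (\<beta> - \<beta>)"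
      using Ebar_Cls[OF s] unfolding \<beta>_def by (intro tendsto_intros)
    then show "(\<lambda>n. mnorm (ip i) (s n - ?r n) + (norm (\<beta> - E i (s n)) + mnorm (ip i) (\<iota> i \<beta> - ?q n))) \<longlonglongrightarrow> 0"
      using tendsto_add[OF r(2) tendsto_add[OF _ q(2)], of "\<lambda>n. norm (\<beta> - E i (s n))" 0] by simp
    show "\<forall>\<^sub>F n in sequentially. mnorm (ip i) (?u n - ?v n)
        \<le> mnorm (ip i) (s n - ?r n) + (norm (\<beta> - E i (s n)) + mnorm (ip i) (\<iota> i \<beta> - ?q n))"
    proof (intro always_eventually allI)
      fix n
      have E: "E i (s n) \<in> B" by (intro E_mem m)
      have w: "\<iota> i (E i (s n)) \<in> A i" "\<iota> i \<beta> \<in> A i" by (intro iota_mem E \<beta>)+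
      have eq: "?u n - ?v n = (s n - ?r n) + (?q n - \<iota> i (E i (s n)))" by simp
      have "mnorm (ip i) (?u n - ?v n) \<le> mnorm (ip i) (s n - ?r n) + mnorm (ip i) (?q n - \<iota> i (E i (s n)))"
        unfolding eq by (intro L.mnorm_add_le A.diff_mem m w)
      also have "mnorm (ip i) (?q n - \<iota> i (E i (s n)))
          \<le> mnorm (ip i) (?q n - \<iota> i \<beta>) + mnorm (ip i) (\<iota> i \<beta> - \<iota> i (E i (s n)))"
        by (intro L.mnorm_diff_triangle m w)
      also have "mnorm (ip i) (?q n - \<iota> i \<beta>) = mnorm (ip i) (\<iota> i \<beta> - ?q n)"
        by (intro L.mnorm_commute m w)
      also have "\<iota> i \<beta> - \<iota> i (E i (s n)) = \<iota> i (\<beta> - E i (s n))" by (simp add: iota_diff \<beta> E)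
      also have "mnorm (ip i) (\<iota> i (\<beta> - E i (s n))) \<le> norm (\<beta> - E i (s n))"
        by (intro mnorm_iota B.mem \<beta> E)
      finally show "mnorm (ip i) (?u n - ?v n)
        \<le> mnorm (ip i) (s n - ?r n) + (norm (\<beta> - E i (s n)) + mnorm (ip i) (\<iota> i \<beta> - ?q n))" by simp
    qed
  qed auto
  have v: "?v \<in> Cau i"
    by (rule L.Cau_equiv[OF u _ uv]) (intro A.mem m)
  have "Cls i ?u = Cls i ?v" by (rule L.cls_eq[OF u v uv])
  then show ?thesis
    using assms unfolding diag_def cdiff_def by (simp add: lact_Cls \<beta>_def s_def)
qed

lemma Cau_diag: "a \<in> A i \<Longrightarrow> t \<in> Cau i \<Longrightarrow> (\<lambda>n. (a o\<^sub>L t n) - \<iota> i (E i (a o\<^sub>L t n))) \<in> Cau i"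
  by (intro Cau_center Cau_act)

lemma diag_H:
  assumes "a \<in> A i" "h \<in> Lc i"
  shows "diag i a h \<in> H i"
proof -
  obtain t where t: "t \<in> Cau i" "h = Cls i t" using assms Lc_cases by metis
  let ?z = "\<lambda>n. (a o\<^sub>L t n) - \<iota> i (E i (a o\<^sub>L t n))"
  have z: "?z \<in> Cau i" by (intro Cau_diag assms t)
  have zm: "?z n \<in> A i" for n by (rule L.Cau_mem[OF z])
  have m: "a o\<^sub>L t n \<in> A i" for n by (intro A.mem assms L.Cau_mem[OF t(1)])
  have "Cip i (hat i (\<iota> i b)) (diag i a h) = 0" if b: "b \<in> B" for b
  proof -
    have "ip i (\<iota> i b) (?z n) = 0" for n
    proof -
      have "ip i (\<iota> i b) (?z n) = op_adj b o\<^sub>L E i (?z n)"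
        using b zm E_left[of "op_adj b" "?z n" i] by (simp add: ip_def iota_adj[symmetric] B.mem)
      also have "E i (?z n) = 0" by (simp add: E_diff m iota_mem E_mem E_iota)
      finally show ?thesis by simp
    qed
    then show ?thesis
      using Cip_Cls[OF L.Cau_const[OF iota_mem[OF b]] z] assms t
      by (simp add: hat_Cls diag_Cls LIMSEQ_const_iff)
  qed
  moreover have "diag i a h \<in> Lc i" using Cls_mem[OF z] assms t by (simp add: diag_Cls)
  ultimately show ?thesis by (simp add: H_def)
qed

text \<open>Let x be the sum of the r_k \<beta>_k on representatives and y = a x. Right
  \<open>B\<close>-linearity of \<open>E\<close> turns the sum of the compressed vectors into y -
  E(y). Pythagoras then leaves two positive terms: the gap in \<open>act_positive\<close>, and
  \<open>op_adj (E i y) o\<^sub>L E i y\<close>.\<close>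

lemma diag_gram_positive:
  assumes a: "a \<in> A i" and h: "\<And>k. k \<in> I \<Longrightarrow> h k \<in> Lc i" and \<beta>: "\<And>k. k \<in> I \<Longrightarrow> \<beta> k \<in> B"
  shows "positive_op (\<Sum>k\<in>I. \<Sum>l\<in>I. op_adj (\<beta> k) o\<^sub>L
    (((norm a)\<^sup>2) *\<^sub>R Cip i (h k) (h l) - Cip i (diag i a (h k)) (diag i a (h l))) o\<^sub>L \<beta> l)"
proof (rule positive_op_limit)
  define r where "r k = rep (h k)" for k
  define z where "z k n = (a o\<^sub>L r k n) - \<iota> i (E i (a o\<^sub>L r k n))" for k n
  have r: "r k \<in> Cau i" "h k = Cls i (r k)" if "k \<in> I" for k
    using h[OF that] unfolding Lc_def r_def by (auto intro: L.rep_Cau simp: L.cls_rep)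
  have z: "z k \<in> Cau i" "diag i a (h k) = Cls i (z k)" if "k \<in> I" for k
    using Cau_diag[OF a r(1)[OF that]] diag_Cls[OF a r(1)[OF that]] r(2)[OF that] by (auto simp: z_def[abs_def])
  have "(\<lambda>n. ip i (r k n) (r l n)) \<longlonglongrightarrow> Cip i (h k) (h l)" if "k \<in> I" "l \<in> I" for k l
    unfolding r(2)[OF that(1)] r(2)[OF that(2)] by (intro Cip_Cls r that)
  moreover have "(\<lambda>n. ip i (z k n) (z l n)) \<longlonglongrightarrow> Cip i (diag i a (h k)) (diag i a (h l))"
    if "k \<in> I" "l \<in> I" for k l
    unfolding z(2)[OF that(1)] z(2)[OF that(2)] by (intro Cip_Cls z that)
  ultimately show "(\<lambda>n. \<Sum>k\<in>I. \<Sum>l\<in>I. op_adj (\<beta> k) o\<^sub>L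
      (((norm a)\<^sup>2) *\<^sub>R ip i (r k n) (r l n) - ip i (z k n) (z l n)) o\<^sub>L \<beta> l)
    \<longlonglongrightarrow> (\<Sum>k\<in>I. \<Sum>l\<in>I. op_adj (\<beta> k) o\<^sub>L
    (((norm a)\<^sup>2) *\<^sub>R Cip i (h k) (h l) - Cip i (diag i a (h k)) (diag i a (h l))) o\<^sub>L \<beta> l)"
    by (intro tendsto_sum comp_tendsto tendsto_const tendsto_diff tendsto_scaleR)
  fix n
  define x where "x = (\<Sum>k\<in>I. r k n o\<^sub>L \<iota> i (\<beta> k))"
  define y where "y = a o\<^sub>L x"
  have m: "r k n \<in> A i" "z k n \<in> A i" "\<iota> i (\<beta> k) \<in> A i" if "k \<in> I" for k
    using L.Cau_mem r(1) z(1) \<beta> iota_mem that by auto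
  have x: "x \<in> A i" unfolding x_def by (intro A.mem m)
  have y: "y \<in> A i" unfolding y_def by (intro A.mem a x)
  have zs: "(\<Sum>k\<in>I. z k n o\<^sub>L \<iota> i (\<beta> k)) = y - \<iota> i (E i y)"
  proof -
    have "y = (\<Sum>k\<in>I. a o\<^sub>L r k n o\<^sub>L \<iota> i (\<beta> k))"
      unfolding y_def x_def by (simp add: comp_sum_right comp_assoc)
    moreover from this have "E i y = (\<Sum>k\<in>I. E i (a o\<^sub>L r k n) o\<^sub>L \<beta> k)"
      by (simp add: E_sum E_right A.mem a m \<beta> cong: sum.cong)
    then have "\<iota> i (E i y) = (\<Sum>k\<in>I. \<iota> i (E i (a o\<^sub>L r k n)) o\<^sub>L \<iota> i (\<beta> k))"
    proof -
      have "\<iota> i (\<Sum>k\<in>I. E i (a o\<^sub>L r k n) o\<^sub>L \<beta> k) = (\<Sum>k\<in>I. \<iota> i (E i (a o\<^sub>L r k n) o\<^sub>L \<beta> k))"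
        by (intro iota_sum B.comp_mem E_mem A.comp_mem a m \<beta>)
      also have "\<dots> = (\<Sum>k\<in>I. \<iota> i (E i (a o\<^sub>L r k n)) o\<^sub>L \<iota> i (\<beta> k))"
        using m \<beta> by (intro sum.cong refl iota_comp E_mem A.comp_mem a) auto
      finally show "\<iota> i (E i y) = \<dots>" using \<open>E i y = _\<close> by simp
    qed
    ultimately show ?thesis by (simp add: z_def comp_simps sum_subtractf)
  qed
  have "(\<Sum>k\<in>I. \<Sum>l\<in>I. op_adj (\<beta> k) o\<^sub>L
      (((norm a)\<^sup>2) *\<^sub>R ip i (r k n) (r l n) - ip i (z k n) (z l n)) o\<^sub>L \<beta> l)
    = ((norm a)\<^sup>2) *\<^sub>R (\<Sum>k\<in>I. \<Sum>l\<in>I. op_adj (\<beta> k) o\<^sub>L ip i (r k n) (r l n) o\<^sub>L \<beta> l)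
      - (\<Sum>k\<in>I. \<Sum>l\<in>I. op_adj (\<beta> k) o\<^sub>L ip i (z k n) (z l n) o\<^sub>L \<beta> l)"
    by (simp add: comp_simps sum_subtractf scaleR_sum_right)
  also have "\<dots> = ((norm a)\<^sup>2) *\<^sub>R ip i x x - ip i (y - \<iota> i (E i y)) (y - \<iota> i (E i y))"
    using m \<beta> zs by (simp add: ip_sum[symmetric] x_def)
  \<comment> \<open>The vector y - E(y) is orthogonal to the image of \<open>B\<close>, so a single
    correction term survives.\<close>
  also have "ip i (y - \<iota> i (E i y)) (y - \<iota> i (E i y)) = ip i y y - (op_adj (E i y) o\<^sub>L E i y)"
  proof -
    have e: "E i y \<in> B" "\<iota> i (E i y) \<in> A i" using y by (auto intro: E_mem iota_mem)
    have "ip i y (\<iota> i (E i y)) = op_adj (E i y) o\<^sub>L E i y"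
      unfolding ip_def using y e by (simp add: E_right A.mem E_adj)
    moreover have "ip i (\<iota> i (E i y)) c = op_adj (E i y) o\<^sub>L E i c" if "c \<in> A i" for c
      unfolding ip_def using y e that by (simp add: iota_adj[symmetric] E_left B.mem)
    ultimately show ?thesis
      using y e by (simp add: L.ip_diff_left L.ip_diff_right A.mem E_iota)
  qed
  also have "((norm a)\<^sup>2) *\<^sub>R ip i x x - (ip i y y - (op_adj (E i y) o\<^sub>L E i y))
      = (((norm a)\<^sup>2) *\<^sub>R ip i x x - ip i y y) + (op_adj (E i y) o\<^sub>L E i y)" by simp
  finally show "positive_op (\<Sum>k\<in>I. \<Sum>l\<in>I. op_adj (\<beta> k) o\<^sub>L
      (((norm a)\<^sup>2) *\<^sub>R ip i (r k n) (r l n) - ip i (z k n) (z l n)) o\<^sub>L \<beta> l)"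
    using act_positive[OF a x] y
    by (simp add: y_def[symmetric] positive_op_add positive_op_square B.has_adjI E_mem)
qed

end


section \<open>The Fock module\<close>

lemma (in pre_module) ip_sum_right:
  "x \<in> X \<Longrightarrow> (\<And>k. k \<in> K \<Longrightarrow> f k \<in> X) \<Longrightarrow> ip x (sum f K) = (\<Sum>k\<in>K. ip x (f k))"
  by (induction K rule: infinite_finite_induct) (auto simp: ip_zero_right ip_add_right sum_in)

lemma (in pre_module) ip_sum_left:
  "x \<in> X \<Longrightarrow> (\<And>k. k \<in> K \<Longrightarrow> f k \<in> X) \<Longrightarrow> ip (sum f K) x = (\<Sum>k\<in>K. ip (f k) x)"
  by (induction K rule: infinite_finite_induct) (auto simp: ip_zero_left ip_add_left sum_in)

text \<open>The sum factors as \<open>op_adj s o\<^sub>L c o\<^sub>L s\<close> with \<open>s\<close>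
  the sum of the \<open>\<beta> k\<close>: a matrix all of whose entries equal a positive
  \<open>c\<close> is positive.\<close>

lemma (in vn_algebra) positive_const_pairing:
  assumes c: "c \<in> M" "positive_op c" and \<beta>: "\<And>k. k \<in> I \<Longrightarrow> \<beta> k \<in> M"
  shows "positive_op (\<Sum>k\<in>I. \<Sum>l\<in>I. op_adj (\<beta> k) o\<^sub>L c o\<^sub>L \<beta> l)"
proof -
  have "op_adj (\<Sum>k\<in>I. \<beta> k) = (\<Sum>k\<in>I. op_adj (\<beta> k))" by (intro op_adj_sum has_adjI \<beta>)
  then have "op_adj (\<Sum>k\<in>I. \<beta> k) o\<^sub>L c o\<^sub>L (\<Sum>k\<in>I. \<beta> k) = (\<Sum>k\<in>I. \<Sum>l\<in>I. op_adj (\<beta> k) o\<^sub>L c o\<^sub>L \<beta> l)"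
    by (simp only: comp_sum_left) (simp only: comp_sum_right)
  moreover have "positive_op (op_adj (\<Sum>k\<in>I. \<beta> k) o\<^sub>L c o\<^sub>L (\<Sum>k\<in>I. \<beta> k))"
    by (intro positive_op_conj c has_adjI sum_mem \<beta>)
  ultimately show ?thesis by simp
qed

text \<open>Splits a double sum into diagonal blocks. \<open>Z\<close> may contain classes that do
  not occur, so the blocks can be indexed by a set fixed in advance.\<close>

lemma sum_classes:
  assumes "finite I" "finite Z" "cl ` I \<subseteq> Z" and zero: "\<And>k l. cl k \<noteq> cl l \<Longrightarrow> t k l = 0"
  shows "(\<Sum>k\<in>I. \<Sum>l\<in>I. t k l) = (\<Sum>z\<in>Z. \<Sum>k | k \<in> I \<and> cl k = z. \<Sum>l | l \<in> I \<and> cl l = z. t k l)"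
proof -
  have "(\<Sum>k\<in>I. \<Sum>l\<in>I. t k l) = (\<Sum>z\<in>Z. \<Sum>k | k \<in> I \<and> cl k = z. \<Sum>l\<in>I. t k l)"
    by (rule sum.group[symmetric]) (use assms in auto)
  also have "\<dots> = (\<Sum>z\<in>Z. \<Sum>k | k \<in> I \<and> cl k = z. \<Sum>l | l \<in> I \<and> cl l = z. t k l)"
  proof (rule sum.cong[OF refl], rule sum.cong[OF refl])
    fix z k assume "k \<in> {k. k \<in> I \<and> cl k = z}"
    then have "t k l = 0" if "cl l \<noteq> z" for l using that zero[of k l] by auto
    then show "(\<Sum>l\<in>I. t k l) = (\<Sum>l | l \<in> I \<and> cl l = z. t k l)"
      using assms(1) by (intro sum.mono_neutral_right) auto
  qed
  finally show ?thesis .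
qed

text \<open>Labels the block of a word by its first index, with \<open>None\<close> for the summand
  \<open>B\<close>. Thus \<open>head w \<noteq> Some i\<close> includes the empty word, in front of
  which a letter of index \<open>i\<close> can be created.\<close>

definition head :: "('a \<times> 'b) list \<Rightarrow> 'a option" where
  "head w = (case w of [] \<Rightarrow> None | p # _ \<Rightarrow> Some (fst p))"

definition letter :: "('a \<times> 'b) list \<Rightarrow> 'b" where
  "letter w = snd (hd w)"

lemma head_simps [simp]: "head [] = None" "head (p # w) = Some (fst p)"
  by (simp_all add: head_def)

lemma letter_Cons [simp]: "letter (p # w) = snd p"
  by (simp add: letter_def)

lemma head_eq_None [simp]: "head w = None \<longleftrightarrow> w = []"
  by (cases w) auto

lemma head_SomeD: "head w = Some i \<Longrightarrow> w = (i, letter w) # tl w"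
  by (cases w) auto

context amalgam_expectation
begin

abbreviation "\<u> \<equiv> unit_of B"

section \<open>Words and their inner product\<close>

lemma words_Nil [simp]: "[] \<in> words"
  by (simp add: words_def)

lemma words_Cons: "(i, h) # w \<in> words \<longleftrightarrow> h \<in> H i \<and> w \<in> words \<and> head w \<noteq> Some i"
  by (cases w) (auto simp: words_def)

lemma words_head:
  assumes "w \<in> words" "head w = Some i"
  shows "letter w \<in> H i" "letter w \<in> Lc i" "tl w \<in> words" "head (tl w) \<noteq> Some i"
  using assms words_Cons[of i "letter w" "tl w"] head_SomeD[OF assms(2)] H_Lc by auto

lemma word_ip_head: "head w \<noteq> head v \<Longrightarrow> word_ip b w v = 0"
  by (cases "(b, w, v)" rule: word_ip.cases) auto

lemma word_ip_Some:
  "head w = Some i \<Longrightarrow> head v = Some i \<Longrightarrow>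
    word_ip b w v = word_ip (Cip i (letter w) (lact i (\<iota> i b) (letter v))) (tl w) (tl v)"
  by (cases "(b, w, v)" rule: word_ip.cases) auto

lemma word_ip_mem: "b \<in> B \<Longrightarrow> w \<in> words \<Longrightarrow> v \<in> words \<Longrightarrow> word_ip b w v \<in> B"
proof (induction b w v rule: word_ip.induct)
  case (2 b i h w j k v)
  then show ?case
    by (auto simp: words_Cons iota_mem H_Lc Cip_mem lact_mem)
qed auto

lemma word_ip_add:
  "b \<in> B \<Longrightarrow> b' \<in> B \<Longrightarrow> w \<in> words \<Longrightarrow> v \<in> words \<Longrightarrow>
    word_ip (b + b') w v = word_ip b w v + word_ip b' w v"
proof (induction b w v arbitrary: b' rule: word_ip.induct)
  case (2 b i h w j k v)
  then show ?case
    by (auto simp: words_Cons iota_add Cip_lact_add iota_mem H_Lc Cip_mem lact_mem)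
qed auto

lemma word_ip_scaleR:
  "b \<in> B \<Longrightarrow> w \<in> words \<Longrightarrow> v \<in> words \<Longrightarrow> word_ip (r *\<^sub>R b) w v = r *\<^sub>R word_ip b w v"
proof (induction b w v rule: word_ip.induct)
  case (2 b i h w j k v)
  then show ?case
    by (auto simp: words_Cons iota_scaleR Cip_lact_scaleR iota_mem H_Lc Cip_mem lact_mem)
qed auto

lemma word_ip_zero: "w \<in> words \<Longrightarrow> v \<in> words \<Longrightarrow> word_ip 0 w v = 0"
  using word_ip_scaleR[of 0 w v 0] by simp

lemma word_ip_diff:
  "b \<in> B \<Longrightarrow> b' \<in> B \<Longrightarrow> w \<in> words \<Longrightarrow> v \<in> words \<Longrightarrow>
    word_ip (b - b') w v = word_ip b w v - word_ip b' w v"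
  using word_ip_add[of b "- b'" w v] word_ip_scaleR[of b' w v "- 1"] by (simp add: B.minus_mem)

lemma word_ip_sum:
  "(\<And>k. k \<in> I \<Longrightarrow> b k \<in> B) \<Longrightarrow> w \<in> words \<Longrightarrow> v \<in> words \<Longrightarrow>
    word_ip (sum b I) w v = (\<Sum>k\<in>I. word_ip (b k) w v)"
  by (induction I rule: infinite_finite_induct) (auto simp: word_ip_zero word_ip_add B.sum_mem)

lemma word_ip_adj:
  "b \<in> B \<Longrightarrow> w \<in> words \<Longrightarrow> v \<in> words \<Longrightarrow> op_adj (word_ip b w v) = word_ip (op_adj b) v w"
proof (induction b w v rule: word_ip.induct)
  case (2 b i h w j k v)
  show ?case
  proof (cases "i = j")
    case True
    with 2 have hk: "h \<in> Lc i" "k \<in> Lc i" by (auto simp: words_Cons H_Lc)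
    have b: "\<iota> i b \<in> A i" using 2 by (intro iota_mem)
    have "op_adj (Cip i h (lact i (\<iota> i b) k)) = Cip i (lact i (\<iota> i b) k) h"
      using hk b by (simp add: Cip_adj lact_mem)
    also have "\<dots> = Cip i k (lact i (\<iota> i (op_adj b)) h)"
      using hk b 2(2) by (simp add: iota_adj Cip_lact_left A.mem A.has_adjI[OF b])
    finally show ?thesis
      using 2 True hk b by (simp add: words_Cons Cip_mem lact_mem)
  qed simp
qed auto

text \<open>Families are indexed by an arbitrary type and not by words, because different words may
  coincide once their first letters are removed.\<close>

abbreviation pairing :: "('x \<Rightarrow> 'k op) \<Rightarrow> ('x \<Rightarrow> ('i, 'h) word) \<Rightarrow> 'x \<Rightarrow> 'x \<Rightarrow> 'k op \<Rightarrow> 'k op" where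
  "pairing c w k l b \<equiv> op_adj (c k) o\<^sub>L word_ip b (w k) (w l) o\<^sub>L c l"

text \<open>Removing the first letters turns the sum over words starting with \<open>j\<close> into a pairing of the
  inner products of the shorter words with the Gram matrix of the letters.\<close>

lemma word_ip_positive_squares:
  assumes "finite I" "\<And>k. k \<in> I \<Longrightarrow> w k \<in> words" "\<And>k. k \<in> I \<Longrightarrow> length (w k) < n"
    and "\<And>k. k \<in> I \<Longrightarrow> c k \<in> B" "\<And>k. k \<in> I \<Longrightarrow> b k \<in> B"
  shows "positive_op (\<Sum>k\<in>I. \<Sum>l\<in>I. pairing c w k l (op_adj (b k) o\<^sub>L b l))"
  using assms
proof (induction n arbitrary: I w b)
  case 0
  then have "I = {}" by fastforce
  then show ?case by simp
next
  case (Suc n)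
  note w = Suc.prems(2) and c = Suc.prems(4) and b = Suc.prems(5)
  let ?t = "\<lambda>k l. pairing c w k l (op_adj (b k) o\<^sub>L b l)"
  let ?J = "\<lambda>z. {k. k \<in> I \<and> head (w k) = z}"
  have "(\<Sum>k\<in>I. \<Sum>l\<in>I. ?t k l) = (\<Sum>z\<in>(head \<circ> w) ` I. \<Sum>k\<in>?J z. \<Sum>l\<in>?J z. ?t k l)"
    using sum_classes[of I "(head \<circ> w) ` I" "head \<circ> w" ?t] Suc.prems(1)
    by (simp add: word_ip_head)
  moreover have "positive_op (\<Sum>k\<in>?J z. \<Sum>l\<in>?J z. ?t k l)" for z
  proof (cases z)
    case None
    \<comment> \<open>All words in this block are empty and \<open>word_ip\<close> returns its
      parameter, so the block is a single square.\<close>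
    let ?s = "\<Sum>k\<in>?J z. b k o\<^sub>L c k"
    have "op_adj ?s = (\<Sum>k\<in>?J z. op_adj (b k o\<^sub>L c k))"
      using b c by (intro op_adj_sum B.has_adjI B.mem) auto
    then have "op_adj ?s o\<^sub>L ?s = (\<Sum>k\<in>?J z. \<Sum>l\<in>?J z. op_adj (b k o\<^sub>L c k) o\<^sub>L (b l o\<^sub>L c l))"
      by (simp only: comp_sum_left) (simp only: comp_sum_right)
    also have "\<dots> = (\<Sum>k\<in>?J z. \<Sum>l\<in>?J z. ?t k l)"
      using None b c by (intro sum.cong refl) (auto simp: op_adj_comp B.has_adjI comp_assoc)
    finally show ?thesis
      using positive_op_square[of ?s] b c by (auto intro!: B.has_adjI B.mem)
  next
    case (Some j)
    have J: "w k \<in> words" "head (w k) = Some j" "k \<in> I" if "k \<in> ?J z" for k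
      using that Some w by auto
    note h = words_head[OF J(1,2)]
    have Jc: "c k \<in> B" "b k \<in> B" "\<iota> j (b k) \<in> A j" if "k \<in> ?J z" for k
      using that b c iota_mem by auto
    define N where "N k l = Cip j (letter (w k)) (lact j (\<iota> j (op_adj (b k) o\<^sub>L b l)) (letter (w l)))" for k l
    \<comment> \<open>In this form \<open>N\<close> is the Gram matrix of the first letters
      multiplied on the left by the \<open>b k\<close>, which makes it positive.\<close>
    have N: "N k l = Cip j (lact j (\<iota> j (b k)) (letter (w k))) (lact j (\<iota> j (b l)) (letter (w l)))"
      if "k \<in> ?J z" "l \<in> ?J z" for k l
    proof -
      have "lact j (\<iota> j (op_adj (b k) o\<^sub>L b l)) (letter (w l))
          = lact j (op_adj (\<iota> j (b k))) (lact j (\<iota> j (b l)) (letter (w l)))"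
        using Jc that h by (simp add: iota_comp iota_adj lact_lact B.mem A.mem)
      then show ?thesis
        unfolding N_def using Jc that h
        by (simp add: Cip_lact_left[of "op_adj (\<iota> j (b k))"] A.mem lact_mem A.has_adjI[of _ j])
    qed
    \<comment> \<open>Of the two inputs of the elimination, positivity of the pairing on squares is
      the induction hypothesis for the shorter words, and positivity of the matrix is
      \<open>gram_positive\<close>.\<close>
    have "positive_op (\<Sum>k\<in>?J z. \<Sum>l\<in>?J z. pairing c (\<lambda>k. tl (w k)) k l (N k l))"
    proof (rule B.positive_op_pairing[where q = "pairing c (\<lambda>k. tl (w k))" and N = N])
      show "finite (?J z)" using Suc.prems(1) by simp
    next
      fix k l b1 b2 assume kl: "k \<in> ?J z" "l \<in> ?J z" and b12: "b1 \<in> B" "b2 \<in> B"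
      show "pairing c (\<lambda>k. tl (w k)) k l (b1 + b2)
          = pairing c (\<lambda>k. tl (w k)) k l b1 + pairing c (\<lambda>k. tl (w k)) k l b2"
        using b12 h(3)[OF kl(1) kl(1)] h(3)[OF kl(2) kl(2)] by (simp add: word_ip_add comp_simps)
    next
      fix k l b1 r assume kl: "k \<in> ?J z" "l \<in> ?J z" and b1: "b1 \<in> B"
      show "pairing c (\<lambda>k. tl (w k)) k l (r *\<^sub>R b1) = r *\<^sub>R pairing c (\<lambda>k. tl (w k)) k l b1"
        using b1 h(3)[OF kl(1) kl(1)] h(3)[OF kl(2) kl(2)] by (simp add: word_ip_scaleR comp_simps)
    next
      fix \<beta> assume \<beta>: "\<And>k. k \<in> ?J z \<Longrightarrow> \<beta> k \<in> B"
      show "positive_op (\<Sum>k\<in>?J z. \<Sum>l\<in>?J z. pairing c (\<lambda>k. tl (w k)) k l (op_adj (\<beta> k) o\<^sub>L \<beta> l))"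
      proof (rule Suc.IH)
        show "length (tl (w k)) < n" if "k \<in> ?J z" for k
          using Suc.prems(3)[OF J(3)[OF that]] J(2)[OF that] by (cases "w k") auto
      qed (use Suc.prems(1) h(3) Jc \<beta> in auto)
    next
      fix k l assume kl: "k \<in> ?J z" "l \<in> ?J z"
      then have m: "lact j (\<iota> j (b k)) (letter (w k)) \<in> Lc j" "lact j (\<iota> j (b l)) (letter (w l)) \<in> Lc j"
        using h(2) Jc by (auto intro: lact_mem)
      show "N k l \<in> B" using m kl by (simp add: N Cip_mem)
      show "op_adj (N k l) = N l k" using m kl by (simp add: N Cip_adj)
    next
      fix \<beta> assume \<beta>: "\<And>k. k \<in> ?J z \<Longrightarrow> \<beta> k \<in> B"
      have "positive_op (\<Sum>k\<in>?J z. \<Sum>l\<in>?J z. op_adj (\<beta> k) o\<^sub>L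
          Cip j (lact j (\<iota> j (b k)) (letter (w k))) (lact j (\<iota> j (b l)) (letter (w l))) o\<^sub>L \<beta> l)"
        using h(2) Jc by (intro gram_positive lact_mem \<beta>) auto
      also have "(\<Sum>k\<in>?J z. \<Sum>l\<in>?J z. op_adj (\<beta> k) o\<^sub>L
          Cip j (lact j (\<iota> j (b k)) (letter (w k))) (lact j (\<iota> j (b l)) (letter (w l))) o\<^sub>L \<beta> l)
        = (\<Sum>k\<in>?J z. \<Sum>l\<in>?J z. op_adj (\<beta> k) o\<^sub>L N k l o\<^sub>L \<beta> l)"
        by (intro sum.cong refl) (simp only: N)
      finally show "positive_op (\<Sum>k\<in>?J z. \<Sum>l\<in>?J z. op_adj (\<beta> k) o\<^sub>L N k l o\<^sub>L \<beta> l)" .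
    qed
    also have "(\<Sum>k\<in>?J z. \<Sum>l\<in>?J z. pairing c (\<lambda>k. tl (w k)) k l (N k l)) = (\<Sum>k\<in>?J z. \<Sum>l\<in>?J z. ?t k l)"
      using J(2) by (intro sum.cong refl) (simp add: N_def word_ip_Some[of _ j])
    finally show ?thesis .
  qed
  ultimately show ?case by (simp add: positive_op_sum)
qed

text \<open>A second use of the elimination passes from squares to arbitrary positive matrices. The
  later estimates take for \<open>N\<close> a constant matrix, or a multiple of one Gram matrix of
  letters minus another.\<close>

lemma word_ip_positive:
  assumes I: "finite I" and w: "\<And>k. k \<in> I \<Longrightarrow> w k \<in> words" and c: "\<And>k. k \<in> I \<Longrightarrow> c k \<in> B"
    and N: "\<And>k l. k \<in> I \<Longrightarrow> l \<in> I \<Longrightarrow> N k l \<in> B"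
      "\<And>k l. k \<in> I \<Longrightarrow> l \<in> I \<Longrightarrow> op_adj (N k l) = N l k"
      "\<And>\<beta>. (\<And>k. k \<in> I \<Longrightarrow> \<beta> k \<in> B) \<Longrightarrow>
        positive_op (\<Sum>k\<in>I. \<Sum>l\<in>I. op_adj (\<beta> k) o\<^sub>L N k l o\<^sub>L \<beta> l)"
  shows "positive_op (\<Sum>k\<in>I. \<Sum>l\<in>I. pairing c w k l (N k l))"
proof (rule B.positive_op_pairing[OF I, where q = "pairing c w" and N = N])
  fix k l b1 b2 r assume kl: "k \<in> I" "l \<in> I" and b1: "b1 \<in> B"
  show "pairing c w k l (r *\<^sub>R b1) = r *\<^sub>R pairing c w k l b1"
    using b1 w kl by (simp add: word_ip_scaleR comp_simps)
  show "pairing c w k l (b1 + b2) = pairing c w k l b1 + pairing c w k l b2" if "b2 \<in> B"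
    using that b1 w kl by (simp add: word_ip_add comp_simps)
next
  fix \<beta> assume \<beta>: "\<And>k. k \<in> I \<Longrightarrow> \<beta> k \<in> B"
  have "length (w k) < Suc (Max ((length \<circ> w) ` I))" if "k \<in> I" for k
    using I that by (simp add: less_Suc_eq_le)
  then show "positive_op (\<Sum>k\<in>I. \<Sum>l\<in>I. pairing c w k l (op_adj (\<beta> k) o\<^sub>L \<beta> l))"
    by (intro word_ip_positive_squares I w c \<beta>)
qed (use N in auto)

lemma word_ip_positive_const:
  assumes "finite I" "\<And>k. k \<in> I \<Longrightarrow> w k \<in> words" "\<And>k. k \<in> I \<Longrightarrow> c k \<in> B"
    and "b \<in> B" "positive_op b"
  shows "positive_op (\<Sum>k\<in>I. \<Sum>l\<in>I. pairing c w k l b)"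
  by (rule word_ip_positive)
     (use assms in \<open>auto intro: B.positive_const_pairing positive_op_selfadj B.has_adjI\<close>)


subsection \<open>The inner product on finitely supported vectors\<close>

abbreviation "lookup \<equiv> Poly_Mapping.lookup"
abbreviation "keys \<equiv> Poly_Mapping.keys"
abbreviation "single \<equiv> Poly_Mapping.single"

lemma prefock_lookup: "f \<in> prefock \<Longrightarrow> lookup f w \<in> B"
  by (simp add: prefock_def)

lemma prefock_keys: "f \<in> prefock \<Longrightarrow> w \<in> keys f \<Longrightarrow> w \<in> words"
  by (auto simp: prefock_def)

lemma prefock_zero: "0 \<in> prefock"
  by (simp add: prefock_def)

lemma prefock_add: "f \<in> prefock \<Longrightarrow> g \<in> prefock \<Longrightarrow> f + g \<in> prefock"
  using Poly_Mapping.keys_add[of f g] by (auto simp: prefock_def lookup_add B.add_mem)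

lemma prefock_diff: "f \<in> prefock \<Longrightarrow> g \<in> prefock \<Longrightarrow> f - g \<in> prefock"
  using Poly_Mapping.keys_diff[of f g] by (auto simp: prefock_def lookup_minus B.diff_mem)

lemma prefock_single: "w \<in> words \<Longrightarrow> c \<in> B \<Longrightarrow> single w c \<in> prefock"
  by (auto simp: prefock_def lookup_single when_def)

lemma prefock_ip_superset:
  assumes "f \<in> prefock" "g \<in> prefock" "finite S" "finite T" "keys f \<subseteq> S" "keys g \<subseteq> T"
  shows "prefock_ip f g = (\<Sum>w\<in>S. \<Sum>v\<in>T. op_adj (lookup f w) o\<^sub>L word_ip \<u> w v o\<^sub>L lookup g v)"
proof -
  have "prefock_ip f g = (\<Sum>w\<in>keys f. \<Sum>v\<in>T. op_adj (lookup f w) o\<^sub>L word_ip \<u> w v o\<^sub>L lookup g v)"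
    unfolding prefock_ip_def using assms
    by (intro sum.cong refl sum.mono_neutral_left) (auto simp: in_keys_iff)
  also have "\<dots> = (\<Sum>w\<in>S. \<Sum>v\<in>T. op_adj (lookup f w) o\<^sub>L word_ip \<u> w v o\<^sub>L lookup g v)"
    using assms by (intro sum.mono_neutral_left) (auto simp: in_keys_iff)
  finally show ?thesis .
qed

lemma prefock_ip_mem: "f \<in> prefock \<Longrightarrow> g \<in> prefock \<Longrightarrow> prefock_ip f g \<in> B"
  unfolding prefock_ip_def
  by (intro B.mem prefock_lookup word_ip_mem prefock_keys) auto

sublocale P: pre_module B prefock prefock_ip
proof unfold_locales
  fix f g h assume fgh: "f \<in> prefock" "g \<in> prefock" "h \<in> prefock"
  have "keys (g + h) \<subseteq> keys g \<union> keys h" by (rule Poly_Mapping.keys_add)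
  then show "prefock_ip f (g + h) = prefock_ip f g + prefock_ip f h"
    using fgh
    by (simp add: prefock_ip_superset[of f _ "keys f" "keys g \<union> keys h"] prefock_add lookup_add
        comp_simps sum.distrib)
next
  fix f g assume fg: "f \<in> prefock" "g \<in> prefock"
  have m: "lookup f w \<in> B" "lookup g w \<in> B" for w using fg prefock_lookup by auto
  have "op_adj (prefock_ip f g) = (\<Sum>w\<in>keys f. \<Sum>v\<in>keys g.
      op_adj (op_adj (lookup f w) o\<^sub>L word_ip \<u> w v o\<^sub>L lookup g v))"
    unfolding prefock_ip_def using fg
    by (simp add: op_adj_sum has_adj_sum B.has_adjI B.mem m word_ip_mem prefock_keys cong: sum.cong)
  also have "\<dots> = (\<Sum>w\<in>keys f. \<Sum>v\<in>keys g. op_adj (lookup g v) o\<^sub>L word_ip \<u> v w o\<^sub>L lookup f w)"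
    using fg
    by (intro sum.cong refl)
       (simp add: op_adj_comp B.has_adjI B.mem m word_ip_mem prefock_keys word_ip_adj B.op_adj_unit comp_assoc)
  also have "\<dots> = prefock_ip g f"
    unfolding prefock_ip_def by (rule sum.swap)
  finally show "op_adj (prefock_ip f g) = prefock_ip g f" .
  fix b c assume bc: "b \<in> B" "c \<in> B"
  let ?S = "keys f \<union> keys g"
  \<comment> \<open>These are the coefficients of f b + g c; the right action is visible on
    coefficients alone.\<close>
  let ?d = "\<lambda>w. (lookup f w o\<^sub>L b) + (lookup g w o\<^sub>L c)"
  have w: "w \<in> words" if "w \<in> ?S" for w using that fg prefock_keys by auto
  have d: "?d w \<in> B" for w by (intro B.mem m bc)
  have dadj: "op_adj (?d w) = (op_adj b o\<^sub>L op_adj (lookup f w)) + (op_adj c o\<^sub>L op_adj (lookup g w))" for w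
    by (simp add: op_adj_add op_adj_comp B.has_adjI B.mem m bc)
  have "positive_op (\<Sum>k\<in>?S. \<Sum>l\<in>?S. pairing ?d (\<lambda>w. w) k l \<u>)"
    using w by (intro word_ip_positive_const d B.unit_mem B.positive_unit) auto
  also have "(\<Sum>k\<in>?S. \<Sum>l\<in>?S. pairing ?d (\<lambda>w. w) k l \<u>)
    = (op_adj b o\<^sub>L prefock_ip f f o\<^sub>L b) + (op_adj b o\<^sub>L prefock_ip f g o\<^sub>L c)
      + (op_adj c o\<^sub>L prefock_ip g f o\<^sub>L b) + (op_adj c o\<^sub>L prefock_ip g g o\<^sub>L c)"
    using fg
    by (simp add: prefock_ip_superset[of _ _ ?S ?S] dadj comp_simps comp_sum_left comp_sum_right comp_assoc
        sum.distrib)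
  finally show "positive_op ((op_adj b o\<^sub>L prefock_ip f f o\<^sub>L b) + (op_adj b o\<^sub>L prefock_ip f g o\<^sub>L c)
      + (op_adj c o\<^sub>L prefock_ip g f o\<^sub>L b) + (op_adj c o\<^sub>L prefock_ip g g o\<^sub>L c))" .
qed (auto intro: prefock_zero prefock_add prefock_diff prefock_ip_mem)

lemma prefock_ip_single:
  assumes "w \<in> words" "v \<in> words" "c \<in> B" "d \<in> B"
  shows "prefock_ip (single w c) (single v d) = op_adj c o\<^sub>L word_ip \<u> w v o\<^sub>L d"
  using prefock_ip_superset[of "single w c" "single v d" "{w}" "{v}"] assms
  by (simp add: prefock_single)

lemma prefock_sum_single: "f = (\<Sum>w\<in>keys f. single w (lookup f w))"
  by (rule poly_mapping_eqI) (simp add: lookup_sum lookup_single when_def in_keys_iff)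

lemma word_ip_unit:
  assumes "w \<in> words" "head w = Some i" "v \<in> words" "head v = Some i"
  shows "word_ip \<u> w v = word_ip (Cip i (letter w) (letter v)) (tl w) (tl v)"
  using assms words_head(2)[OF assms(3,4)] by (simp add: word_ip_Some iota_unit lact_unit)

section \<open>Left multiplication by elements of \<open>B\<close>\<close>

lemma lmul_mem: "b \<in> B \<Longrightarrow> v \<in> words \<Longrightarrow> d \<in> B \<Longrightarrow> lmul b v d \<in> prefock"
  by (cases "(b, v, d)" rule: lmul.cases)
     (auto intro!: prefock_single B.comp_mem lact_H simp: words_Cons)

text \<open>Identifies left multiplication with the parameter of \<open>word_ip\<close>. On the
  empty word \<open>b\<close> enters the coefficient, otherwise the first letter; after pairing both
  give the same expression.\<close>

lemma prefock_ip_single_lmul: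
  assumes "w \<in> words" "c \<in> B" "b \<in> B" "v \<in> words" "d \<in> B"
  shows "prefock_ip (single w c) (lmul b v d) = op_adj c o\<^sub>L word_ip b w v o\<^sub>L d"
proof (cases v)
  case Nil
  have "word_ip \<u> w [] o\<^sub>L b = word_ip b w []"
    using assms by (cases w) (auto simp: B.unit_left)
  then show ?thesis
    using assms by (simp add: Nil prefock_ip_single B.comp_mem comp_assoc) (simp flip: comp_assoc)
next
  case (Cons p v')
  obtain j h where p: "p = (j, h)" by fastforce
  have h: "h \<in> H j" "v' \<in> words" "(j, lact j (\<iota> j b) h) # v' \<in> words"
    using assms by (auto simp: Cons p words_Cons lact_H)
  have "lact j (\<iota> j \<u>) (lact j (\<iota> j b) h) = lact j (\<iota> j b) h"
    using assms h by (simp add: iota_unit lact_unit lact_mem iota_mem H_Lc)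
  then have "word_ip \<u> w ((j, lact j (\<iota> j b) h) # v') = word_ip b w v"
    by (cases w) (auto simp: Cons p)
  then show ?thesis using assms h by (simp add: Cons p prefock_ip_single)
qed

lemma prefock_ip_lmul:
  assumes g: "g \<in> prefock" and "b \<in> B" "v \<in> words" "d \<in> B"
  shows "prefock_ip g (lmul b v d) = (\<Sum>w\<in>keys g. op_adj (lookup g w) o\<^sub>L word_ip b w v o\<^sub>L d)"
proof -
  have w: "w \<in> words" "lookup g w \<in> B" if "w \<in> keys g" for w
    using that g prefock_keys prefock_lookup by auto
  have "prefock_ip g (lmul b v d) = (\<Sum>w\<in>keys g. prefock_ip (single w (lookup g w)) (lmul b v d))"
    by (subst prefock_sum_single[of g], rule P.ip_sum_left) (auto intro: lmul_mem assms prefock_single w)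
  then show ?thesis using assms w by (simp add: prefock_ip_single_lmul cong: sum.cong)
qed

text \<open>For a nonempty word, \<open>lmul 0 v d\<close> is a word whose first letter is a zero
  class: in general not the zero function, but of length zero. Such terms come from
  \<open>lmul (E i a)\<close> in \<open>pre_pi\<close> when \<open>E i a = 0\<close>.\<close>

lemma mnorm_lmul_zero:
  assumes "v \<in> words" "d \<in> B"
  shows "mnorm prefock_ip (lmul 0 v d) = 0"
proof -
  have "prefock_ip g (lmul 0 v d) = 0" if "g \<in> prefock" for g
    using that assms prefock_keys by (simp add: prefock_ip_lmul word_ip_zero cong: sum.cong)
  then show ?thesis using assms by (simp add: mnorm_def lmul_mem)
qed

end


section \<open>Creation, diagonal and annihilation parts\<close>

context pre_module
begin

lemma ip_self_positive: "x \<in> X \<Longrightarrow> positive_op (ip x x)"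
  using ip_positive[of x x \<e> 0] by (simp add: mem op_adj_unit unit_left unit_right ip_mem)

lemma mnorm_le_sqrt:
  assumes "x \<in> X" "y \<in> X" "\<gamma> \<ge> 0" "positive_op (\<gamma> *\<^sub>R ip y y - ip x x)"
  shows "mnorm ip x \<le> sqrt \<gamma> * mnorm ip y"
proof -
  have "norm (ip x x) \<le> norm (\<gamma> *\<^sub>R ip y y)"
    using assms by (intro positive_op_norm_mono ip_self_positive has_adjI ip_mem)
  also have "\<dots> = \<gamma> * norm (ip y y)" using assms by simp
  finally show ?thesis
    unfolding mnorm_def real_sqrt_mult[symmetric] by (rule real_sqrt_le_mono)
qed

lemma ip_blocks:
  assumes F: "finite F"
    and x: "\<And>i w. i \<in> F \<Longrightarrow> w \<in> S i \<Longrightarrow> x i w \<in> X"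
    and y: "\<And>i v. i \<in> F \<Longrightarrow> v \<in> T i \<Longrightarrow> y i v \<in> X"
    and zero: "\<And>i j w v. i \<in> F \<Longrightarrow> j \<in> F \<Longrightarrow> i \<noteq> j \<Longrightarrow> w \<in> S i \<Longrightarrow> v \<in> T j \<Longrightarrow> ip (x i w) (y j v) = 0"
  shows "ip (\<Sum>i\<in>F. \<Sum>w\<in>S i. x i w) (\<Sum>j\<in>F. \<Sum>v\<in>T j. y j v)
    = (\<Sum>i\<in>F. \<Sum>w\<in>S i. \<Sum>v\<in>T i. ip (x i w) (y i v))"
proof -
  have xs: "(\<Sum>w\<in>S i. x i w) \<in> X" if "i \<in> F" for i using x that by (intro sum_in)
  have ys: "(\<Sum>v\<in>T i. y i v) \<in> X" if "i \<in> F" for i using y that by (intro sum_in)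
  have ysum: "(\<Sum>j\<in>F. \<Sum>v\<in>T j. y j v) \<in> X" by (rule sum_in[OF ys])
  have "ip (x i w) (\<Sum>j\<in>F. \<Sum>v\<in>T j. y j v) = (\<Sum>v\<in>T i. ip (x i w) (y i v))"
    if i: "i \<in> F" and w: "w \<in> S i" for i w
  proof -
    have "ip (x i w) (\<Sum>j\<in>F. \<Sum>v\<in>T j. y j v) = (\<Sum>j\<in>F. ip (x i w) (\<Sum>v\<in>T j. y j v))"
      by (rule ip_sum_right[OF x[OF i w] ys])
    also have "\<dots> = (\<Sum>j\<in>F. \<Sum>v\<in>T j. ip (x i w) (y j v))"
      using y by (intro sum.cong refl ip_sum_right x[OF i w])
    also have "\<dots> = (\<Sum>j\<in>{i}. \<Sum>v\<in>T j. ip (x i w) (y j v))"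
    proof (rule sum.mono_neutral_right[OF F])
      show "\<forall>j\<in>F - {i}. (\<Sum>v\<in>T j. ip (x i w) (y j v)) = 0"
        using zero[OF i _ _ w] by (intro ballI sum.neutral) auto
    qed (use i in auto)
    finally show ?thesis by simp
  qed
  note row = this
  have "ip (\<Sum>i\<in>F. \<Sum>w\<in>S i. x i w) (\<Sum>j\<in>F. \<Sum>v\<in>T j. y j v)
      = (\<Sum>i\<in>F. ip (\<Sum>w\<in>S i. x i w) (\<Sum>j\<in>F. \<Sum>v\<in>T j. y j v))"
    by (rule ip_sum_left[OF ysum xs])
  also have "\<dots> = (\<Sum>i\<in>F. \<Sum>w\<in>S i. ip (x i w) (\<Sum>j\<in>F. \<Sum>v\<in>T j. y j v))"
    using x by (intro sum.cong refl ip_sum_left ysum)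
  also have "\<dots> = (\<Sum>i\<in>F. \<Sum>w\<in>S i. \<Sum>v\<in>T i. ip (x i w) (y i v))"
    by (intro sum.cong refl row)
  finally show ?thesis .
qed

end

context amalgam_expectation
begin

definition create :: "'i set \<Rightarrow> ('i \<Rightarrow> 'h op) \<Rightarrow> ('i, 'h, 'k) prefock \<Rightarrow> ('i, 'h, 'k) prefock" where
  "create F a f = (\<Sum>i\<in>F. \<Sum>w | w \<in> keys f \<and> head w \<noteq> Some i. single ((i, hat i (a i)) # w) (lookup f w))"

definition preserve :: "'i set \<Rightarrow> ('i \<Rightarrow> 'h op) \<Rightarrow> ('i, 'h, 'k) prefock \<Rightarrow> ('i, 'h, 'k) prefock" where
  "preserve F a f = (\<Sum>i\<in>F. \<Sum>w | w \<in> keys f \<and> head w = Some i.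
     single ((i, diag i (a i) (letter w)) # tl w) (lookup f w))"

definition annihilate :: "'i set \<Rightarrow> ('i \<Rightarrow> 'h op) \<Rightarrow> ('i, 'h, 'k) prefock \<Rightarrow> ('i, 'h, 'k) prefock" where
  "annihilate F a f = (\<Sum>i\<in>F. \<Sum>w | w \<in> keys f \<and> head w = Some i.
     lmul (Ebar i (lact i (a i) (letter w))) (tl w) (lookup f w))"

abbreviation fpair :: "('i, 'h, 'k) prefock \<Rightarrow> ('i, 'h) word \<Rightarrow> ('i, 'h) word \<Rightarrow> 'k op \<Rightarrow> 'k op" where
  "fpair f \<equiv> pairing (lookup f) (\<lambda>w. w)"

lemma fpair_positive:
  assumes "f \<in> prefock" "K \<subseteq> keys f" "b \<in> B" "positive_op b"
  shows "positive_op (\<Sum>w\<in>K. \<Sum>v\<in>K. fpair f w v b)"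
  using assms prefock_keys prefock_lookup finite_subset[OF assms(2) finite_keys]
  by (intro word_ip_positive_const) auto

context
  fixes F :: "'i set" and a :: "'i \<Rightarrow> 'h op" and f :: "('i, 'h, 'k) prefock"
  assumes F: "finite F" and aA: "\<And>i. i \<in> F \<Longrightarrow> a i \<in> A i"
    and Ea: "\<And>i. i \<in> F \<Longrightarrow> E i (a i) = 0" and f: "f \<in> prefock"
begin

lemma key: "w \<in> keys f \<Longrightarrow> w \<in> words" "lookup f w \<in> B"
  using f prefock_keys prefock_lookup by auto

lemma create_word:
  "i \<in> F \<Longrightarrow> w \<in> words \<Longrightarrow> head w \<noteq> Some i \<Longrightarrow> (i, hat i (a i)) # w \<in> words"
  by (simp add: words_Cons hat_H aA Ea)

lemma create_mem: "create F a f \<in> prefock"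
  unfolding create_def by (intro P.sum_in prefock_single create_word) (auto simp: key)

lemma preserve_word:
  "i \<in> F \<Longrightarrow> w \<in> words \<Longrightarrow> head w = Some i \<Longrightarrow> (i, diag i (a i) (letter w)) # tl w \<in> words"
  using words_head[of w i] by (simp add: words_Cons diag_H aA)

lemma preserve_mem: "preserve F a f \<in> prefock"
  unfolding preserve_def by (intro P.sum_in prefock_single preserve_word) (auto simp: key)

lemma annihilate_coeff:
  "i \<in> F \<Longrightarrow> w \<in> words \<Longrightarrow> head w = Some i \<Longrightarrow> Ebar i (lact i (a i) (letter w)) \<in> B"
  using words_head[of w i] by (intro Ebar_mem lact_mem aA)

lemma annihilate_term_mem:
  "i \<in> F \<Longrightarrow> w \<in> {w. w \<in> keys f \<and> head w = Some i} \<Longrightarrow>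
    lmul (Ebar i (lact i (a i) (letter w))) (tl w) (lookup f w) \<in> prefock"
  using words_head[of w i] key annihilate_coeff by (intro lmul_mem) auto

lemma annihilate_mem: "annihilate F a f \<in> prefock"
  unfolding annihilate_def by (intro P.sum_in annihilate_term_mem)

text \<open>If a letter of index \<open>i\<close> were put in front of every word, the inner product
  would be exactly the pairing of \<open>f\<close> with its left multiple by \<open>s\<close>.
  Omitting the words that start with \<open>i\<close> drops diagonal blocks that are positive, and
  so only lowers it.\<close>

lemma mnorm_create:
  "mnorm prefock_ip (create F a f)
    \<le> sqrt (norm (\<Sum>i\<in>F. E i (op_adj (a i) o\<^sub>L a i))) * mnorm prefock_ip f"
proof (rule P.mnorm_le_sqrt[OF create_mem f norm_ge_zero])
  define e where "e i = E i (op_adj (a i) o\<^sub>L a i)" for i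
  define s where "s = (\<Sum>i\<in>F. e i)"
  let ?K = "keys f"
  let ?P = "\<lambda>i. {w. w \<in> ?K \<and> head w \<noteq> Some i}" and ?Q = "\<lambda>i. {w. w \<in> ?K \<and> head w = Some i}"
  have e: "e i \<in> B" "positive_op (e i)" if "i \<in> F" for i
    unfolding e_def using aA[OF that]
    by (auto intro!: E_mem E_positive A.mem positive_op_square A.has_adjI)
  have s: "s \<in> B" "positive_op s" unfolding s_def using e by (auto intro: B.sum_mem positive_op_sum)
  have sadj: "op_adj s = s" using s by (intro positive_op_selfadj B.has_adjI)
  have "prefock_ip (create F a f) (create F a f)
      = (\<Sum>i\<in>F. \<Sum>w\<in>?P i. \<Sum>v\<in>?P i. prefock_ip (single ((i, hat i (a i)) # w) (lookup f w))
          (single ((i, hat i (a i)) # v) (lookup f v)))"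
    unfolding create_def
    by (rule P.ip_blocks[OF F])
       (auto intro!: prefock_single create_word simp: key prefock_ip_single create_word word_ip_head)
  also have "\<dots> = (\<Sum>i\<in>F. \<Sum>w\<in>?P i. \<Sum>v\<in>?P i. fpair f w v (e i))"
  proof (intro sum.cong refl)
    fix i w v assume i: "i \<in> F" and w: "w \<in> ?P i" and v: "v \<in> ?P i"
    \<comment> \<open>The common first letter contributes its inner product \<open>e i\<close> with
      itself, which then acts as left multiplication on the remaining words.\<close>
    have "word_ip \<u> ((i, hat i (a i)) # w) ((i, hat i (a i)) # v) = word_ip (e i) w v"
      using aA[OF i] by (simp add: iota_unit lact_unit hat_mem Cip_hat e_def ip_def)
    then show "prefock_ip (single ((i, hat i (a i)) # w) (lookup f w))
        (single ((i, hat i (a i)) # v) (lookup f v)) = fpair f w v (e i)"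
      using i w v by (simp add: prefock_ip_single create_word key del: word_ip.simps)
  qed
  finally have 1: "prefock_ip (create F a f) (create F a f)
    = (\<Sum>i\<in>F. \<Sum>w\<in>?P i. \<Sum>v\<in>?P i. fpair f w v (e i))" .
  \<comment> \<open>A word starting with \<open>i\<close> is orthogonal to one that does not, so the
    full double sum has just two blocks.\<close>
  have 2: "(\<Sum>w\<in>?K. \<Sum>v\<in>?K. fpair f w v (e i)) = (\<Sum>w\<in>?P i. \<Sum>v\<in>?P i. fpair f w v (e i))
      + (\<Sum>w\<in>?Q i. \<Sum>v\<in>?Q i. fpair f w v (e i))" for i
  proof -
    have "fpair f w v (e i) = 0" if "(head w = Some i) \<noteq> (head v = Some i)" for w v
    proof -
      have "head w \<noteq> head v" using that by auto
      then show ?thesis by (simp add: word_ip_head)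
    qed
    then have "(\<Sum>w\<in>?K. \<Sum>v\<in>?K. fpair f w v (e i))
      = (\<Sum>z\<in>UNIV. \<Sum>w | w \<in> ?K \<and> (head w = Some i) = z. \<Sum>v | v \<in> ?K \<and> (head v = Some i) = z. fpair f w v (e i))"
      by (intro sum_classes) auto
    then show ?thesis by (simp add: UNIV_bool)
  qed
  have 3: "(\<Sum>i\<in>F. \<Sum>w\<in>?K. \<Sum>v\<in>?K. fpair f w v (e i)) = (\<Sum>w\<in>?K. \<Sum>v\<in>?K. fpair f w v s)"
  proof -
    have "(\<Sum>w\<in>?K. \<Sum>v\<in>?K. fpair f w v s) = (\<Sum>w\<in>?K. \<Sum>v\<in>?K. \<Sum>i\<in>F. fpair f w v (e i))"
      unfolding s_def using e(1)
      by (intro sum.cong refl) (simp add: word_ip_sum key comp_sum_left comp_sum_right)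
    also have "\<dots> = (\<Sum>w\<in>?K. \<Sum>i\<in>F. \<Sum>v\<in>?K. fpair f w v (e i))"
      by (intro sum.cong refl sum.swap)
    also have "\<dots> = (\<Sum>i\<in>F. \<Sum>w\<in>?K. \<Sum>v\<in>?K. fpair f w v (e i))" by (rule sum.swap)
    finally show ?thesis by simp
  qed
  have 4: "(\<Sum>w\<in>?K. \<Sum>v\<in>?K. fpair f w v (norm s *\<^sub>R \<u> - s))
      = norm s *\<^sub>R prefock_ip f f - (\<Sum>w\<in>?K. \<Sum>v\<in>?K. fpair f w v s)"
    unfolding prefock_ip_def scaleR_sum_right sum_subtractf[symmetric]
    by (intro sum.cong refl)
       (simp add: word_ip_diff word_ip_scaleR key s B.mem comp_simps)
  have "norm s *\<^sub>R prefock_ip f f - prefock_ip (create F a f) (create F a f)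
      = (\<Sum>w\<in>?K. \<Sum>v\<in>?K. fpair f w v (norm s *\<^sub>R \<u> - s))
        + (\<Sum>i\<in>F. \<Sum>w\<in>?Q i. \<Sum>v\<in>?Q i. fpair f w v (e i))"
    unfolding 1 4 3[symmetric] 2 sum.distrib by simp
  moreover have "positive_op (\<Sum>w\<in>?K. \<Sum>v\<in>?K. fpair f w v (norm s *\<^sub>R \<u> - s))"
  proof (rule fpair_positive[OF f order_refl])
    show "norm s *\<^sub>R \<u> - s \<in> B" by (intro B.mem s)
    have "op_adj (- s) = - s"
      using op_adj_scaleR[OF B.has_adjI[OF s(1)], of "- 1"] by (simp add: sadj)
    then show "positive_op (norm s *\<^sub>R \<u> - s)"
      using B.positive_shift[OF B.minus_mem[OF s(1)]] by simp
  qed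
  moreover have "positive_op (\<Sum>i\<in>F. \<Sum>w\<in>?Q i. \<Sum>v\<in>?Q i. fpair f w v (e i))"
    by (intro positive_op_sum fpair_positive f e) auto
  ultimately show "positive_op (norm (\<Sum>i\<in>F. E i (op_adj (a i) o\<^sub>L a i)) *\<^sub>R prefock_ip f f
      - prefock_ip (create F a f) (create F a f))"
    unfolding e_def[symmetric] s_def[symmetric] by (simp add: positive_op_add)
qed

lemma mnorm_preserve:
  assumes S: "S \<ge> 0" "\<And>i. i \<in> F \<Longrightarrow> norm (a i) \<le> S"
  shows "mnorm prefock_ip (preserve F a f) \<le> S * mnorm prefock_ip f"
proof -
  let ?K = "keys f"
  let ?Q = "\<lambda>z. {w. w \<in> ?K \<and> head w = z}"
  define c where "c i w v = Cip i (letter w) (letter v)" for i and w v :: "('i, 'h) word"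
  define d where "d i w v = Cip i (diag i (a i) (letter w)) (diag i (a i) (letter v))"
    for i and w v :: "('i, 'h) word"
  let ?p = "\<lambda>w v. pairing (lookup f) tl w v"
  have Q: "w \<in> words" "letter w \<in> Lc i" "tl w \<in> words" "lookup f w \<in> B" if "w \<in> ?Q (Some i)" for i w
    using that key words_head[of w i] by auto
  have cB: "c i w v \<in> B" if "w \<in> ?Q (Some i)" "v \<in> ?Q (Some i)" for i w v
    unfolding c_def using Q(2) that by (intro Cip_mem)
  have dL: "diag i (a i) (letter w) \<in> Lc i" if "i \<in> F" "w \<in> ?Q (Some i)" for i w
    by (rule H_Lc, rule diag_H[OF aA[OF that(1)] Q(2)[OF that(2)]])
  have dB: "d i w v \<in> B" if "i \<in> F" "w \<in> ?Q (Some i)" "v \<in> ?Q (Some i)" for i w v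
    unfolding d_def using dL that by (intro Cip_mem)
  have "prefock_ip (preserve F a f) (preserve F a f)
      = (\<Sum>i\<in>F. \<Sum>w\<in>?Q (Some i). \<Sum>v\<in>?Q (Some i).
          prefock_ip (single ((i, diag i (a i) (letter w)) # tl w) (lookup f w))
          (single ((i, diag i (a i) (letter v)) # tl v) (lookup f v)))"
    unfolding preserve_def
    by (rule P.ip_blocks[OF F])
       (auto intro!: prefock_single preserve_word simp: key prefock_ip_single preserve_word word_ip_head)
  also have "\<dots> = (\<Sum>i\<in>F. \<Sum>w\<in>?Q (Some i). \<Sum>v\<in>?Q (Some i). ?p w v (d i w v))"
  proof (intro sum.cong refl)
    fix i w v assume i: "i \<in> F" and w: "w \<in> ?Q (Some i)" and v: "v \<in> ?Q (Some i)"
    have "word_ip \<u> ((i, diag i (a i) (letter w)) # tl w) ((i, diag i (a i) (letter v)) # tl v)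
        = word_ip (d i w v) (tl w) (tl v)"
      using dL[OF i v] by (simp add: iota_unit lact_unit d_def)
    then show "prefock_ip (single ((i, diag i (a i) (letter w)) # tl w) (lookup f w))
        (single ((i, diag i (a i) (letter v)) # tl v) (lookup f v)) = ?p w v (d i w v)"
      using i w v by (simp add: prefock_ip_single preserve_word key del: word_ip.simps)
  qed
  finally have 1: "prefock_ip (preserve F a f) (preserve F a f)
    = (\<Sum>i\<in>F. \<Sum>w\<in>?Q (Some i). \<Sum>v\<in>?Q (Some i). ?p w v (d i w v))" .
  \<comment> \<open>Besides the classes met by \<open>f\<close>, every index of \<open>F\<close> is
    included, so that the blocks over \<open>F\<close> can be split off; those not met by
    \<open>f\<close> are empty sums.\<close>
  define Z where "Z = head ` ?K \<union> Some ` F"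
  have Z: "finite Z" using F by (simp add: Z_def)
  let ?G = "\<lambda>z. \<Sum>w\<in>?Q z. \<Sum>v\<in>?Q z. fpair f w v \<u>"
  have "prefock_ip f f = (\<Sum>z\<in>Z. ?G z)"
    unfolding prefock_ip_def using Z by (intro sum_classes) (auto simp: Z_def word_ip_head)
  also have "\<dots> = (\<Sum>z\<in>Z - Some ` F. ?G z) + (\<Sum>z\<in>Some ` F. ?G z)"
    using Z by (intro sum.subset_diff) (auto simp: Z_def)
  also have "(\<Sum>z\<in>Some ` F. ?G z) = (\<Sum>i\<in>F. ?G (Some i))"
    by (simp add: sum.reindex)
  finally have 2: "prefock_ip f f = (\<Sum>z\<in>Z - Some ` F. ?G z) + (\<Sum>i\<in>F. ?G (Some i))" .
  have G: "positive_op (?G z)" for z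
    by (intro fpair_positive f B.unit_mem B.positive_unit) auto
  have 3: "positive_op (((norm (a i))\<^sup>2) *\<^sub>R ?G (Some i)
      - (\<Sum>w\<in>?Q (Some i). \<Sum>v\<in>?Q (Some i). ?p w v (d i w v)))" if i: "i \<in> F" for i
  proof -
    let ?N = "\<lambda>w v. ((norm (a i))\<^sup>2) *\<^sub>R c i w v - d i w v"
    have "positive_op (\<Sum>w\<in>?Q (Some i). \<Sum>v\<in>?Q (Some i). ?p w v (?N w v))"
    proof (rule word_ip_positive)
      fix w v assume w: "w \<in> ?Q (Some i)" and v: "v \<in> ?Q (Some i)"
      show "?N w v \<in> B" by (intro B.mem cB dB i w v)
      show "op_adj (?N w v) = ?N v w"
        using cB[OF w v] dB[OF i w v] Q(2)[OF w] Q(2)[OF v] dL[OF i w] dL[OF i v]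
        by (simp add: op_adj_diff op_adj_scaleR B.has_adjI B.mem) (simp add: c_def d_def Cip_adj)
    next
      fix \<beta> assume "\<And>w. w \<in> ?Q (Some i) \<Longrightarrow> \<beta> w \<in> B"
      then show "positive_op (\<Sum>w\<in>?Q (Some i). \<Sum>v\<in>?Q (Some i). op_adj (\<beta> w) o\<^sub>L ?N w v o\<^sub>L \<beta> v)"
        unfolding c_def d_def by (intro diag_gram_positive aA i Q(2))
    qed (use Q in auto)
    also have "(\<Sum>w\<in>?Q (Some i). \<Sum>v\<in>?Q (Some i). ?p w v (?N w v))
      = ((norm (a i))\<^sup>2) *\<^sub>R ?G (Some i) - (\<Sum>w\<in>?Q (Some i). \<Sum>v\<in>?Q (Some i). ?p w v (d i w v))"
      unfolding scaleR_sum_right sum_subtractf[symmetric]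
    proof (intro sum.cong refl)
      fix w v assume w: "w \<in> ?Q (Some i)" and v: "v \<in> ?Q (Some i)"
      have "word_ip \<u> w v = word_ip (c i w v) (tl w) (tl v)"
        unfolding c_def using w v Q(1)[OF w] Q(1)[OF v] by (intro word_ip_unit) auto
      then show "?p w v (?N w v) = ((norm (a i))\<^sup>2) *\<^sub>R fpair f w v \<u> - ?p w v (d i w v)"
        using cB[OF w v] dB[OF i w v] Q(3)[OF w] Q(3)[OF v]
        by (simp add: word_ip_diff word_ip_scaleR B.mem comp_simps)
    qed
    finally show ?thesis .
  qed
  \<comment> \<open>Three positive contributions: the blocks whose label lies outside
    \<open>F\<close>, the slack between the squares of \<open>S\<close> and
    \<open>norm (a i)\<close>, and the gap inside each block over \<open>F\<close>.\<close>
  have "(S\<^sup>2) *\<^sub>R prefock_ip f f - prefock_ip (preserve F a f) (preserve F a f)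
      = (S\<^sup>2) *\<^sub>R (\<Sum>z\<in>Z - Some ` F. ?G z) + (\<Sum>i\<in>F. (S\<^sup>2 - (norm (a i))\<^sup>2) *\<^sub>R ?G (Some i))
        + (\<Sum>i\<in>F. ((norm (a i))\<^sup>2) *\<^sub>R ?G (Some i)
            - (\<Sum>w\<in>?Q (Some i). \<Sum>v\<in>?Q (Some i). ?p w v (d i w v)))"
    unfolding 1 2 by (simp add: sum_subtractf scaleR_diff_left scaleR_add_right scaleR_sum_right[of "S\<^sup>2" _ F])
  also have "positive_op \<dots>"
  proof (intro positive_op_add)
    show "positive_op ((S\<^sup>2) *\<^sub>R (\<Sum>z\<in>Z - Some ` F. ?G z))"
      by (rule positive_op_scaleR, rule positive_op_sum, rule G) simp
    show "positive_op (\<Sum>i\<in>F. (S\<^sup>2 - (norm (a i))\<^sup>2) *\<^sub>R ?G (Some i))"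
    proof (rule positive_op_sum, rule positive_op_scaleR, rule G)
      fix i assume "i \<in> F"
      then have "(norm (a i))\<^sup>2 \<le> S\<^sup>2" using S by (intro power_mono) auto
      then show "0 \<le> S\<^sup>2 - (norm (a i))\<^sup>2" by simp
    qed
    show "positive_op (\<Sum>i\<in>F. ((norm (a i))\<^sup>2) *\<^sub>R ?G (Some i)
            - (\<Sum>w\<in>?Q (Some i). \<Sum>v\<in>?Q (Some i). ?p w v (d i w v)))"
      by (rule positive_op_sum, rule 3)
  qed
  finally have "mnorm prefock_ip (preserve F a f) \<le> sqrt (S\<^sup>2) * mnorm prefock_ip f"
    by (intro P.mnorm_le_sqrt preserve_mem f) auto
  then show ?thesis using S by simp
qed

end

text \<open>Both sides expand into the same terms over words \<open>w\<close> of \<open>g\<close>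
  and \<open>v\<close> of \<open>f\<close>. Annihilating the first letter of \<open>v\<close> leaves
  a left coefficient on \<open>tl v\<close>, which by \<open>Cip_hat_left\<close> is the pairing of
  that letter with the created one.\<close>

lemma annihilate_adjoint:
  assumes F: "finite F" and aA: "\<And>i. i \<in> F \<Longrightarrow> a i \<in> A i" and Ea: "\<And>i. i \<in> F \<Longrightarrow> E i (a i) = 0"
    and f: "f \<in> prefock" and g: "g \<in> prefock"
  shows "prefock_ip g (annihilate F a f) = prefock_ip (create F (\<lambda>i. op_adj (a i)) g) f"
proof -
  let ?a = "\<lambda>i. op_adj (a i)"
  have aA': "?a i \<in> A i" "E i (?a i) = 0" if "i \<in> F" for i
    using that by (auto intro: A.mem aA simp: E_adj aA Ea)
  let ?P = "\<lambda>i. {w. w \<in> keys g \<and> head w \<noteq> Some i}" and ?Q = "\<lambda>i. {w. w \<in> keys f \<and> head w = Some i}"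
  let ?b = "\<lambda>i v. Ebar i (lact i (a i) (letter v))"
  have gk: "w \<in> words" "lookup g w \<in> B" if "w \<in> keys g" for w using g that prefock_keys prefock_lookup by auto
  have fk: "w \<in> words" "lookup f w \<in> B" if "w \<in> keys f" for w using f that prefock_keys prefock_lookup by auto
  have Q: "v \<in> words" "letter v \<in> Lc i" "tl v \<in> words" "head (tl v) \<noteq> Some i" "lookup f v \<in> B" "head v = Some i"
    if "v \<in> ?Q i" for i v using that fk words_head[of v i] by auto
  have lm: "lmul (?b i v) (tl v) (lookup f v) \<in> prefock" if "i \<in> F" "v \<in> ?Q i" for i v
    by (rule annihilate_term_mem[OF F aA Ea f that])
  have bB: "?b i v \<in> B" if "i \<in> F" "v \<in> ?Q i" for i v
    using that Q by (intro Ebar_mem lact_mem aA)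
  have "prefock_ip g (annihilate F a f)
      = (\<Sum>i\<in>F. prefock_ip g (\<Sum>v\<in>?Q i. lmul (?b i v) (tl v) (lookup f v)))"
    unfolding annihilate_def by (rule P.ip_sum_right[OF g P.sum_in[OF lm]])
  also have "\<dots> = (\<Sum>i\<in>F. \<Sum>v\<in>?Q i. prefock_ip g (lmul (?b i v) (tl v) (lookup f v)))"
    by (intro sum.cong refl P.ip_sum_right g lm)
  also have "\<dots> = (\<Sum>i\<in>F. \<Sum>v\<in>?Q i. \<Sum>w\<in>?P i.
      prefock_ip (single ((i, hat i (?a i)) # w) (lookup g w)) (single v (lookup f v)))"
  proof (intro sum.cong refl)
    fix i v assume i: "i \<in> F" and v: "v \<in> ?Q i"
    have "prefock_ip g (lmul (?b i v) (tl v) (lookup f v))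
        = (\<Sum>w\<in>keys g. op_adj (lookup g w) o\<^sub>L word_ip (?b i v) w (tl v) o\<^sub>L lookup f v)"
      using Q[OF v] bB[OF i v] by (intro prefock_ip_lmul g)
    \<comment> \<open>As indices alternate in \<open>v\<close>, \<open>tl v\<close> cannot start
      with \<open>i\<close>, so words of \<open>g\<close> starting with \<open>i\<close> drop out.
      This matches the restriction in \<open>create\<close>.\<close>
    also have "\<dots> = (\<Sum>w\<in>?P i. op_adj (lookup g w) o\<^sub>L word_ip (?b i v) w (tl v) o\<^sub>L lookup f v)"
      using Q(4)[OF v] by (intro sum.mono_neutral_right) (auto simp: word_ip_head)
    also have "\<dots> = (\<Sum>w\<in>?P i. prefock_ip (single ((i, hat i (?a i)) # w) (lookup g w)) (single v (lookup f v)))"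
    proof (intro sum.cong refl)
      fix w assume w: "w \<in> ?P i"
      have ww: "(i, hat i (?a i)) # w \<in> words"
        using create_word[of F ?a g i w] F aA' g i w gk by auto
      have "word_ip \<u> ((i, hat i (?a i)) # w) v = word_ip (Cip i (hat i (?a i)) (letter v)) w (tl v)"
        using word_ip_unit[OF ww _ Q(1)[OF v] Q(6)[OF v]] by simp
      also have "Cip i (hat i (?a i)) (letter v) = ?b i v"
        by (intro Cip_hat_left aA i Q(2) v)
      finally show "op_adj (lookup g w) o\<^sub>L word_ip (?b i v) w (tl v) o\<^sub>L lookup f v
          = prefock_ip (single ((i, hat i (?a i)) # w) (lookup g w)) (single v (lookup f v))"
        using ww w gk Q[OF v] by (simp add: prefock_ip_single)
    qed
    finally show "prefock_ip g (lmul (?b i v) (tl v) (lookup f v))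
      = (\<Sum>w\<in>?P i. prefock_ip (single ((i, hat i (?a i)) # w) (lookup g w)) (single v (lookup f v)))" .
  qed
  also have "\<dots> = (\<Sum>i\<in>F. \<Sum>w\<in>?P i. \<Sum>v\<in>?Q i.
      prefock_ip (single ((i, hat i (?a i)) # w) (lookup g w)) (single v (lookup f v)))"
    by (intro sum.cong refl sum.swap)
  also have "\<dots> = (\<Sum>i\<in>F. \<Sum>w\<in>?P i. prefock_ip (single ((i, hat i (?a i)) # w) (lookup g w)) f)"
  proof (intro sum.cong refl)
    fix i w assume i: "i \<in> F" and w: "w \<in> ?P i"
    let ?s = "single ((i, hat i (?a i)) # w) (lookup g w)"
    have ww: "(i, hat i (?a i)) # w \<in> words"
      using create_word[of F ?a g i w] F aA' g i w gk by auto
    have s: "?s \<in> prefock" using ww w gk by (intro prefock_single) auto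
    have "prefock_ip ?s f = (\<Sum>v\<in>keys f. prefock_ip ?s (single v (lookup f v)))"
      by (subst prefock_sum_single[of f], rule P.ip_sum_right[OF s]) (auto intro: prefock_single fk)
    also have "\<dots> = (\<Sum>v\<in>?Q i. prefock_ip ?s (single v (lookup f v)))"
    proof (rule sum.mono_neutral_right)
      show "\<forall>v\<in>keys f - ?Q i. prefock_ip ?s (single v (lookup f v)) = 0"
      proof
        fix v assume v: "v \<in> keys f - ?Q i"
        then have "head ((i, hat i (?a i)) # w) \<noteq> head v" by auto
        then show "prefock_ip ?s (single v (lookup f v)) = 0"
          using ww w v gk fk by (simp add: prefock_ip_single word_ip_head)
      qed
    qed auto
    finally show "(\<Sum>v\<in>?Q i. prefock_ip ?s (single v (lookup f v))) = prefock_ip ?s f" by simp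
  qed
  also have "\<dots> = prefock_ip (create F ?a g) f"
  proof -
    have m: "single ((i, hat i (?a i)) # w) (lookup g w) \<in> prefock" if "i \<in> F" "w \<in> ?P i" for i w
      using create_word[of F ?a g i w] F aA' g that gk by (intro prefock_single) auto
    have "prefock_ip (create F ?a g) f
        = (\<Sum>i\<in>F. prefock_ip (\<Sum>w\<in>?P i. single ((i, hat i (?a i)) # w) (lookup g w)) f)"
      unfolding create_def by (rule P.ip_sum_left[OF f P.sum_in[OF m]])
    also have "\<dots> = (\<Sum>i\<in>F. \<Sum>w\<in>?P i. prefock_ip (single ((i, hat i (?a i)) # w) (lookup g w)) f)"
      by (intro sum.cong refl P.ip_sum_left f m)
    finally show ?thesis by simp
  qed
  finally show ?thesis .
qed

text \<open>Take for \<open>g\<close> in \<open>annihilate_adjoint\<close> the annihilated vector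
  itself. Its squared norm becomes a pairing of \<open>f\<close> with a created vector,
  \<open>mnorm_create\<close> for the adjoints bounds that by the norms of \<open>g\<close> and
  \<open>f\<close>, and one factor cancels.\<close>

lemma mnorm_annihilate:
  assumes F: "finite F" and aA: "\<And>i. i \<in> F \<Longrightarrow> a i \<in> A i" and Ea: "\<And>i. i \<in> F \<Longrightarrow> E i (a i) = 0"
    and f: "f \<in> prefock"
  shows "mnorm prefock_ip (annihilate F a f)
    \<le> sqrt (norm (\<Sum>i\<in>F. E i (a i o\<^sub>L op_adj (a i)))) * mnorm prefock_ip f"
proof -
  let ?a = "\<lambda>i. op_adj (a i)" and ?g = "annihilate F a f"
  let ?m = "mnorm prefock_ip" and ?\<gamma> = "sqrt (norm (\<Sum>i\<in>F. E i (a i o\<^sub>L op_adj (a i))))"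
  have aA': "?a i \<in> A i" "E i (?a i) = 0" if "i \<in> F" for i
    using that by (auto intro: A.mem aA simp: E_adj aA Ea)
  have g: "?g \<in> prefock" using F aA Ea f by (rule annihilate_mem)
  have adj2: "op_adj (?a i) = a i" if "i \<in> F" for i using A.has_adjI[OF aA[OF that]] by simp
  have "?m (create F ?a ?g) \<le> sqrt (norm (\<Sum>i\<in>F. E i (op_adj (?a i) o\<^sub>L ?a i))) * ?m ?g"
    using F aA' g by (rule mnorm_create)
  then have C: "?m (create F ?a ?g) \<le> ?\<gamma> * ?m ?g" by (simp add: adj2 cong: sum.cong)
  have cm: "create F ?a ?g \<in> prefock" using F aA' g by (rule create_mem)
  have "(?m ?g)\<^sup>2 = norm (prefock_ip (create F ?a ?g) f)"
    using F aA Ea f g by (simp add: annihilate_adjoint flip: P.norm_ip_self)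
  also have "\<dots> \<le> ?m (create F ?a ?g) * ?m f" by (rule P.norm_ip_le[OF cm f])
  also have "\<dots> \<le> ?\<gamma> * ?m ?g * ?m f" by (rule mult_right_mono[OF C]) simp
  finally have "(?m ?g)\<^sup>2 \<le> ?\<gamma> * ?m ?g * ?m f" .
  then have "?m ?g * ?m ?g \<le> ?m ?g * (?\<gamma> * ?m f)" by (simp add: power2_eq_square mult_ac)
  then show ?thesis
    by (cases "?m ?g = 0") (auto simp: mult_le_cancel_left less_le)
qed


section \<open>The sum of the canonical images\<close>

lemma lmul_diff: "lmul b w (c - d) = lmul b w c - lmul b w d"
  by (cases "(b, w, c)" rule: lmul.cases) (simp_all add: comp_simps single_diff)

lemma creann_diff: "creann i a w (c - d) = creann i a w c - creann i a w d"
  by (cases "(i, a, w, c)" rule: creann.cases) (simp_all add: single_diff lmul_diff)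

text \<open>An exact identity of finitely supported functions, not one modulo null vectors: each
  word contributes additively in its coefficient, and a zero coefficient contributes nothing, so all
  sums may run over the union of the supports.\<close>

lemma pre_pi_diff: "pre_pi i a (f - g) = pre_pi i a f - pre_pi i a g"
proof -
  define \<phi> where "\<phi> w c = lmul (E i a) w c + creann i (a - \<iota> i (E i a)) w c" for w c
  have \<phi>: "\<phi> w (c - d) = \<phi> w c - \<phi> w d" for w c d by (simp add: \<phi>_def lmul_diff creann_diff)
  have \<phi>0: "\<phi> w 0 = 0" for w using \<phi>[of w 0 0] by simp
  have *: "pre_pi i a h = (\<Sum>w\<in>keys f \<union> keys g. \<phi> w (lookup h w))" if "keys h \<subseteq> keys f \<union> keys g" for h
    unfolding pre_pi_def \<phi>_def[symmetric] using that
    by (intro sum.mono_neutral_left) (auto simp: in_keys_iff \<phi>0)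
  show ?thesis
    using Poly_Mapping.keys_diff[of f g] by (simp add: * \<phi> lookup_minus sum_subtractf)
qed

lemma mnorm_sum_pre_pi:
  assumes F: "finite F" and aA: "\<And>i. i \<in> F \<Longrightarrow> a i \<in> A i" and Ea: "\<And>i. i \<in> F \<Longrightarrow> E i (a i) = 0"
    and S: "S \<ge> 0" "\<And>i. i \<in> F \<Longrightarrow> norm (a i) \<le> S" and f: "f \<in> prefock"
  shows "(\<Sum>i\<in>F. pre_pi i (a i) f) \<in> prefock"
    and "mnorm prefock_ip (\<Sum>i\<in>F. pre_pi i (a i) f)
      \<le> (S + sqrt (norm (\<Sum>i\<in>F. E i (op_adj (a i) o\<^sub>L a i)))
          + sqrt (norm (\<Sum>i\<in>F. E i (a i o\<^sub>L op_adj (a i))))) * mnorm prefock_ip f"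
proof -
  let ?m = "mnorm prefock_ip"
  let ?P = "\<lambda>i. {w. w \<in> keys f \<and> head w \<noteq> Some i}" and ?Q = "\<lambda>i. {w. w \<in> keys f \<and> head w = Some i}"
  \<comment> \<open>The terms \<open>lmul (E i (a i))\<close> remain as formal vectors of length
    zero, hence a fourth summand beside the three parts.\<close>
  define Z where "Z = (\<Sum>i\<in>F. \<Sum>w\<in>keys f. lmul 0 w (lookup f w))"
  have fk: "w \<in> words" "lookup f w \<in> B" if "w \<in> keys f" for w using f that prefock_keys prefock_lookup by auto
  have eq: "(\<Sum>i\<in>F. pre_pi i (a i) f) = Z + create F a f + preserve F a f + annihilate F a f"
  proof -
    have "pre_pi i (a i) f = (\<Sum>w\<in>keys f. lmul 0 w (lookup f w))
        + (\<Sum>w\<in>?P i. single ((i, hat i (a i)) # w) (lookup f w))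
        + (\<Sum>w\<in>?Q i. single ((i, diag i (a i) (letter w)) # tl w) (lookup f w))
        + (\<Sum>w\<in>?Q i. lmul (Ebar i (lact i (a i) (letter w))) (tl w) (lookup f w))" if i: "i \<in> F" for i
    proof -
      have "keys f = ?P i \<union> ?Q i" "?P i \<inter> ?Q i = {}" by auto
      then have "(\<Sum>w\<in>keys f. creann i (a i) w (lookup f w))
          = (\<Sum>w\<in>?P i. creann i (a i) w (lookup f w)) + (\<Sum>w\<in>?Q i. creann i (a i) w (lookup f w))"
        by (metis (no_types, lifting) finite_keys finite_Un sum.union_disjoint)
      also have "(\<Sum>w\<in>?P i. creann i (a i) w (lookup f w))
          = (\<Sum>w\<in>?P i. single ((i, hat i (a i)) # w) (lookup f w))"
      proof (intro sum.cong refl)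
        fix w assume "w \<in> ?P i"
        then show "creann i (a i) w (lookup f w) = single ((i, hat i (a i)) # w) (lookup f w)"
          by (cases w) (auto split: prod.splits)
      qed
      also have "(\<Sum>w\<in>?Q i. creann i (a i) w (lookup f w))
          = (\<Sum>w\<in>?Q i. single ((i, diag i (a i) (letter w)) # tl w) (lookup f w)
              + lmul (Ebar i (lact i (a i) (letter w))) (tl w) (lookup f w))"
      proof (intro sum.cong refl)
        fix w assume "w \<in> ?Q i"
        then obtain h v where "w = (i, h) # v" by (auto dest: head_SomeD)
        then show "creann i (a i) w (lookup f w) = single ((i, diag i (a i) (letter w)) # tl w) (lookup f w)
              + lmul (Ebar i (lact i (a i) (letter w))) (tl w) (lookup f w)"
          by (simp add: diag_def)
      qed
      finally show ?thesis
        using i by (simp add: pre_pi_def Ea iota_zero sum.distrib add.assoc)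
    qed
    then show ?thesis
      by (simp add: Z_def create_def preserve_def annihilate_def sum.distrib)
  qed
  have m: "create F a f \<in> prefock" "preserve F a f \<in> prefock" "annihilate F a f \<in> prefock"
    by (rule create_mem preserve_mem annihilate_mem; use F aA Ea f in auto)+
  have l: "lmul 0 w (lookup f w) \<in> prefock" "?m (lmul 0 w (lookup f w)) = 0" if "w \<in> keys f" for w
    using fk[OF that] by (auto intro: lmul_mem mnorm_lmul_zero)
  have lZ: "(\<Sum>w\<in>keys f. lmul 0 w (lookup f w)) \<in> prefock" using l by (intro P.sum_in)
  have "?m (\<Sum>w\<in>keys f. lmul 0 w (lookup f w)) \<le> 0"
    using P.mnorm_sum_le[of "keys f" "\<lambda>w. lmul 0 w (lookup f w)"] l by simp
  then have Zm: "?m Z \<le> 0" "Z \<in> prefock"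
    unfolding Z_def using P.mnorm_sum_le[of F "\<lambda>_. \<Sum>w\<in>keys f. lmul 0 w (lookup f w)"] lZ
    by (auto intro: order_trans simp: antisym[OF _ P.mnorm_nonneg])
  show "(\<Sum>i\<in>F. pre_pi i (a i) f) \<in> prefock"
    unfolding eq by (intro P.add_in m Zm)
  have "?m (Z + create F a f + preserve F a f + annihilate F a f)
      \<le> ?m Z + ?m (create F a f) + ?m (preserve F a f) + ?m (annihilate F a f)"
    using P.mnorm_add_le[of "Z + create F a f + preserve F a f" "annihilate F a f"]
      P.mnorm_add_le[of "Z + create F a f" "preserve F a f"] P.mnorm_add_le[of Z "create F a f"] m Zm
    by (auto simp: P.add_in)
  then show "?m (\<Sum>i\<in>F. pre_pi i (a i) f)
      \<le> (S + sqrt (norm (\<Sum>i\<in>F. E i (op_adj (a i) o\<^sub>L a i)))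
          + sqrt (norm (\<Sum>i\<in>F. E i (a i o\<^sub>L op_adj (a i))))) * ?m f"
    unfolding eq distrib_right
    using Zm mnorm_create[OF F aA Ea f] mnorm_preserve[OF F aA Ea f S] mnorm_annihilate[OF F aA Ea f]
    by linarith
qed

section \<open>Passage to the completion\<close>

abbreviation "Fcls \<equiv> cls prefock prefock_ip"

lemma Cau_sum_pre_pi:
  assumes F: "finite F" and aA: "\<And>i. i \<in> F \<Longrightarrow> a i \<in> A i" and Ea: "\<And>i. i \<in> F \<Longrightarrow> E i (a i) = 0"
    and s: "s \<in> P.Cau"
  shows "(\<lambda>n. \<Sum>i\<in>F. pre_pi i (a i) (s n)) \<in> P.Cau"
proof -
  \<comment> \<open>Any bound of the \<open>norm (a i)\<close> will do, since only some Lipschitz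
    constant is wanted here.\<close>
  define S where "S = (\<Sum>i\<in>F. norm (a i))"
  have S: "S \<ge> 0" "\<And>i. i \<in> F \<Longrightarrow> norm (a i) \<le> S"
    unfolding S_def using F by (auto intro: sum_nonneg member_le_sum)
  let ?C = "S + sqrt (norm (\<Sum>i\<in>F. E i (op_adj (a i) o\<^sub>L a i)))
    + sqrt (norm (\<Sum>i\<in>F. E i (a i o\<^sub>L op_adj (a i))))"
  have mem: "(\<Sum>i\<in>F. pre_pi i (a i) f) \<in> prefock" if "f \<in> prefock" for f
    using F aA Ea S that by (rule mnorm_sum_pre_pi(1))
  have le: "mnorm prefock_ip (\<Sum>i\<in>F. pre_pi i (a i) f) \<le> ?C * mnorm prefock_ip f" if "f \<in> prefock" for f
    using F aA Ea S that by (rule mnorm_sum_pre_pi(2))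
  show ?thesis
  proof (rule P.Cau_image[OF s])
    show "(\<Sum>i\<in>F. pre_pi i (a i) (s n)) \<in> prefock" for n by (intro mem P.Cau_mem s)
    fix m n
    have "s m - s n \<in> prefock" by (intro P.diff_in P.Cau_mem s)
    from le[OF this] show "mnorm prefock_ip ((\<Sum>i\<in>F. pre_pi i (a i) (s m)) - (\<Sum>i\<in>F. pre_pi i (a i) (s n)))
      \<le> ?C * mnorm prefock_ip (s m - s n)"
      by (simp add: pre_pi_diff sum_subtractf)
  qed
qed

text \<open>Sums on one representing sequence and forms a single class at the end, whereas addition
  of operators forms a class at each step and chooses new representatives. Empty \<open>F\<close>
  gives the zero operator.\<close>

definition sum_hom :: "'i set \<Rightarrow> ('i \<Rightarrow> 'h op) \<Rightarrow> ('i, 'h, 'k) fvec \<Rightarrow> ('i, 'h, 'k) fvec" where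
  "sum_hom F a = (\<lambda>\<xi>\<in>fock. Fcls (\<lambda>n. \<Sum>i\<in>F. pre_pi i (a i) (rep \<xi> n)))"

section \<open>Finite sums in the generated algebra\<close>

lemma free_product_add: "add reduced_free_product S T = (\<lambda>\<xi>\<in>fock. cadd prefock prefock_ip (S \<xi>) (T \<xi>))"
  and free_product_zero: "zero reduced_free_product = (\<lambda>\<xi>\<in>fock. emb prefock prefock_ip 0)"
  and free_product_nrm: "nrm reduced_free_product T
    = (SUP \<xi>\<in>{\<xi> \<in> fock. mnorm fock_ip \<xi> \<le> 1}. mnorm fock_ip (T \<xi>))"
  by (simp_all add: reduced_free_product_def generated_cstar_def adjointable_def)

lemma free_product_carrier:
  "carrier reduced_free_product
    = \<Inter>{C. (\<Union>i. canonical_hom i ` A i) \<subseteq> C \<and> cstar_closed adjointable C}"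
  by (simp add: reduced_free_product_def generated_cstar_def)

lemma free_product_add_closed:
  assumes "S \<in> carrier reduced_free_product" "T \<in> carrier reduced_free_product"
  shows "add reduced_free_product S T \<in> carrier reduced_free_product"
proof -
  have "add reduced_free_product = add adjointable"
    by (simp add: reduced_free_product_def generated_cstar_def)
  moreover have "add adjointable S T \<in> C"
    if C: "(\<Union>i. canonical_hom i ` A i) \<subseteq> C" "cstar_closed adjointable C" for C
  proof -
    have "S \<in> C" "T \<in> C" using assms C unfolding free_product_carrier by blast+
    then show ?thesis using C(2) unfolding cstar_closed_def by blast
  qed
  ultimately show ?thesis unfolding free_product_carrier by simp
qed

lemma free_product_generator: "a \<in> A i \<Longrightarrow> canonical_hom i a \<in> carrier reduced_free_product"
  unfolding free_product_carrier by blast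

text \<open>\<open>cstar_closed\<close> lists no zero element, but it is 0 times the generator
  \<open>canonical_hom i 0\<close>; an index exists because types are inhabited.\<close>

lemma free_product_zero_closed: "zero reduced_free_product \<in> carrier reduced_free_product"
proof -
  have "Poly_Mapping.map (op_scale 0) f = (0 :: ('i, 'h, 'k) prefock)" for f
    by (rule poly_mapping_eqI) (simp add: map.rep_eq when_def)
  then have zero: "scal adjointable 0 T = zero reduced_free_product" for T
    unfolding free_product_zero by (simp add: adjointable_def cmap_def emb_def)
  have "scal adjointable 0 (canonical_hom i 0) \<in> C"
    if "(\<Union>i. canonical_hom i ` A i) \<subseteq> C" "cstar_closed adjointable C" for i C
  proof -
    have "canonical_hom i 0 \<in> C" using that(1) A.zero_mem by blast
    then show ?thesis using that(2) unfolding cstar_closed_def by blast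
  qed
  then show ?thesis unfolding zero free_product_carrier by simp
qed

text \<open>\<open>cadd\<close> picks representatives of both classes afresh, so the two sequences
  agree only up to a null sequence. The estimate for finite sums of the \<open>pre_pi\<close> is
  what makes them Cauchy.\<close>

lemma add_sum_hom:
  assumes F: "finite F" "i \<notin> F" and aA: "\<And>j. a j \<in> A j" and Ea: "\<And>j. E j (a j) = 0"
  shows "add reduced_free_product (canonical_hom i (a i)) (sum_hom F a) = sum_hom (insert i F) a"
  unfolding free_product_add sum_hom_def
proof (rule restrict_ext)
  fix \<xi> assume \<xi>: "\<xi> \<in> fock"
  let ?r = "rep \<xi>"
  have r: "?r \<in> P.Cau" using \<xi> unfolding fock_def by (rule P.rep_Cau)
  let ?s = "\<lambda>n. pre_pi i (a i) (?r n)" and ?t = "\<lambda>n. \<Sum>i\<in>F. pre_pi i (a i) (?r n)"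
  have s: "?s \<in> P.Cau" using Cau_sum_pre_pi[of "{i}" a ?r] aA Ea r by simp
  have t: "?t \<in> P.Cau" by (intro Cau_sum_pre_pi F aA Ea r)
  have st: "(\<lambda>n. \<Sum>i\<in>insert i F. pre_pi i (a i) (?r n)) \<in> P.Cau" by (intro Cau_sum_pre_pi aA Ea r) (use F in simp)
  let ?s' = "rep (Fcls ?s)" and ?t' = "rep (Fcls ?t)"
  note s' = P.rep_cls[OF s] and t' = P.rep_cls[OF t]
  have nd: "(\<lambda>n. mnorm prefock_ip ((\<Sum>i\<in>insert i F. pre_pi i (a i) (?r n)) - (?s' n + ?t' n))) \<longlonglongrightarrow> 0"
  proof (rule tendsto_sandwich[OF _ _ tendsto_const])
    show "(\<lambda>n. mnorm prefock_ip (?s n - ?s' n) + mnorm prefock_ip (?t n - ?t' n)) \<longlonglongrightarrow> 0"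
      using tendsto_add[OF s'(2) t'(2)] by simp
    show "\<forall>\<^sub>F n in sequentially. mnorm prefock_ip ((\<Sum>i\<in>insert i F. pre_pi i (a i) (?r n)) - (?s' n + ?t' n))
        \<le> mnorm prefock_ip (?s n - ?s' n) + mnorm prefock_ip (?t n - ?t' n)"
    proof (intro always_eventually allI)
      fix n
      have eq: "(\<Sum>i\<in>insert i F. pre_pi i (a i) (?r n)) - (?s' n + ?t' n) = (?s n - ?s' n) + (?t n - ?t' n)"
        using F by simp
      show "mnorm prefock_ip ((\<Sum>i\<in>insert i F. pre_pi i (a i) (?r n)) - (?s' n + ?t' n))
        \<le> mnorm prefock_ip (?s n - ?s' n) + mnorm prefock_ip (?t n - ?t' n)"
        unfolding eq by (intro P.mnorm_add_le P.diff_in P.Cau_mem[OF s] P.Cau_mem[OF t] P.Cau_mem[OF s'(1)] P.Cau_mem[OF t'(1)])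
    qed
  qed auto
  have st': "(\<lambda>n. ?s' n + ?t' n) \<in> P.Cau"
    by (rule P.Cau_equiv[OF st _ nd]) (intro P.add_in P.Cau_mem[OF s'(1)] P.Cau_mem[OF t'(1)])
  have "Fcls (\<lambda>n. \<Sum>i\<in>insert i F. pre_pi i (a i) (?r n)) = Fcls (\<lambda>n. ?s' n + ?t' n)"
    by (rule P.cls_eq[OF st st' nd])
  then show "cadd prefock prefock_ip (canonical_hom i (a i) \<xi>) ((\<lambda>\<xi>\<in>fock. Fcls (\<lambda>n. \<Sum>i\<in>F. pre_pi i (a i) (rep \<xi> n))) \<xi>)
      = Fcls (\<lambda>n. \<Sum>i\<in>insert i F. pre_pi i (a i) (?r n))"
    using \<xi> by (simp add: cadd_def canonical_hom_def cmap_def)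
qed

text \<open>Arguing on the graph of the fold avoids having to know that the carrier of the free product
  is an additive group of adjointable operators; closure under addition is enough.\<close>

lemma finsum_canonical_hom:
  assumes F: "finite F" and aA: "\<And>j. a j \<in> A j" and Ea: "\<And>j. E j (a j) = 0"
  shows "finsum reduced_free_product (\<lambda>i. canonical_hom i (a i)) F = sum_hom F a"
proof -
  let ?R = reduced_free_product
  let ?g = "add ?R \<circ> (\<lambda>i. canonical_hom i (a i))"
  let ?fold = "foldSetD (carrier ?R) ?g (zero ?R)"
  have zero: "zero ?R = sum_hom {} a"
    unfolding free_product_zero sum_hom_def by (simp add: emb_def)
  \<comment> \<open>Uniqueness by rule induction on the graph: whatever the order of insertion, the
    value reached is \<open>sum_hom\<close>.\<close>
  have uniq: "x = sum_hom G a" if "(G, x) \<in> ?fold" "finite G" for G x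
    using that
  proof (induction rule: foldSetD.induct)
    case (insertI i G y)
    then show ?case using aA Ea by (simp add: add_sum_hom)
  qed (simp add: zero)
  \<comment> \<open>Existence: each rule of \<open>foldSetD\<close> demands that the new value lie
    in the carrier.\<close>
  have "(G, sum_hom G a) \<in> ?fold" if "finite G" for G
    using that
  proof (induction rule: finite_induct)
    case empty
    then show ?case using foldSetD.emptyI[OF free_product_zero_closed] zero by simp
  next
    case (insert i G)
    have "sum_hom G a \<in> carrier ?R" by (rule foldSetD_closed[OF insert.IH])
    then have "?g i (sum_hom G a) \<in> carrier ?R"
      by (simp add: free_product_add_closed free_product_generator aA)
    then have "(insert i G, ?g i (sum_hom G a)) \<in> ?fold"
      by (intro foldSetD.insertI insert)
    moreover have "?g i (sum_hom G a) = sum_hom (insert i G) a"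
      using insert.hyps aA Ea by (simp add: add_sum_hom)
    ultimately show ?case by (simp only:)
  qed
  then have "foldD (carrier ?R) ?g (zero ?R) F = sum_hom F a"
    unfolding foldD_def using uniq F by (intro the_equality) auto
  then show ?thesis using F by (simp add: finsum_def finprod_def)
qed

lemma nrm_sum_hom_le:
  assumes F: "finite F" and aA: "\<And>i. i \<in> F \<Longrightarrow> a i \<in> A i" and Ea: "\<And>i. i \<in> F \<Longrightarrow> E i (a i) = 0"
    and S: "S \<ge> 0" "\<And>i. i \<in> F \<Longrightarrow> norm (a i) \<le> S"
  shows "nrm reduced_free_product (sum_hom F a)
    \<le> S + sqrt (norm (\<Sum>i\<in>F. E i (op_adj (a i) o\<^sub>L a i)))
        + sqrt (norm (\<Sum>i\<in>F. E i (a i o\<^sub>L op_adj (a i))))"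
    (is "_ \<le> ?C")
  unfolding free_product_nrm
proof (rule cSUP_least)
  \<comment> \<open>A common bound of the values bounds the supremum only over a nonempty set; the
    zero vector lies in the unit ball.\<close>
  have "emb prefock prefock_ip 0 \<in> fock"
    unfolding fock_def emb_def by (intro P.cls_mem P.Cau_const prefock_zero)
  moreover have "mnorm fock_ip (emb prefock prefock_ip 0) = 0"
    using P.mnorm_cip[OF P.Cau_const[OF prefock_zero]] by (simp add: fock_ip_def emb_def LIMSEQ_const_iff)
  ultimately show "{\<xi> \<in> fock. mnorm fock_ip \<xi> \<le> 1} \<noteq> {}" by fastforce
next
  fix \<xi> assume "\<xi> \<in> {\<xi> \<in> fock. mnorm fock_ip \<xi> \<le> 1}"
  then have \<xi>: "\<xi> \<in> fock" "mnorm fock_ip \<xi> \<le> 1" by auto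
  let ?r = "rep \<xi>" and ?T = "\<lambda>f. \<Sum>i\<in>F. pre_pi i (a i) f"
  have r: "?r \<in> P.Cau" using \<xi> unfolding fock_def by (intro P.rep_Cau)
  have t: "(\<lambda>n. ?T (?r n)) \<in> P.Cau" by (intro Cau_sum_pre_pi F aA Ea r)
  have "(\<lambda>n. mnorm prefock_ip (?r n)) \<longlonglongrightarrow> mnorm fock_ip \<xi>"
    using P.mnorm_cip[OF r] P.cls_rep[of \<xi>] \<xi> by (simp add: fock_ip_def fock_def)
  then have 1: "(\<lambda>n. ?C * mnorm prefock_ip (?r n)) \<longlonglongrightarrow> ?C * mnorm fock_ip \<xi>"
    by (rule tendsto_mult_left)
  have 2: "(\<lambda>n. mnorm prefock_ip (?T (?r n))) \<longlonglongrightarrow> mnorm fock_ip (sum_hom F a \<xi>)"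
    using P.mnorm_cip[OF t] \<xi> by (simp add: fock_ip_def sum_hom_def)
  have "mnorm fock_ip (sum_hom F a \<xi>) \<le> ?C * mnorm fock_ip \<xi>"
    using mnorm_sum_pre_pi(2)[OF F aA Ea S P.Cau_mem[OF r]] by (intro LIMSEQ_le[OF 2 1]) auto
  also have "\<dots> \<le> ?C" using \<xi>(2) S(1) by (intro mult_left_le) auto
  finally show "mnorm fock_ip (sum_hom F a \<xi>) \<le> ?C" .
qed

end

theorem proposition7p1:
  fixes B :: "'k::complex_hilbert op set"
    and A :: "'i \<Rightarrow> 'h::complex_hilbert op set"
    and \<iota> :: "'i \<Rightarrow> 'k op \<Rightarrow> 'h op"
    and E :: "'i \<Rightarrow> 'h op \<Rightarrow> 'k op"
    and a :: "'i \<Rightarrow> 'h op"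
  assumes "von_neumann_algebra B"
    and "\<And>i. von_neumann_algebra (A i)"
    and "\<And>i. vn_inclusion B (A i) (\<iota> i)"
    and "\<And>i. conditional_expectation B (A i) (\<iota> i) (E i)"
    and "\<And>i. normal_map (A i) B (E i)"
    and "\<And>i. faithful_on (A i) (E i)"
    and "\<And>i. a i \<in> A i"
    and "\<And>i. E i (a i) = 0"
    and "finite {i. a i \<noteq> 0}"
  shows "nrm (amalgam.reduced_free_product B A \<iota> E)
           (\<Oplus>\<^bsub>amalgam.reduced_free_product B A \<iota> E\<^esub> i\<in>{i. a i \<noteq> 0}.
              amalgam.canonical_hom B A \<iota> E i (a i))
         \<le> (SUP i. norm (a i))
           + sqrt (norm (\<Sum>i | a i \<noteq> 0. E i (op_adj (a i) o\<^sub>L a i)))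
           + sqrt (norm (\<Sum>i | a i \<noteq> 0. E i (a i o\<^sub>L op_adj (a i))))"
proof -
  interpret amalgam_expectation B A \<iota> E
    by unfold_locales (rule assms)+
  \<comment> \<open>The supremum runs over the whole, possibly infinite, index type. Its values form
    a finite set, which gives the boundedness that \<open>cSUP_upper\<close> requires.\<close>
  have "range (\<lambda>i. norm (a i)) \<subseteq> insert 0 ((\<lambda>i. norm (a i)) ` {i. a i \<noteq> 0})" by auto
  then have "finite (range (\<lambda>i. norm (a i)))" by (rule finite_subset) (use assms(9) in simp)
  then have S: "norm (a i) \<le> (SUP i. norm (a i))" for i
    by (intro cSUP_upper bdd_above_finite) auto
  then have "0 \<le> (SUP i. norm (a i))" using norm_ge_zero order_trans by blast
  then show ?thesis
    unfolding finsum_canonical_hom[OF assms(9,7,8)]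
    by (intro nrm_sum_hom_le assms S)
qed

end
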